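(* Let $g,h,k>0$ be fixed and let $\mu_1^*=\tanh(kh)/k$. The second variation $\frac{\delta^2\Lambda}{\delta w^2}$ below is evaluated with $h$, $k$ and $Q$ (equivalently $\mu=(Q-2gh)/g$) held fixed, on mean-zero variations $u\in H^1_{2\pi,\circ}(\mathbb{R})$. (1) The trivial solution $w=0$ is strictly variationally stable for $\mu>\frac{\tanh(kh)}{k}$, weakly variationally stable and degenerate at $\mu=\mu_1^*$, and variationally unstable for $\mu<\mu_1^*$. At $\mu=\mu_1^*$ the kernel of $\frac{\delta^2\Lambda}{\delta w^2}(0,h)$ is spanned by $\cos x$ and $\sin x$. (2) Let $(\mu(\varepsilon),w_\varepsilon)$ be the primary even branch, with $w_\varepsilon=\varepsilon\cos x+o(\varepsilon)$. Then for all sufficiently small $\varepsilon\neq0$ there exists an even mean-zero variation $u_\varepsilon\in H^1_{2\pi,\circ}(\mathbb{R})$ such that $$\frac{\delta^2\Lambda}{\delta w^2}(w_\varepsilon,h)(u_\varepsilon,u_\varepsilon)<0$$ (where $Q=g\mu(\varepsilon)+2gh$). Thus the non-trivial primary branch is variationally unstable in the fixed-$h$ problem.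
   Context: Notation. $[f]_{2\pi}=\frac1{2\pi}\int_0^{2\pi}f\,dx$. $H^1_{2\pi,\circ}(\mathbb{R})$ is the space of real-valued $2\pi$-periodic $H^1$ functions with zero mean. $C^{2,\alpha}_{2\pi,e}(\mathbb{R})$ is the space of even $2\pi$-periodic $C^{2,\alpha}$ functions ($0<\alpha<1$). For $D>0$, $\mathcal{C}_D$ is the Fourier multiplier on mean-zero $2\pi$-periodic $L^2$ functions with $\mathcal{C}_D(e^{inx})=-i\coth(nD)e^{inx}$, $n\in\mathbb{Z}\setminus\{0\}$. Equation. For $\mu\in\mathbb{R}$ and a mean-zero function $w$, consider $$\mu\,\mathcal{C}_{kh}(w')=\frac{w}{k}+w\,\mathcal{C}_{kh}(w')+\mathcal{C}_{kh}(ww')-[w\,\mathcal{C}_{kh}(w')]_{2\pi}.\qquad (\ast)$$ Here $\mu=(Q-2gh)/g$ with $Q\in\mathbb{R}$. With $v=w+h$, $(\ast)$ is the mean-zero-projected Euler--Lagrange equation in $w$ of $$\Lambda(w,h)=\int_0^{2\pi}(Qv-gv^2)\Big(\frac1k+\mathcal{C}_{kh}(w')\Big)+\frac{m^2}{kh}\,dx,$$ where $m$ is a constant (the mass flux) that affects neither $(\ast)$ nor the second variation in $w$. Critical points are the solutions $w$ of $(\ast)$; $w=0$ is a solution for every $\mu$ (the trivial solution). Second variation. For $u\in H^1_{2\pi,\circ}(\mathbb{R})$, $$\frac{\delta^2\Lambda}{\delta w^2}(w,h)(u,u)=\frac{d^2}{ds^2}\Big|_{s=0}\Lambda(w+su,h)=2\int_0^{2\pi}(Q-2gv)\,u\,\mathcal{C}_{kh}(u')-g\Big(\frac1k+\mathcal{C}_{kh}(w')\Big)u^2\,dx;$$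 its kernel is the kernel of the associated symmetric bilinear form on $H^1_{2\pi,\circ}(\mathbb{R})$. Stability notions (admissible variations $H^1_{2\pi,\circ}(\mathbb{R})$). A critical point $w$ is strictly variationally stable if $\frac{\delta^2\Lambda}{\delta w^2}(w,h)(u,u)>0$ for all nonzero admissible $u$; weakly variationally stable if this quantity is $\ge0$ for all admissible $u$; variationally unstable if it is negative for some admissible $u$; degenerate if the kernel is nontrivial. Primary branch. By a known local bifurcation theorem (Crandall--Rabinowitz), $(\ast)$ has a continuous curve of solutions $(\mu(\varepsilon),w_\varepsilon)$, $|\varepsilon|<\varepsilon_0$, in $\mathbb{R}\times C^{2,\alpha}_{2\pi,e}(\mathbb{R})$, with $w_\varepsilon$ of zero mean, $(\mu(0),w_0)=(\mu_1^*,0)$, $w_\varepsilon(x)=\varepsilon\cos x+o(\varepsilon)$ as $\varepsilon\to0$, such that all solutions of $(\ast)$ with $w\neq0$ in some neighborhood of $(\mu_1^*,0)$ in $\mathbb{R}\times C^{2,\alpha}_{2\pi,e}(\mathbb{R})$ are the points $(\mu(\varepsilon),w_\varepsilon)$ with $\varepsilon\ne0$ small; the curve admits a real-analytic re-parametrization locally around each of its points. This is the primary even branch. *)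

theory Defs
  imports "HOL-Analysis.Analysis"
begin

section \<open>Periodic function spaces\<close>

definition periodic2pi :: "(real \<Rightarrow> real) \<Rightarrow> bool" where
  "periodic2pi f \<longleftrightarrow> (\<forall>x. f (x + 2 * pi) = f x)"

definition even_fun :: "(real \<Rightarrow> real) \<Rightarrow> bool" where
  "even_fun f \<longleftrightarrow> (\<forall>x. f (- x) = f x)"

definition mean2pi :: "(real \<Rightarrow> real) \<Rightarrow> real" where
  "mean2pi f = 1 / (2 * pi) * (LBINT x:{0..2*pi}. f x)"

text \<open>Members of \<open>L2per\<close> are Borel representatives of classes of
  \<open>2\<pi>\<close>-periodic square integrable functions; they are never compared pointwise.\<close>

definition L2per :: "(real \<Rightarrow> real) set" where
  "L2per = {f. f \<in> borel_measurable borel \<and> periodic2pi f \<and>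
               set_integrable lborel {0..2*pi} (\<lambda>x. (f x)\<^sup>2)}"

definition is_weak_deriv :: "(real \<Rightarrow> real) \<Rightarrow> (real \<Rightarrow> real) \<Rightarrow> bool" where
  "is_weak_deriv u v \<longleftrightarrow> v \<in> L2per \<and>
     (\<forall>a b. a \<le> b \<longrightarrow> u b - u a = (LBINT t:{a..b}. v t))"

text \<open>An element of \<open>H1per0\<close> is the continuous (absolutely continuous) representative
  of its class, so that it is nonzero in \<open>H\<^sup>1\<close> iff it is nonzero as a function.\<close>

definition H1per0 :: "(real \<Rightarrow> real) set" where
  "H1per0 = {u. periodic2pi u \<and> (\<exists>v. is_weak_deriv u v) \<and> mean2pi u = 0}"

text \<open>The weak derivative is determined only almost everywhere; \<open>wderiv\<close> selects a
  representative. The same applies to \<open>CC\<close> below. Both are used only under integrals or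
  almost everywhere.\<close>

definition wderiv :: "(real \<Rightarrow> real) \<Rightarrow> real \<Rightarrow> real" where
  "wderiv u = (SOME v. is_weak_deriv u v)"

definition fourier_coeff :: "(real \<Rightarrow> real) \<Rightarrow> int \<Rightarrow> complex" where
  "fourier_coeff f n =
     1 / (2 * of_real pi) * (CLBINT x:{0..2*pi}. of_real (f x) * exp (- \<i> * of_int n * of_real x))"

definition coth :: "real \<Rightarrow> real" where
  "coth x = cosh x / sinh x"

text \<open>The multiplier \<open>e\<^sup>i\<^sup>n\<^sup>x \<mapsto> -i coth(nD) e\<^sup>i\<^sup>n\<^sup>x\<close>, \<open>n \<noteq> 0\<close>, acting on real-valued mean-zero
  functions. It preserves real-valuedness because its symbol at \<open>-n\<close> is the complex conjugate
  of its symbol at \<open>n\<close>.\<close>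

definition CC :: "real \<Rightarrow> (real \<Rightarrow> real) \<Rightarrow> real \<Rightarrow> real" where
  "CC D f = (SOME F. F \<in> L2per \<and>
     (\<forall>n. fourier_coeff F n =
        (if n = 0 then 0 else - \<i> * of_real (coth (of_int n * D)) * fourier_coeff f n)))"


section \<open>The equation, the functional and its second variation\<close>

definition solves_eq :: "real \<Rightarrow> real \<Rightarrow> real \<Rightarrow> (real \<Rightarrow> real) \<Rightarrow> bool" where
  "solves_eq h k \<mu> w \<longleftrightarrow>
     (AE x in lborel. \<mu> * CC (k*h) (wderiv w) x =
        w x / k + w x * CC (k*h) (wderiv w) x
        + CC (k*h) (\<lambda>y. w y * wderiv w y) x
        - mean2pi (\<lambda>y. w y * CC (k*h) (wderiv w) y))"

definition Lam :: "real \<Rightarrow> real \<Rightarrow> real \<Rightarrow> real \<Rightarrow> (real \<Rightarrow> real) \<Rightarrow> real \<Rightarrow> real" where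
  "Lam g k m Q w h =
     (LBINT x:{0..2*pi}.
        (Q * (w x + h) - g * (w x + h)\<^sup>2) * (1 / k + CC (k*h) (wderiv w) x) + m\<^sup>2 / (k*h))"

definition second_var ::
  "real \<Rightarrow> real \<Rightarrow> real \<Rightarrow> real \<Rightarrow> real \<Rightarrow> (real \<Rightarrow> real) \<Rightarrow> (real \<Rightarrow> real) \<Rightarrow> real" where
  "second_var g h k m Q w u =
     deriv (deriv (\<lambda>s. Lam g k m Q (\<lambda>x. w x + s * u x) h)) 0"

text \<open>The symmetric bilinear form associated with the quadratic form \<open>second_var\<close>, by
  polarization.\<close>

definition second_var_form ::
  "real \<Rightarrow> real \<Rightarrow> real \<Rightarrow> real \<Rightarrow> real \<Rightarrow> (real \<Rightarrow> real) \<Rightarrow> (real \<Rightarrow> real) \<Rightarrow> (real \<Rightarrow> real) \<Rightarrow> real" where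
  "second_var_form g h k m Q w u v =
     (second_var g h k m Q w (\<lambda>x. u x + v x)
      - second_var g h k m Q w u - second_var g h k m Q w v) / 2"

definition second_var_kernel ::
  "real \<Rightarrow> real \<Rightarrow> real \<Rightarrow> real \<Rightarrow> real \<Rightarrow> (real \<Rightarrow> real) \<Rightarrow> (real \<Rightarrow> real) set" where
  "second_var_kernel g h k m Q w =
     {u \<in> H1per0. \<forall>v\<in>H1per0. second_var_form g h k m Q w u v = 0}"

definition critical_point :: "real \<Rightarrow> real \<Rightarrow> real \<Rightarrow> real \<Rightarrow> (real \<Rightarrow> real) \<Rightarrow> bool" where
  "critical_point g h k Q w \<longleftrightarrow> w \<in> H1per0 \<and> solves_eq h k ((Q - 2*g*h) / g) w"

definition strictly_variationally_stable ::
  "real \<Rightarrow> real \<Rightarrow> real \<Rightarrow> real \<Rightarrow> real \<Rightarrow> (real \<Rightarrow> real) \<Rightarrow> bool" where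
  "strictly_variationally_stable g h k m Q w \<longleftrightarrow> critical_point g h k Q w \<and>
     (\<forall>u\<in>H1per0. u \<noteq> (\<lambda>x. 0) \<longrightarrow> second_var g h k m Q w u > 0)"

definition weakly_variationally_stable ::
  "real \<Rightarrow> real \<Rightarrow> real \<Rightarrow> real \<Rightarrow> real \<Rightarrow> (real \<Rightarrow> real) \<Rightarrow> bool" where
  "weakly_variationally_stable g h k m Q w \<longleftrightarrow> critical_point g h k Q w \<and>
     (\<forall>u\<in>H1per0. second_var g h k m Q w u \<ge> 0)"

definition variationally_unstable ::
  "real \<Rightarrow> real \<Rightarrow> real \<Rightarrow> real \<Rightarrow> real \<Rightarrow> (real \<Rightarrow> real) \<Rightarrow> bool" where
  "variationally_unstable g h k m Q w \<longleftrightarrow> critical_point g h k Q w \<and>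
     (\<exists>u\<in>H1per0. second_var g h k m Q w u < 0)"

definition degenerate ::
  "real \<Rightarrow> real \<Rightarrow> real \<Rightarrow> real \<Rightarrow> real \<Rightarrow> (real \<Rightarrow> real) \<Rightarrow> bool" where
  "degenerate g h k m Q w \<longleftrightarrow> critical_point g h k Q w \<and>
     (\<exists>u\<in>second_var_kernel g h k m Q w. u \<noteq> (\<lambda>x. 0))"


section \<open>The primary even branch\<close>

definition C2per_e :: "real \<Rightarrow> (real \<Rightarrow> real) set" where
  "C2per_e \<alpha> = {w. periodic2pi w \<and> even_fun w \<and>
     (\<forall>x. w differentiable (at x)) \<and> (\<forall>x. deriv w differentiable (at x)) \<and>
     (\<exists>K. \<forall>x y. \<bar>deriv (deriv w) x - deriv (deriv w) y\<bar> \<le> K * \<bar>x - y\<bar> powr \<alpha>)}"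

definition C2_norm :: "real \<Rightarrow> (real \<Rightarrow> real) \<Rightarrow> real" where
  "C2_norm \<alpha> w = (SUP x. \<bar>w x\<bar>) + (SUP x. \<bar>deriv w x\<bar>) + (SUP x. \<bar>deriv (deriv w) x\<bar>)
     + (SUP (x, y) \<in> {(x, y). x \<noteq> y}.
          \<bar>deriv (deriv w) x - deriv (deriv w) y\<bar> / \<bar>x - y\<bar> powr \<alpha>)"

text \<open>Around the parameter value \<open>e\<close>, a curve in \<open>\<real> \<times> C2per_e \<alpha>\<close> parametrized over
  \<open>(-\<epsilon>\<^sub>0, \<epsilon>\<^sub>0)\<close> becomes, after a continuous injective change of parameter \<open>\<phi>\<close>, the sum of a
  norm-convergent power series. Such a \<open>\<phi>\<close> is a homeomorphism onto an open interval
  around \<open>e\<close>.\<close>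

definition analytic_reparam_at ::
  "real \<Rightarrow> real \<Rightarrow> (real \<Rightarrow> real) \<Rightarrow> (real \<Rightarrow> real \<Rightarrow> real) \<Rightarrow> real \<Rightarrow> bool" where
  "analytic_reparam_at \<alpha> \<epsilon>0 \<mu> w e \<longleftrightarrow>
     (\<exists>\<delta>>0. \<exists>\<phi>::real \<Rightarrow> real. \<exists>M::nat \<Rightarrow> real. \<exists>W::nat \<Rightarrow> real \<Rightarrow> real.
        \<phi> 0 = e \<and> continuous_on {-\<delta><..<\<delta>} \<phi> \<and> inj_on \<phi> {-\<delta><..<\<delta>} \<and>
        \<phi> ` {-\<delta><..<\<delta>} \<subseteq> {-\<epsilon>0<..<\<epsilon>0} \<and>
        (\<forall>j. W j \<in> C2per_e \<alpha>) \<and>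
        (\<forall>s\<in>{-\<delta><..<\<delta>}.
           (\<lambda>j. M j * s ^ j) sums \<mu> (\<phi> s) \<and>
           (\<lambda>N. C2_norm \<alpha> (\<lambda>x. w (\<phi> s) x - (\<Sum>j<N. s ^ j * W j x))) \<longlonglongrightarrow> 0))"

definition primary_even_branch ::
  "real \<Rightarrow> real \<Rightarrow> real \<Rightarrow> real \<Rightarrow> (real \<Rightarrow> real) \<Rightarrow> (real \<Rightarrow> real \<Rightarrow> real) \<Rightarrow> bool" where
  "primary_even_branch h k \<alpha> \<epsilon>0 \<mu> w \<longleftrightarrow>
     \<epsilon>0 > 0 \<and>
     (\<forall>\<epsilon>\<in>{-\<epsilon>0<..<\<epsilon>0}. w \<epsilon> \<in> C2per_e \<alpha> \<and> mean2pi (w \<epsilon>) = 0 \<and> solves_eq h k (\<mu> \<epsilon>) (w \<epsilon>)) \<and>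
     continuous_on {-\<epsilon>0<..<\<epsilon>0} \<mu> \<and>
     (\<forall>e\<in>{-\<epsilon>0<..<\<epsilon>0}. ((\<lambda>\<epsilon>. C2_norm \<alpha> (\<lambda>x. w \<epsilon> x - w e x)) \<longlongrightarrow> 0) (at e)) \<and>
     \<mu> 0 = tanh (k*h) / k \<and> w 0 = (\<lambda>x. 0) \<and>
     ((\<lambda>\<epsilon>. C2_norm \<alpha> (\<lambda>x. w \<epsilon> x - \<epsilon> * cos x) / \<bar>\<epsilon>\<bar>) \<longlongrightarrow> 0) (at 0) \<and>
     (\<exists>r>0. \<forall>\<nu> z. z \<in> C2per_e \<alpha> \<and> mean2pi z = 0 \<and> solves_eq h k \<nu> z \<and> z \<noteq> (\<lambda>x. 0) \<and>
          \<bar>\<nu> - tanh (k*h) / k\<bar> < r \<and> C2_norm \<alpha> z < r \<longrightarrow>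
          (\<exists>\<epsilon>. \<epsilon> \<noteq> 0 \<and> \<bar>\<epsilon>\<bar> < \<epsilon>0 \<and> \<nu> = \<mu> \<epsilon> \<and> z = w \<epsilon>)) \<and>
     (\<forall>e\<in>{-\<epsilon>0<..<\<epsilon>0}. analytic_reparam_at \<alpha> \<epsilon>0 \<mu> w e)"

end

(*
The Fourier multiplier u -> C_D(u') has the even symbol lam n = n coth (n D), which is
increasing in |n|. At w = 0 the second variation is therefore diagonal,
4 pi g * sum (mu lam n - 1/k) |u_n|^2, and its sign is decided by the modes n = 1, -1, where
mu lam 1 = 1/k exactly at mu = tanh (k h) / k.

On the branch the functional is a quadratic plus a cubic, and the cubic part couples the modes
1 and 2. With a_n the (real) Fourier coefficients of w, the test function cos x + s cos 2x has
second variation 2 pi g times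
  (mu lam 1 - 1/k) - L a_2 - 2 s L a_1 + s^2 (mu lam 2 - 1/k) + o(eps^2),   L = 2 lam 1 + lam 2.
The first Fourier coefficient of the equation reads (mu lam 1 - 1/k) a_1 = L a_1 a_2 + o(eps^3),
so the terms without s cancel up to o(eps^2), and with B = lim (mu lam 2 - 1/k) > 0 the choice
s = a_1 L / B leaves -(L a_1)^2 / B + o(eps^2) < 0. Neither the second-order expansion of w nor
that of mu is needed: the equation gives lam n * a_n = O(eps^2) for |n| >= 2, and
w - eps cos x = o(eps) in C^2 makes the sum of these |a_n| an o(eps).
*)
theory Submission
  imports Defs
begin

section \<open>Fourier coefficients of functions on a period\<close>

text \<open>\<open>CC\<close> and \<open>wderiv\<close> only choose representatives, so every
  statement about them passes through Fourier coefficients: Riesz-Fischer shows that the chosen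
  function exists, uniqueness of coefficients identifies it almost everywhere. Coefficients of
  functions in \<open>H1per0\<close> are absolutely summable, so products with merely integrable
  functions become convergent convolution sums, and both the equation and the second variation turn
  into statements about one real sequence \<open>a\<close>. The obstacle on the branch is that the
  form at the bifurcation point vanishes on cos x. Its sign nearby is decided at order eps^2, where
  the shift of \<mu> and the value of a_2 both enter. They enter only through (\<mu> lam 1 - 1/k) -
  L a_2, which the first coefficient of the equation controls; the constant L is the same on both
  sides because both come from the symmetric trilinear form of the cubic part of \<open>Lam\<close>
  on the modes (1,1,2). What is left in that coefficient pairs two modes of modulus at least 2: one
  is o(eps) by the C2 norm, the other O(eps^2) by the equation. The product is o(eps^3), and
  dividing by a_1, of size eps/2, leaves o(eps^2).\<close>

definition circ :: "real measure" where
  "circ = restrict_space lborel {0..2*pi}"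

text \<open>Complex-valued counterpart of \<open>fourier_coeff\<close>: multiplication by an
  exponential, which shifts the index (\<open>fc_shift\<close>), leaves the real functions.\<close>

definition fc :: "(real \<Rightarrow> complex) \<Rightarrow> int \<Rightarrow> complex" where
  "fc F n = (LINT x|circ. F x * cis (- (of_int n * x))) / (2 * of_real pi)"

lemma space_circ [simp]: "space circ = {0..2*pi}"
  by (simp add: circ_def)

lemma finite_measure_circ: "finite_measure circ"
  by (rule finite_measureI) (simp add: circ_def emeasure_restrict_space)

interpretation circ: finite_measure circ
  by (rule finite_measure_circ)

lemma measure_circ: "measure circ {0..2*pi} = 2 * pi"
  by (simp add: circ_def measure_restrict_space)

lemma measurable_circ [measurable (raw)]:
  "f \<in> borel_measurable borel \<Longrightarrow> f \<in> borel_measurable circ"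
  unfolding circ_def by (rule measurable_restrict_space1) simp

lemma continuous_measurable_circ:
  fixes f :: "real \<Rightarrow> 'a::real_normed_vector"
  assumes "continuous_on {0..2*pi} f"
  shows "f \<in> borel_measurable circ"
proof -
  have "f \<in> borel_measurable (restrict_space borel {0..2*pi})"
    using assms by (rule borel_measurable_continuous_on_restrict)
  moreover have "sets circ = sets (restrict_space borel {0..2*pi})"
    by (simp add: circ_def sets_restrict_space)
  ultimately show ?thesis
    by (simp cong: measurable_cong_sets)
qed

lemma integrable_circ_bounded:
  fixes f :: "real \<Rightarrow> 'a::{banach,second_countable_topology}"
  assumes "f \<in> borel_measurable circ" "\<And>x. x \<in> {0..2*pi} \<Longrightarrow> norm (f x) \<le> B"
  shows "integrable circ f"
  using assms by (intro circ.integrable_const_bound[where B = B]) (auto intro!: AE_I2)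

lemma integrable_circ_continuous:
  fixes f :: "real \<Rightarrow> 'a::{banach,second_countable_topology}"
  assumes "continuous_on {0..2*pi} f"
  shows "integrable circ f"
proof -
  have "bounded (f ` {0..2*pi})"
    using assms by (intro compact_imp_bounded compact_continuous_image) auto
  then obtain B where "\<forall>x\<in>{0..2*pi}. norm (f x) \<le> B"
    by (auto simp: bounded_iff)
  then show ?thesis
    using assms by (intro integrable_circ_bounded[of _ B] continuous_measurable_circ) auto
qed

lemma integrable_circ_mult_bounded:
  fixes f g :: "real \<Rightarrow> 'a::{banach,second_countable_topology,real_normed_algebra}"
  assumes "integrable circ f" "g \<in> borel_measurable circ"
    "\<And>x. x \<in> {0..2*pi} \<Longrightarrow> norm (g x) \<le> B"
  shows "integrable circ (\<lambda>x. f x * g x)"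
proof (rule Bochner_Integration.integrable_bound)
  show "integrable circ (\<lambda>x. \<bar>B\<bar> * norm (f x))"
    using assms(1) by simp
  show "(\<lambda>x. f x * g x) \<in> borel_measurable circ"
    using assms by measurable
  show "AE x in circ. norm (f x * g x) \<le> norm (\<bar>B\<bar> * norm (f x))"
  proof (rule AE_I2)
    fix x assume "x \<in> space circ"
    then have "norm (g x) \<le> \<bar>B\<bar>" using assms(3)[of x] by auto
    then show "norm (f x * g x) \<le> norm (\<bar>B\<bar> * norm (f x))"
      using norm_mult_ineq[of "f x" "g x"] mult_left_mono[of "norm (g x)" "\<bar>B\<bar>" "norm (f x)"]
      by (simp add: mult.commute)
  qed
qed

lemma integrable_circ_mult_continuous:
  fixes f g :: "real \<Rightarrow> 'a::{banach,second_countable_topology,real_normed_algebra}"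
  assumes "integrable circ f" "continuous_on {0..2*pi} g"
  shows "integrable circ (\<lambda>x. f x * g x)"
proof -
  have "bounded (g ` {0..2*pi})"
    using assms by (intro compact_imp_bounded compact_continuous_image) auto
  then obtain B where "\<forall>x\<in>{0..2*pi}. norm (g x) \<le> B"
    by (auto simp: bounded_iff)
  then show ?thesis
    using assms by (intro integrable_circ_mult_bounded[of _ _ B] continuous_measurable_circ) auto
qed

lemma integrable_circ_cis:
  assumes "integrable circ F"
  shows "integrable circ (\<lambda>x. F x * cis (c * x))"
  by (rule integrable_circ_mult_continuous[OF assms]) (intro continuous_intros)

lemma integrable_fc:
  assumes "integrable circ F"
  shows "integrable circ (\<lambda>x. F x * cis (- (of_int n * x)))"
  using integrable_circ_cis[OF assms, of "- of_int n"] by simp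

lemma LBINT_circ:
  fixes f :: "real \<Rightarrow> 'a::{banach,second_countable_topology}"
  shows "(LBINT x:{0..2*pi}. f x) = (LINT x|circ. f x)"
  by (simp add: circ_def integral_restrict_space set_lebesgue_integral_def)

lemma set_integrable_circ:
  fixes f :: "real \<Rightarrow> 'a::{banach,second_countable_topology}"
  shows "set_integrable lborel {0..2*pi} f \<longleftrightarrow> integrable circ f"
  by (simp add: circ_def integrable_restrict_space set_integrable_def)

lemma fourier_coeff_fc: "fourier_coeff f n = fc (\<lambda>x. of_real (f x)) n"
  by (simp add: fourier_coeff_def fc_def LBINT_circ cis_conv_exp mult.assoc)

lemma AE_circ: "(AE x in lborel. P x) \<Longrightarrow> (AE x in circ. P x)"
  unfolding circ_def by (subst AE_restrict_space_iff) auto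

lemma measurable_cis_uminus_circ [measurable]: "(\<lambda>x. cis (- (c * x))) \<in> borel_measurable circ"
  by (intro continuous_measurable_circ continuous_intros)

lemma fc_cong_AE:
  assumes "AE x in circ. F x = G x" "F \<in> borel_measurable circ" "G \<in> borel_measurable circ"
  shows "fc F n = fc G n"
  unfolding fc_def
  by (rule arg_cong2[where f="(/)"], rule Bochner_Integration.integral_cong_AE)
     (use assms in \<open>auto intro!: borel_measurable_times\<close>)

lemma fc_add:
  assumes "integrable circ F" "integrable circ G"
  shows "fc (\<lambda>x. F x + G x) n = fc F n + fc G n"
  using integrable_fc[OF assms(1), of n] integrable_fc[OF assms(2), of n]
  by (simp add: fc_def ring_distribs add_divide_distrib)

lemma fc_diff:
  assumes "integrable circ F" "integrable circ G"
  shows "fc (\<lambda>x. F x - G x) n = fc F n - fc G n"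
  using integrable_fc[OF assms(1), of n] integrable_fc[OF assms(2), of n]
  by (simp add: fc_def ring_distribs diff_divide_distrib)

lemma fc_cmult: "fc (\<lambda>x. c * F x) n = c * fc F n"
  by (simp add: fc_def mult.assoc)

lemma fc_zero [simp]: "fc (\<lambda>x. 0) n = 0"
  by (simp add: fc_def)

lemma fc_sum:
  assumes "\<And>i. i \<in> I \<Longrightarrow> integrable circ (F i)"
  shows "fc (\<lambda>x. \<Sum>i\<in>I. F i x) n = (\<Sum>i\<in>I. fc (F i) n)"
proof (cases "finite I")
  case True
  then show ?thesis
    using assms by (induction I rule: finite_induct) (auto simp: fc_add)
qed simp

lemma fc_shift: "fc (\<lambda>x. F x * cis (of_int m * x)) n = fc F (n - m)"
  unfolding fc_def by (simp add: mult.assoc cis_mult algebra_simps)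

section \<open>Integrals and orthogonality of exponentials\<close>

lemma integral_cis_Icc:
  assumes "n \<noteq> 0" "a \<le> b"
  shows "(LINT x|lborel. indicator {a..b} x *\<^sub>R cis (of_int n * x))
    = (cis (of_int n * b) - cis (of_int n * a)) / (\<i> * of_int n)"
proof -
  let ?F = "\<lambda>x. cis (of_int n * x) / (\<i> * of_int n)"
  have "(LINT x|lborel. indicator {a..b} x *\<^sub>R cis (of_int n * x)) = ?F b - ?F a"
  proof (rule integral_FTC_atLeastAtMost[OF assms(2)])
    fix x :: real
    have "((\<lambda>x. exp (\<i> * of_int n * of_real x) / (\<i> * of_int n)) has_vector_derivative
            exp (\<i> * of_int n * of_real x)) (at x within {a..b})"
      using assms
      by (auto intro!: derivative_eq_intros has_vector_derivative_real_field simp: field_simps)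
    then show "(?F has_vector_derivative cis (of_int n * x)) (at x within {a..b})"
      by (simp add: cis_conv_exp mult.assoc)
  qed (auto intro!: continuous_intros)
  then show ?thesis by (simp add: diff_divide_distrib)
qed

lemma cis_int_2pi [simp]: "cis (of_int n * (2*pi)) = 1"
  using cis_multiple_2pi[of "of_int n"] by (simp add: mult.commute mult.left_commute)

lemma integral_cis:
  "(LINT x|circ. cis (of_int n * x)) = (if n = 0 then 2 * of_real pi else 0)"
proof (cases "n = 0")
  case True
  then show ?thesis by (simp add: measure_circ scaleR_conv_of_real)
next
  case False
  then show ?thesis
    using integral_cis_Icc[of n 0 "2*pi"] cis_int_2pi[of n] by (simp add: circ_def integral_restrict_space)
qed

lemma fc_cis: "fc (\<lambda>x. cis (of_int m * x)) n = (if n = m then 1 else 0)"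
proof -
  have "(\<lambda>x. cis (of_int m * x) * cis (- (of_int n * x))) = (\<lambda>x. cis (of_int (m - n) * x))"
    by (simp add: cis_mult algebra_simps)
  then show ?thesis
    by (simp add: fc_def integral_cis del: of_int_diff)
qed

lemma fc_cnj: "fc (\<lambda>x. cnj (F x)) n = cnj (fc F (- n))"
proof -
  have "(\<lambda>x. cnj (F x) * cis (- (of_int n * x))) = (\<lambda>x. cnj (F x * cis (of_int n * x)))"
    by (simp add: cis_cnj)
  then show ?thesis
    unfolding fc_def by (simp del: complex_cnj_mult) simp
qed

section \<open>Uniqueness of Fourier coefficients\<close>

text \<open>On the unit circle a real-linear functional of z is a combination of z and 1/z, so
  multiplying by it only shifts Fourier indices by 1 and -1. The induction keeps \<open>F\<close>
  arbitrary so that the product case can apply the two hypotheses one after the other.\<close>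

lemma fc_zero_mult_real_polynomial:
  assumes "real_polynomial_function p"
    and "integrable circ F" "\<And>n. fc F n = 0"
  shows "integrable circ (\<lambda>x. F x * of_real (p (cis x))) \<and> (\<forall>n. fc (\<lambda>x. F x * of_real (p (cis x))) n = 0)"
  using assms
proof (induction arbitrary: F rule: real_polynomial_function.induct)
  case (linear f)
  \<comment> \<open>Coefficients of the linear functional in exponential form: f 1 cos x + f \<i>
    sin x = A e^{ix} + B e^{-ix}.\<close>
  define A :: complex where "A = (of_real (f 1) - \<i> * of_real (f \<i>)) / 2"
  define B :: complex where "B = (of_real (f 1) + \<i> * of_real (f \<i>)) / 2"
  have f: "of_real (f (cis x)) = A * cis x + B * cis (- x)" for x
  proof -
    have "cis x = cos x *\<^sub>R 1 + sin x *\<^sub>R \<i>"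
      by (simp add: complex_eq_iff)
    then have "f (cis x) = cos x * f 1 + sin x * f \<i>"
      using bounded_linear.linear[OF linear.hyps] by (simp only: linear_add linear_scale real_scaleR_def)
    then show ?thesis
      by (simp add: A_def B_def complex_eq_iff field_simps)
  qed
  have int: "integrable circ (\<lambda>x. A * (F x * cis (of_int 1 * x)))"
       "integrable circ (\<lambda>x. B * (F x * cis (of_int (-1) * x)))"
    using linear by (auto intro!: integrable_circ_cis simp del: of_int_1 of_int_minus mult_minus_left)
  have eq: "(\<lambda>x. F x * of_real (f (cis x)))
      = (\<lambda>x. A * (F x * cis (of_int 1 * x)) + B * (F x * cis (of_int (-1) * x)))"
    by (simp add: f algebra_simps)
  show ?case
    unfolding eq using int linear.prems
    by (simp add: fc_add fc_cmult fc_shift del: of_int_1 of_int_minus mult_minus_left)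
next
  case (const c)
  then show ?case by (simp add: fc_cmult mult.commute[of _ "of_real c"])
next
  case (add f g)
  then show ?case by (simp add: ring_distribs fc_add)
next
  case (mult f g)
  show ?case
    using mult.IH(2)[of "\<lambda>x. F x * of_real (f (cis x))"] mult.IH(1)[of F] mult.prems
    by (simp add: mult.assoc)
qed

text \<open>The lift is f composed with \<open>Arg2pi\<close>, which jumps at 1; the equal end
  values repair this. Continuity is checked on closed sets: the preimage of one is the image under
  \<open>cis\<close> of a compact subset of the interval.\<close>

lemma continuous_on_circle_lift:
  fixes f :: "real \<Rightarrow> real"
  assumes "continuous_on {0..2*pi} f" "f (2*pi) = f 0"
  obtains g :: "complex \<Rightarrow> real"
    where "continuous_on (sphere 0 1) g" "\<And>x. x \<in> {0..2*pi} \<Longrightarrow> g (cis x) = f x"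
proof -
  let ?g = "\<lambda>z. f (Arg2pi z)"
  have g: "?g (cis x) = f x" if "x \<in> {0..2*pi}" for x
  proof (cases "x = 2*pi")
    case True
    then have "Arg2pi (cis x) = 0" by (simp add: Arg2pi_eq_0)
    then show ?thesis using True assms(2) by simp
  next
    case False
    then have "Arg2pi (cis x) = x"
      using that by (intro Arg2pi_unique[of 1]) (auto simp: cis_conv_exp)
    then show ?thesis by simp
  qed
  have cis_img: "cis ` {0..2*pi} = sphere 0 1"
  proof
    show "sphere 0 1 \<subseteq> cis ` {0..2*pi}"
    proof
      fix z :: complex assume "z \<in> sphere 0 1"
      then have "z = cis (Arg2pi z)"
        using Arg2pi_eq[of z] by (simp add: cis_conv_exp)
      moreover have "Arg2pi z \<in> {0..2*pi}"
        using Arg2pi[of z] by auto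
      ultimately show "z \<in> cis ` {0..2*pi}" by blast
    qed
  qed auto
  have "continuous_on (sphere 0 1) ?g"
  proof (subst continuous_on_closed_vimage)
    show "closed (sphere 0 1 :: complex set)" by simp
    show "\<forall>B. closed B \<longrightarrow> closed (?g -` B \<inter> sphere 0 1)"
    proof (intro allI impI)
      fix B :: "real set" assume "closed B"
      have "?g -` B \<inter> sphere 0 1 = cis ` (f -` B \<inter> {0..2*pi})"
        unfolding cis_img[symmetric] using g by (auto simp: image_iff)
      moreover have "closed (f -` B \<inter> {0..2*pi})"
        using assms(1) \<open>closed B\<close> by (auto simp: continuous_on_closed_vimage)
      then have "compact (f -` B \<inter> {0..2*pi})"
        by (meson Int_lower2 bounded_closed_interval bounded_subset compact_eq_bounded_closed)
      then have "compact (cis ` (f -` B \<inter> {0..2*pi}))"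
        by (intro compact_continuous_image continuous_intros)
      ultimately show "closed (?g -` B \<inter> sphere 0 1)"
        by (simp add: compact_imp_closed)
    qed
  qed
  then show thesis using g by (rule that)
qed

text \<open>\<open>F\<close> is orthogonal to all polynomials on the circle, and by
  Stone-Weierstrass these approximate the lift of \<open>f\<close> uniformly.\<close>

lemma fc_zero_integral_mult_continuous:
  fixes f :: "real \<Rightarrow> real"
  assumes F: "integrable circ F" "\<And>n. fc F n = 0"
    and f: "continuous_on {0..2*pi} f" "f (2*pi) = f 0"
  shows "(LINT x|circ. F x * of_real (f x)) = 0"
proof -
  obtain h where h: "continuous_on (sphere 0 1) h" "\<And>x. x \<in> {0..2*pi} \<Longrightarrow> h (cis x) = f x"
    using continuous_on_circle_lift[OF f] by blast
  let ?N = "LINT x|circ. norm (F x)"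
  have Ff: "integrable circ (\<lambda>x. F x * of_real (f x))"
    using F(1) f(1) by (intro integrable_circ_mult_continuous) (auto intro!: continuous_intros)
  have "norm (LINT x|circ. F x * of_real (f x)) \<le> 0 + e" if "e > 0" for e
  proof -
    \<comment> \<open>The added 1 keeps the denominator positive when the L1 norm of
      \<open>F\<close> is zero.\<close>
    define d where "d = e / (?N + 1)"
    have N: "?N \<ge> 0" by simp
    have "d > 0" using that add_nonneg_pos[OF N zero_less_one] by (simp add: d_def)
    then obtain p where p: "real_polynomial_function p" "\<And>z. z \<in> sphere 0 1 \<Longrightarrow> \<bar>h z - p z\<bar> < d"
      using Stone_Weierstrass_real_polynomial_function[OF _ h(1), of d] by auto
    have Fp: "integrable circ (\<lambda>x. F x * of_real (p (cis x)))"
      and "fc (\<lambda>x. F x * of_real (p (cis x))) 0 = 0"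
      using fc_zero_mult_real_polynomial[OF p(1) F] by auto
    then have "(LINT x|circ. F x * of_real (p (cis x))) = 0"
      by (simp add: fc_def)
    then have "norm (LINT x|circ. F x * of_real (f x))
        = norm (LINT x|circ. F x * of_real (f x) - F x * of_real (p (cis x)))"
      using Ff Fp by simp
    also have "\<dots> \<le> (LINT x|circ. norm (F x * of_real (f x) - F x * of_real (p (cis x))))"
      using Ff Fp by (intro integral_norm_bound)
    also have "\<dots> \<le> (LINT x|circ. d * norm (F x))"
    proof (rule integral_mono)
      fix x assume x: "x \<in> space circ"
      have "\<bar>f x - p (cis x)\<bar> \<le> d"
        using p(2)[of "cis x"] h(2)[of x] x by auto
      then have "norm (F x) * \<bar>f x - p (cis x)\<bar> \<le> norm (F x) * d"
        by (rule mult_left_mono) simp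
      moreover have "F x * of_real (f x) - F x * of_real (p (cis x)) = F x * of_real (f x - p (cis x))"
        by (simp add: algebra_simps)
      ultimately show "norm (F x * of_real (f x) - F x * of_real (p (cis x))) \<le> d * norm (F x)"
        by (simp add: norm_mult mult.commute del: of_real_diff)
    qed (use Ff Fp F(1) in auto)
    also have "\<dots> = e * (?N / (?N + 1))"
      by (simp add: d_def)
    also have "\<dots> \<le> e * 1"
      using add_nonneg_pos[OF N zero_less_one] that
      by (intro mult_left_mono) (auto simp: divide_le_eq)
    finally show ?thesis by simp
  qed
  then have "norm (LINT x|circ. F x * of_real (f x)) \<le> 0"
    by (rule field_le_epsilon)
  then show ?thesis by simp
qed

lemma nonneg_integral_zero_continuous:
  fixes f :: "real \<Rightarrow> real"
  assumes "continuous_on {0..2*pi} f" "\<And>x. x \<in> {0..2*pi} \<Longrightarrow> f x \<ge> 0" "(LINT x|circ. f x) = 0" "x \<in> {0..2*pi}"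
  shows "f x = 0"
proof -
  have "set_integrable lborel {0..2*pi} f"
    using assms(1) by (simp add: set_integrable_circ integrable_circ_continuous)
  from set_borel_integral_eq_integral(2)[OF this] have "integral {0..2*pi} f = 0"
    using assms(3) by (simp add: LBINT_circ)
  then show ?thesis
    using integral_eq_0_iff[of 0 "2*pi" f] assms by auto
qed

text \<open>\<open>F\<close> is tested against its own real and imaginary parts, which are
  admissible continuous functions; the integrals of their squares vanish.\<close>

lemma fc_zero_continuous:
  fixes F :: "real \<Rightarrow> complex"
  assumes F: "continuous_on {0..2*pi} F" "F (2*pi) = F 0" "\<And>n. fc F n = 0" and x: "x \<in> {0..2*pi}"
  shows "F x = 0"
proof -
  have int: "integrable circ F" using F(1) by (rule integrable_circ_continuous)
  have R: "continuous_on {0..2*pi} (\<lambda>x. Re (F x))" "continuous_on {0..2*pi} (\<lambda>x. Im (F x))"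
    using F(1) by (auto intro!: continuous_intros)
  have "(LINT x|circ. F x * of_real (Re (F x))) = 0" "(LINT x|circ. F x * of_real (Im (F x))) = 0"
    by (rule fc_zero_integral_mult_continuous; use int F R in simp)+
  moreover have "integrable circ (\<lambda>x. F x * of_real (Re (F x)))" "integrable circ (\<lambda>x. F x * of_real (Im (F x)))"
    by (rule integrable_circ_continuous; use F R in \<open>auto intro!: continuous_intros\<close>)+
  ultimately have "(LINT x|circ. Re (F x * of_real (Re (F x)))) = 0" "(LINT x|circ. Im (F x * of_real (Im (F x)))) = 0"
    by (simp_all only: integral_Re integral_Im zero_complex.sel)
  then have *: "(LINT x|circ. Re (F x) * Re (F x)) = 0" "(LINT x|circ. Im (F x) * Im (F x)) = 0"
    by simp_all
  have "Re (F x) * Re (F x) = 0"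
    by (rule nonneg_integral_zero_continuous[OF _ _ *(1) x]) (use R in \<open>auto intro!: continuous_intros\<close>)
  moreover have "Im (F x) * Im (F x) = 0"
    by (rule nonneg_integral_zero_continuous[OF _ _ *(2) x]) (use R in \<open>auto intro!: continuous_intros\<close>)
  ultimately show ?thesis by (simp add: complex_eq_iff)
qed


text \<open>Rays are closed under intersection and generate the Borel sets, and the sets over which
  the extended function \<open>G\<close> integrates to zero form a Dynkin system. So all Borel sets
  have integral zero, and the density vanishes almost everywhere.\<close>

lemma AE_circ_zero_if_ray_integrals_zero:
  fixes F :: "real \<Rightarrow> complex"
  assumes int: "integrable circ F"
    and zero: "\<And>x. x \<in> {0..2*pi} \<Longrightarrow> (LINT t|circ. indicator {..x} t *\<^sub>R F t) = 0"
  shows "AE x in circ. F x = 0"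
proof -
  define G where "G t = indicator {0..2*pi} t *\<^sub>R F t" for t
  have G: "integrable lborel G"
    using int by (simp add: circ_def integrable_restrict_space G_def[abs_def])
  have conv: "(LINT t|circ. indicator A t *\<^sub>R F t) = (LINT t:A|lborel. G t)" for A
    by (simp add: circ_def integral_restrict_space set_lebesgue_integral_def G_def mult.commute)
  have total: "(LINT t|lborel. G t) = 0"
  proof -
    have "(LINT t|lborel. G t) = (LINT t:{..2*pi}|lborel. G t)"
      unfolding set_lebesgue_integral_def
      by (rule Bochner_Integration.integral_cong) (auto simp: G_def indicator_def)
    then show ?thesis using zero[of "2*pi"] conv[of "{..2*pi}"] by simp
  qed
  have ray: "(LINT t:{..x}|lborel. G t) = 0" for x
  proof -
    consider "x < 0" | "x \<in> {0..2*pi}" | "x > 2*pi" by force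
    then show ?thesis
    proof cases
      case 1
      then have "(\<lambda>t. indicator {..x} t *\<^sub>R G t) = (\<lambda>t. 0)"
        by (auto simp: G_def indicator_def)
      then show ?thesis by (simp add: set_lebesgue_integral_def)
    next
      case 2
      then show ?thesis using zero[of x] conv[of "{..x}"] by simp
    next
      case 3
      have "(LINT t:{..x}|lborel. G t) = (LINT t|lborel. G t)"
        unfolding set_lebesgue_integral_def
        by (rule Bochner_Integration.integral_cong) (use 3 in \<open>auto simp: G_def indicator_def\<close>)
      then show ?thesis using total by simp
    qed
  qed
  have intA: "set_integrable lborel A G" if "A \<in> sets borel" for A
    unfolding set_integrable_def using that G by (intro integrable_mult_indicator) auto
  have "AE t in lborel. G t = 0"
  proof (rule sigma_finite_measure.density_zero[OF sigma_finite_lborel G])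
    fix A :: "real set" assume "A \<in> sets lborel"
    then have A: "A \<in> sigma_sets UNIV (range (\<lambda>a::real. {..a}))"
      by (simp add: borel_eq_atMost sets_measure_of)
    have "Int_stable (range (\<lambda>a::real. {..a}))"
      by (auto simp: Int_stable_def)
    moreover have "range (\<lambda>a::real. {..a}) \<subseteq> Pow UNIV" by simp
    ultimately show "(LINT t:A|lborel. G t) = 0"
      using A
    proof (induction A rule: sigma_sets_induct_disjoint)
      case (basic A)
      then show ?case using ray by auto
    next
      case (compl A)
      then have A: "A \<in> sets borel" by (simp add: borel_eq_atMost sets_measure_of)
      have "(LINT t:A|lborel. G t) + (LINT t:UNIV - A|lborel. G t) = (LINT t:A \<union> (UNIV - A)|lborel. G t)"
        using A by (intro set_integral_Un[symmetric] intA) auto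
      then show ?case
        using compl.IH total by (simp add: set_lebesgue_integral_def)
    next
      case (union A)
      then have A: "\<And>i. A i \<in> sets borel" by (simp add: borel_eq_atMost sets_measure_of image_subset_iff)
      then have "(LINT t:(\<Union>i. A i)|lborel. G t) = (\<Sum>i. (LINT t:A i|lborel. G t))"
        using union(1) by (intro lebesgue_integral_countable_add intA) (auto simp: disjoint_family_on_def)
      then show ?case using union by simp
    qed (simp add: set_lebesgue_integral_def)
  qed
  then have "AE t in circ. G t = 0" by (rule AE_circ)
  then show ?thesis
    by (rule AE_mp) (auto simp: G_def)
qed

text \<open>Integration by parts for a derivative that is only integrable, obtained by Fubini on the
  triangle t \<le> x. The zero mean of \<open>V\<close> removes the boundary term and settles n =
  0.\<close>

lemma fc_antiderivative:
  assumes V: "integrable circ V" and zero: "(LINT t|circ. V t) = 0"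
    and U: "\<And>x. x \<in> {0..2*pi} \<Longrightarrow> U x = c + (LINT t|circ. indicator {..x} t *\<^sub>R V t)"
  shows "fc V n = \<i> * of_int n * fc U n"
proof (cases "n = 0")
  case True
  then show ?thesis using zero by (simp add: fc_def)
next
  case False
  let ?e = "\<lambda>x. cis (of_int (- n) * x)"
  have tail: "(LINT x|circ. indicator {t..} x *\<^sub>R ?e x) = (1 - ?e t) / (\<i> * of_int (- n))"
    if "t \<in> {0..2*pi}" for t
  proof -
    have "(LINT x|circ. indicator {t..} x *\<^sub>R ?e x) = (LINT x|lborel. indicator {t..2*pi} x *\<^sub>R ?e x)"
      unfolding circ_def using that
      by (subst integral_restrict_space) (auto simp: indicator_def intro!: Bochner_Integration.integral_cong)
    also have "\<dots> = (?e (2*pi) - ?e t) / (\<i> * of_int (- n))"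
      using False that by (intro integral_cis_Icc) auto
    finally show ?thesis by (simp only: cis_int_2pi)
  qed
  interpret P: pair_sigma_finite circ circ ..
  \<comment> \<open>The indicator of t \<le> x is read as a condition on t inside
    \<open>inner\<close>, and as one on x after the exchange, where \<open>tail\<close> evaluates
    the integral.\<close>
  define f where "f t x = (indicator {..x} t *\<^sub>R V t) * ?e x" for t x
  have [measurable]: "(\<lambda>x. x) \<in> borel_measurable circ" by simp
  have [measurable]: "V \<in> borel_measurable circ" using V by auto
  have f: "integrable (circ \<Otimes>\<^sub>M circ) (case_prod f)"
  proof (rule Bochner_Integration.integrable_bound)
    show "integrable (circ \<Otimes>\<^sub>M circ) (\<lambda>p. V (fst p))"
      by (rule P.Fubini_integrable) (use V in auto)
    have "case_prod f = (\<lambda>p. (if fst p \<le> snd p then V (fst p) else 0) * ?e (snd p))"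
      by (auto simp: f_def fun_eq_iff indicator_def)
    then show "case_prod f \<in> borel_measurable (circ \<Otimes>\<^sub>M circ)"
      by simp measurable
    show "AE p in circ \<Otimes>\<^sub>M circ. norm (case_prod f p) \<le> norm (V (fst p))"
      by (intro AE_I2) (auto simp: f_def norm_mult indicator_def)
  qed
  have inner: "(LINT t|circ. f t x) = (LINT t|circ. indicator {..x} t *\<^sub>R V t) * ?e x" for x
    unfolding f_def by (rule integral_mult_left_zero)
  have "(LINT x|circ. U x * ?e x) = (LINT x|circ. c * ?e x + (LINT t|circ. f t x))"
    by (rule Bochner_Integration.integral_cong) (simp_all only: space_circ U ring_distribs inner)
  also have "\<dots> = (LINT x|circ. c * ?e x) + (LINT x|circ. (LINT t|circ. f t x))"
    using P.integrable_snd[OF f] by (intro Bochner_Integration.integral_add integrable_circ_cis) auto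
  also have "(LINT x|circ. c * ?e x) = 0"
    using False integral_cis[of "- n"] by simp
  also have "(LINT x|circ. (LINT t|circ. f t x)) = (LINT t|circ. (LINT x|circ. f t x))"
    by (rule P.Fubini_integral[OF f])
  also have "\<dots> = (LINT t|circ. V t * ((1 - ?e t) / (\<i> * of_int (- n))))"
  proof (rule Bochner_Integration.integral_cong)
    fix t assume t: "t \<in> space circ"
    have "f t x = V t * (indicator {t..} x *\<^sub>R ?e x)" for x
      by (simp add: f_def indicator_def)
    then show "(LINT x|circ. f t x) = V t * ((1 - ?e t) / (\<i> * of_int (- n)))"
      using t by (simp only: integral_mult_right_zero tail space_circ)
  qed simp
  also have "\<dots> = (LINT t|circ. V t - V t * ?e t) / (\<i> * of_int (- n))"
    by (simp add: right_diff_distrib)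
  also have "(LINT t|circ. V t - V t * ?e t) = - (LINT t|circ. V t * ?e t)"
    using integrable_circ_cis[OF V, of "of_int (- n)"] V zero by simp
  finally show ?thesis
    using False by (simp add: fc_def field_simps)
qed


text \<open>Uniqueness is known for continuous functions only, so the argument moves to the
  antiderivative \<open>U\<close>. All its coefficients except the mean vanish, hence it is
  constant; it starts at 0, hence all ray integrals of \<open>F\<close> are zero.\<close>

lemma fc_zero_AE_zero:
  assumes F: "integrable circ F" "\<And>n. fc F n = 0"
  shows "AE x in circ. F x = 0"
proof (rule AE_circ_zero_if_ray_integrals_zero[OF F(1)])
  define U where "U x = (LINT t|circ. indicator {..x} t *\<^sub>R F t)" for x
  have total: "(LINT t|circ. F t) = 0"
    using F(2)[of 0] by (simp add: fc_def)
  have U_eq: "U x = integral {0..x} F" if "x \<in> {0..2*pi}" for x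
  proof -
    have int: "set_integrable lborel {0..2*pi} F"
      using F(1) by (simp add: set_integrable_circ)
    then have "set_integrable lborel {0..x} F"
      by (rule set_integrable_subset) (use that in auto)
    moreover have "U x = (LINT t:{0..x}|lborel. F t)"
      unfolding U_def set_lebesgue_integral_def circ_def using that
      by (subst integral_restrict_space) (auto simp: indicator_def intro!: Bochner_Integration.integral_cong)
    ultimately show ?thesis by (simp add: set_borel_integral_eq_integral(2))
  qed
  have "F integrable_on {0..2*pi}"
    using F(1) by (intro set_borel_integral_eq_integral(1)) (simp add: set_integrable_circ)
  then have "continuous_on {0..2*pi} (\<lambda>x. integral {0..x} F)"
    by (rule indefinite_integral_continuous_1)
  then have cont: "continuous_on {0..2*pi} U"
    by (subst continuous_on_cong[OF refl U_eq])
  have U0: "U 0 = 0" by (simp add: U_eq)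
  have U2: "U (2*pi) = 0"
  proof -
    have "U (2*pi) = (LINT t|circ. F t)"
      unfolding U_def by (rule Bochner_Integration.integral_cong) auto
    then show ?thesis using total by simp
  qed
  have Un: "fc U n = 0" if "n \<noteq> 0" for n
    using fc_antiderivative[OF F(1) total, of U 0 n] F(2)[of n] that by (simp add: U_def)
  define c where "c = fc U 0"
  have c: "fc (\<lambda>x. U x - c) n = 0" for n
  proof -
    have "fc (\<lambda>x. U x - c) n = fc U n - fc (\<lambda>x. c * cis (of_int 0 * x)) n"
      using cont by (subst fc_diff[symmetric]) (auto intro!: integrable_circ_continuous)
    also have "\<dots> = 0"
      unfolding fc_cmult fc_cis using Un by (simp add: c_def)
    finally show ?thesis .
  qed
  have U_const: "U x - c = 0" if "x \<in> {0..2*pi}" for x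
    by (rule fc_zero_continuous[OF _ _ c that]) (use cont U0 U2 in \<open>auto intro!: continuous_intros\<close>)
  from U_const[of 0] U0 have "c = 0" by simp
  with U_const show "x \<in> {0..2*pi} \<Longrightarrow> (LINT t|circ. indicator {..x} t *\<^sub>R F t) = 0" for x
    by (simp add: U_def)
qed

section \<open>Bessel's inequality and the Riesz-Fischer theorem\<close>

definition sq_integrable :: "(real \<Rightarrow> complex) \<Rightarrow> bool" where
  "sq_integrable F \<longleftrightarrow> F \<in> borel_measurable circ \<and> integrable circ (\<lambda>x. (norm (F x))\<^sup>2)"

lemma sq_integrable_imp_integrable:
  assumes "sq_integrable F"
  shows "integrable circ F"
proof (rule Bochner_Integration.integrable_bound)
  show "integrable circ (\<lambda>x. 1 + (norm (F x))\<^sup>2)"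
    using assms by (simp add: sq_integrable_def)
  have "t \<le> 1 + t\<^sup>2" if "t \<ge> 0" for t :: real
    using sum_squares_ge_zero[of "t - 1" 0] that zero_le_power2[of t] by (simp add: power2_eq_square algebra_simps)
  then show "AE x in circ. norm (F x) \<le> norm (1 + (norm (F x))\<^sup>2)"
    by (intro AE_I2) simp
qed (use assms in \<open>simp add: sq_integrable_def\<close>)

lemma LINT_fc: "(LINT x|circ. F x * cis (- (of_int n * x))) = 2 * of_real pi * fc F n"
  by (simp add: fc_def)

lemma norm_diff_square: "(norm (a - b))\<^sup>2 = (norm a)\<^sup>2 - 2 * Re (a * cnj b) + (norm b)\<^sup>2"
  unfolding cmod_power2 by (simp add: power2_eq_square algebra_simps)

lemma integral_norm_diff_square:
  assumes "integrable M (\<lambda>x. (norm (F x :: complex))\<^sup>2)" "integrable M (\<lambda>x. (norm (G x))\<^sup>2)"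
    "integrable M (\<lambda>x. F x * cnj (G x))"
  shows "(LINT x|M. (norm (F x - G x))\<^sup>2)
    = (LINT x|M. (norm (F x))\<^sup>2) - 2 * Re (LINT x|M. F x * cnj (G x)) + (LINT x|M. (norm (G x))\<^sup>2)"
proof -
  have "(LINT x|M. (norm (F x - G x))\<^sup>2)
      = (LINT x|M. ((norm (F x))\<^sup>2 - 2 * Re (F x * cnj (G x))) + (norm (G x))\<^sup>2)"
    by (simp only: norm_diff_square)
  also have "\<dots> = (LINT x|M. (norm (F x))\<^sup>2 - 2 * Re (F x * cnj (G x))) + (LINT x|M. (norm (G x))\<^sup>2)"
    by (intro Bochner_Integration.integral_add Bochner_Integration.integrable_diff
        integrable_mult_right integrable_Re assms)
  also have "(LINT x|M. (norm (F x))\<^sup>2 - 2 * Re (F x * cnj (G x)))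
      = (LINT x|M. (norm (F x))\<^sup>2) - (LINT x|M. 2 * Re (F x * cnj (G x)))"
    by (intro Bochner_Integration.integral_diff integrable_mult_right integrable_Re assms)
  also have "(LINT x|M. 2 * Re (F x * cnj (G x))) = 2 * Re (LINT x|M. F x * cnj (G x))"
    by (simp only: integral_mult_right_zero integral_Re[OF assms(3)])
  finally show ?thesis .
qed

lemma cnj_mult_self: "cnj z * (a * z) = a * of_real ((norm z)\<^sup>2)"
  by (simp only: complex_norm_square mult_ac)

lemma integral_norm_square_trig_sum:
  assumes "finite A"
  shows "(LINT x|circ. (norm (\<Sum>n\<in>A. c n * cis (of_int n * x)))\<^sup>2) = 2 * pi * (\<Sum>n\<in>A. (norm (c n))\<^sup>2)"
proof -
  let ?S = "\<lambda>x. \<Sum>n\<in>A. c n * cis (of_int n * x)"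
  have int: "integrable circ (\<lambda>x. c n * cis (of_int n * x))" for n
    by (intro integrable_circ_continuous continuous_intros)
  have fcS: "fc ?S n = (if n \<in> A then c n else 0)" for n
  proof -
    have "fc ?S n = (\<Sum>m\<in>A. if n = m then c m else 0)"
      by (simp add: fc_sum int fc_cmult fc_cis if_distrib cong: if_cong)
    then show ?thesis using assms by simp
  qed
  have "(LINT x|circ. of_real ((norm (?S x))\<^sup>2)) = (LINT x|circ. (\<Sum>n\<in>A. cnj (c n) * (?S x * cis (- (of_int n * x)))))"
  proof (rule Bochner_Integration.integral_cong)
    fix x
    have "of_real ((norm (?S x))\<^sup>2) = ?S x * cnj (?S x)"
      by (rule complex_norm_square)
    also have "\<dots> = (\<Sum>n\<in>A. cnj (c n) * (?S x * cis (- (of_int n * x))))"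
      by (simp add: sum_distrib_left cis_cnj mult_ac)
    finally show "complex_of_real ((norm (?S x))\<^sup>2) = (\<Sum>n\<in>A. cnj (c n) * (?S x * cis (- (of_int n * x))))" .
  qed simp
  also have "\<dots> = (\<Sum>n\<in>A. cnj (c n) * (LINT x|circ. ?S x * cis (- (of_int n * x))))"
    by (subst Bochner_Integration.integral_sum) (auto intro!: integrable_fc integrable_circ_continuous continuous_intros)
  also have "\<dots> = (\<Sum>n\<in>A. cnj (c n) * (2 * of_real pi * fc ?S n))"
    by (simp add: fc_def)
  also have "\<dots> = of_real (2 * pi * (\<Sum>n\<in>A. (norm (c n))\<^sup>2))"
    by (simp add: fcS cnj_mult_self sum_distrib_left)
  finally show ?thesis by (simp only: integral_complex_of_real of_real_eq_iff)
qed

text \<open>Expansion of the nonnegative squared L2 distance between \<open>F\<close> and its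
  partial sum; the cross term equals the squared norm of the partial sum.\<close>

lemma bessel_finite:
  assumes F: "sq_integrable F" and A: "finite A"
  shows "2 * pi * (\<Sum>n\<in>A. (norm (fc F n))\<^sup>2) \<le> (LINT x|circ. (norm (F x))\<^sup>2)"
proof -
  let ?c = "fc F"
  let ?S = "\<lambda>x. \<Sum>n\<in>A. ?c n * cis (of_int n * x)"
  have intF: "integrable circ F" using F by (rule sq_integrable_imp_integrable)
  have contS: "continuous_on {0..2*pi} ?S" by (intro continuous_intros)
  have intFS: "integrable circ (\<lambda>x. F x * cnj (?S x))"
    using intF contS by (intro integrable_circ_mult_continuous continuous_intros)
  have "(LINT x|circ. F x * cnj (?S x)) = (LINT x|circ. (\<Sum>n\<in>A. cnj (?c n) * (F x * cis (- (of_int n * x)))))"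
    by (simp add: sum_distrib_left cis_cnj mult_ac)
  also have "\<dots> = (\<Sum>n\<in>A. cnj (?c n) * (LINT x|circ. F x * cis (- (of_int n * x))))"
    using intF by (subst Bochner_Integration.integral_sum) (auto intro!: integrable_fc)
  also have "\<dots> = of_real (2 * pi * (\<Sum>n\<in>A. (norm (?c n))\<^sup>2))"
    unfolding LINT_fc cnj_mult_self by (simp add: sum_distrib_left)
  finally have cross: "Re (LINT x|circ. F x * cnj (?S x)) = 2 * pi * (\<Sum>n\<in>A. (norm (?c n))\<^sup>2)"
    by simp
  have intS2: "integrable circ (\<lambda>x. (norm (?S x))\<^sup>2)"
    by (intro integrable_circ_continuous continuous_intros)
  have "0 \<le> (LINT x|circ. (norm (F x - ?S x))\<^sup>2)" by simp
  also have "\<dots> = (LINT x|circ. (norm (F x))\<^sup>2) - 2 * Re (LINT x|circ. F x * cnj (?S x)) + (LINT x|circ. (norm (?S x))\<^sup>2)"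
    using F by (intro integral_norm_diff_square intS2 intFS) (simp add: sq_integrable_def)
  finally show ?thesis
    unfolding cross integral_norm_square_trig_sum[OF A] by simp
qed

lemma bessel_summable:
  assumes "sq_integrable F"
  shows "(\<lambda>n. (norm (fc F n))\<^sup>2) summable_on A"
proof (rule nonneg_bounded_partial_sums_imp_summable_on)
  show "\<forall>\<^sub>F X in finite_subsets_at_top A. (\<Sum>n\<in>X. (norm (fc F n))\<^sup>2) \<le> (LINT x|circ. (norm (F x))\<^sup>2) / (2 * pi)"
    using bessel_finite[OF assms]
    by (intro eventually_finite_subsets_at_top_weakI) (simp add: field_simps)
qed simp

text \<open>Passes an L2 bound to an almost everywhere limit. In the Riesz-Fischer theorem it serves
  twice: for the limit itself and for its distance to a partial sum.\<close>

lemma Fatou_L2: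
  fixes f :: "real \<Rightarrow> real"
  assumes s: "\<And>j. integrable circ (\<lambda>x. (s j x)\<^sup>2)" "\<And>j. s j \<in> borel_measurable circ"
    and f: "f \<in> borel_measurable circ"
    and lim: "AE x in circ. (\<lambda>j. s j x) \<longlonglongrightarrow> f x"
    and K: "\<forall>\<^sub>F j in sequentially. (LINT x|circ. (s j x)\<^sup>2) \<le> K"
  shows "integrable circ (\<lambda>x. (f x)\<^sup>2)" "(LINT x|circ. (f x)\<^sup>2) \<le> K"
proof -
  obtain j0 where "(LINT x|circ. (s j0 x)\<^sup>2) \<le> K"
    using K by (meson eventually_happens trivial_limit_sequentially)
  moreover have "0 \<le> (LINT x|circ. (s j0 x)\<^sup>2)" by simp
  ultimately have K0: "K \<ge> 0" by linarith
  have "(\<integral>\<^sup>+x. ennreal ((f x)\<^sup>2) \<partial>circ) = (\<integral>\<^sup>+x. liminf (\<lambda>j. ennreal ((s j x)\<^sup>2)) \<partial>circ)"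
  proof (rule nn_integral_cong_AE)
    show "AE x in circ. ennreal ((f x)\<^sup>2) = liminf (\<lambda>j. ennreal ((s j x)\<^sup>2))"
      using lim
    proof eventually_elim
      case (elim x)
      then have "(\<lambda>j. ennreal ((s j x)\<^sup>2)) \<longlonglongrightarrow> ennreal ((f x)\<^sup>2)"
        by (intro tendsto_ennrealI tendsto_power)
      then show ?case by (rule lim_imp_Liminf[OF sequentially_bot, symmetric])
    qed
  qed
  also have "\<dots> \<le> liminf (\<lambda>j. \<integral>\<^sup>+x. ennreal ((s j x)\<^sup>2) \<partial>circ)"
    using s by (intro nn_integral_liminf) auto
  also have "\<dots> = liminf (\<lambda>j. ennreal (LINT x|circ. (s j x)\<^sup>2))"
    by (intro arg_cong[where f = liminf] ext nn_integral_eq_integral s) auto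
  also have "\<dots> \<le> ennreal K"
  proof -
    have "\<forall>\<^sub>F j in sequentially. ennreal (LINT x|circ. (s j x)\<^sup>2) \<le> ennreal K"
      using K by eventually_elim (rule ennreal_leI)
    then have "liminf (\<lambda>j. ennreal (LINT x|circ. (s j x)\<^sup>2)) \<le> liminf (\<lambda>j::nat. ennreal K)"
      by (rule Liminf_mono)
    then show ?thesis by (simp add: Liminf_const)
  qed
  finally have le: "(\<integral>\<^sup>+x. ennreal ((f x)\<^sup>2) \<partial>circ) \<le> ennreal K" .
  show int: "integrable circ (\<lambda>x. (f x)\<^sup>2)"
    using le f by (intro integrableI_bounded) (auto simp: less_top[symmetric] top_unique)
  show "(LINT x|circ. (f x)\<^sup>2) \<le> K"
    using le nn_integral_eq_integral[OF int] K0 by simp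
qed

text \<open>In place of Cauchy-Schwarz, the pointwise inequality |f| \<le> a/2 + f^2/(2a) is
  integrated; \<open>a = e / (2 * pi)\<close> makes each of the two contributions e/2.\<close>

lemma L1_less_if_L2_less:
  fixes f :: "real \<Rightarrow> real"
  assumes f: "f \<in> borel_measurable circ" "integrable circ (\<lambda>x. (f x)\<^sup>2)"
    and "e > 0" "(LINT x|circ. (f x)\<^sup>2) < e\<^sup>2 / (2 * pi)"
  shows "(LINT x|circ. \<bar>f x\<bar>) < e"
proof -
  define a where "a = e / (2 * pi)"
  have a: "a > 0" using assms by (simp add: a_def)
  have "(LINT x|circ. \<bar>f x\<bar>) \<le> (LINT x|circ. a / 2 + (f x)\<^sup>2 / (2 * a))"
  proof (rule integral_mono')
    fix x
    have "0 \<le> (\<bar>f x\<bar> - a)\<^sup>2 / (2 * a)" using a by simp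
    also have "\<dots> = a / 2 + (f x)\<^sup>2 / (2 * a) - \<bar>f x\<bar>"
      using a by (simp add: power2_diff field_simps power2_eq_square)
    finally show "\<bar>f x\<bar> \<le> a / 2 + (f x)\<^sup>2 / (2 * a)" by simp
  qed (use f a in auto)
  also have "\<dots> = pi * a + (LINT x|circ. (f x)\<^sup>2) / (2 * a)"
    using f by (simp add: measure_circ)
  also have "\<dots> < pi * a + (e\<^sup>2 / (2 * pi)) / (2 * a)"
    using a assms by (intro add_strict_left_mono divide_strict_right_mono) auto
  also have "\<dots> = e"
    using \<open>e > 0\<close> by (simp add: a_def field_simps power2_eq_square)
  finally show ?thesis .
qed

text \<open>Symmetric index sets make the partial sums real when c (-n) is the conjugate of c n,
  while the unordered sums over the integers still control them.\<close>

lemma filterlim_symmetric_intervals: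
  "filterlim (\<lambda>N. {- int N..int N}) (finite_subsets_at_top UNIV) sequentially"
  unfolding filterlim_finite_subsets_at_top
proof safe
  fix X :: "int set" assume X: "finite X"
  have "X \<subseteq> {- int N..int N}" if "N \<ge> nat (Max (insert 0 (abs ` X)))" for N
  proof
    fix x assume "x \<in> X"
    then have "\<bar>x\<bar> \<le> Max (insert 0 (abs ` X))" using X by (intro Max_ge) auto
    then show "x \<in> {- int N..int N}" using that by auto
  qed
  then show "\<forall>\<^sub>F N in sequentially. finite {- int N..int N} \<and> X \<subseteq> {- int N..int N} \<and> {- int N..int N} \<subseteq> UNIV"
    by (auto simp: eventually_sequentially)
qed

text \<open>The partial sums are Cauchy in L2, hence in L1, so a subsequence converges almost
  everywhere. Fatou then yields square integrability, and Bessel identifies the coefficients. The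
  result supplies the witness behind the choice in \<open>CC\<close>.\<close>

theorem Riesz_Fischer:
  assumes c: "(\<lambda>n::int. (norm (c n))\<^sup>2) summable_on UNIV" and sym: "\<And>n. c (- n) = cnj (c n)"
  obtains F :: "real \<Rightarrow> real"
    where "F \<in> borel_measurable borel" "periodic2pi F" "integrable circ (\<lambda>x. (F x)\<^sup>2)"
      "\<And>n. fc (\<lambda>x. of_real (F x)) n = c n"
proof -
  define A where "A N = {- int N..int N}" for N
  define S where "S N x = (\<Sum>n\<in>A N. c n * cis (of_int n * x))" for N x
  define s where "s N x = Re (S N x)" for N x
  define q where "q N = (\<Sum>n\<in>A N. (norm (c n))\<^sup>2)" for N
  define Q where "Q = (\<Sum>\<^sub>\<infinity>n. (norm (c n))\<^sup>2)"
  have S_real: "S N x = of_real (s N x)" for N x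
  proof -
    have "cnj (S N x) = (\<Sum>n\<in>A N. c (- n) * cis (of_int (- n) * x))"
      by (simp add: S_def sym cis_cnj)
    also have "\<dots> = S N x"
      unfolding S_def by (rule sum.reindex_bij_witness[of _ uminus uminus]) (auto simp: A_def)
    finally show ?thesis by (simp add: s_def complex_eq_iff)
  qed
  have q_lim: "q \<longlonglongrightarrow> Q"
    unfolding q_def Q_def A_def
    by (rule filterlim_compose[OF infsum_tendsto[OF c] filterlim_symmetric_intervals])
  have q_le: "q N \<le> Q" for N
    unfolding q_def Q_def by (rule finite_sum_le_infsum[OF c]) (auto simp: A_def)
  have cont: "continuous_on X (s N)" for N X
    unfolding s_def[abs_def] S_def by (intro continuous_intros)
  have s_int: "integrable circ (\<lambda>x. (s i x)\<^sup>2)" "integrable circ (\<lambda>x. (s i x - s j x)\<^sup>2)" 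
     "integrable circ (s i)" for i j
    by (intro integrable_circ_continuous continuous_intros cont)+
  have s_meas [measurable]: "s i \<in> borel_measurable circ" for i
    by (intro continuous_measurable_circ cont)
  have s_sq: "(LINT x|circ. (s N x)\<^sup>2) = 2 * pi * q N" for N
  proof -
    have "finite (A N)" by (simp add: A_def)
    from integral_norm_square_trig_sum[OF this, of c] show ?thesis
      unfolding S_def[symmetric] q_def[symmetric] S_real by simp
  qed
  have s_diff: "(LINT x|circ. (s i x - s j x)\<^sup>2) = 2 * pi * (q i - q j)" if "j \<le> i" for i j
  proof -
    have sub: "A j \<subseteq> A i" "finite (A i)" using that by (auto simp: A_def)
    have "S i x - S j x = (\<Sum>n\<in>A i - A j. c n * cis (of_int n * x))" for x
      unfolding S_def using sub by (simp add: sum_diff)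
    then have "norm (\<Sum>n\<in>A i - A j. c n * cis (of_int n * x)) = \<bar>s i x - s j x\<bar>" for x
      by (metis S_real norm_of_real of_real_diff)
    moreover have "(\<Sum>n\<in>A i - A j. (norm (c n))\<^sup>2) = q i - q j"
      unfolding q_def using sub by (simp add: sum_diff)
    ultimately show ?thesis
      using integral_norm_square_trig_sum[of "A i - A j" c] sub by simp
  qed
  have cauchy: "\<exists>N. \<forall>i\<ge>N. \<forall>j\<ge>N. (LINT x|circ. norm (s i x - s j x)) < e" if "e > 0" for e
  proof -
    from q_lim have "Cauchy q" by (rule LIMSEQ_imp_Cauchy)
    moreover have "e\<^sup>2 / (2 * pi) / (2 * pi) > 0" using that by simp
    ultimately obtain N where N: "\<And>i j. i \<ge> N \<Longrightarrow> j \<ge> N \<Longrightarrow> \<bar>q i - q j\<bar> < e\<^sup>2 / (2 * pi) / (2 * pi)"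
      unfolding Cauchy_def dist_real_def by meson
    have ord: "(LINT x|circ. \<bar>s i x - s j x\<bar>) < e" if "j \<ge> N" "i \<ge> j" for i j
    proof (rule L1_less_if_L2_less)
      have "q i - q j < e\<^sup>2 / (2 * pi) / (2 * pi)" using N[of i j] that by auto
      then show "(LINT x|circ. (s i x - s j x)\<^sup>2) < e\<^sup>2 / (2 * pi)"
        unfolding s_diff[OF \<open>i \<ge> j\<close>] using pi_gt_zero by (subst (asm) pos_less_divide_eq) (auto simp: mult_ac)
    qed (use s_int \<open>e > 0\<close> in auto)
    have "(LINT x|circ. norm (s i x - s j x)) < e" if "i \<ge> N" "j \<ge> N" for i j
      unfolding real_norm_def
      using ord[of j i] ord[of i j] that abs_minus_commute[of "s i x" "s j x" for x]
      by (cases "i \<ge> j") simp_all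
    then show ?thesis by blast
  qed
  obtain r where r: "strict_mono r" "AE x in circ. Cauchy (\<lambda>i. s (r i) x)"
    using cauchy_L1_AE_cauchy_subseq[of circ s, OF s_int(3) cauchy] by blast
  \<comment> \<open>\<open>lim\<close> is total, so \<open>F\<close> is Borel and exactly periodic
    even at points where the subsequence diverges.\<close>
  define F where "F x = lim (\<lambda>i. s (r i) x)" for x
  have F_borel: "F \<in> borel_measurable borel"
    unfolding F_def[abs_def]
    by (intro borel_measurable_lim_metric borel_measurable_continuous_onI cont)
  then have [measurable]: "F \<in> borel_measurable circ" by (rule measurable_circ)
  have per: "s N (x + 2 * pi) = s N x" for N x
    by (simp add: s_def S_def ring_distribs flip: cis_mult)
  have F_lim: "AE x in circ. (\<lambda>i. s (r i) x) \<longlonglongrightarrow> F x"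
    using r(2) by eventually_elim (simp add: F_def Cauchy_convergent convergent_LIMSEQ_iff[symmetric])
  show thesis
  proof (rule that[OF F_borel])
    show "periodic2pi F" by (simp add: periodic2pi_def F_def per)
    show F2: "integrable circ (\<lambda>x. (F x)\<^sup>2)"
      by (rule Fatou_L2(1)[OF _ _ _ F_lim, of "2 * pi * Q"]) (use s_int q_le in \<open>auto simp: s_sq\<close>)
    fix n
    \<comment> \<open>Bessel for the single index n, applied to F minus a partial sum that already
      contains the n-th mode. The L2 distance is at most the tail \<open>Q - q (r i)\<close> up to
      the factor 2 pi, which cancels.\<close>
    have "norm (fc (\<lambda>x. of_real (F x)) n - c n) ^ 2 \<le> Q - q (r i)" if "nat \<bar>n\<bar> \<le> r i" for i
    proof -
      have lim: "AE x in circ. (\<lambda>j. s (r j) x - s (r i) x) \<longlonglongrightarrow> F x - s (r i) x"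
        using F_lim by eventually_elim (intro tendsto_intros)
      have "\<forall>\<^sub>F j in sequentially. (LINT x|circ. (s (r j) x - s (r i) x)\<^sup>2) \<le> 2 * pi * (Q - q (r i))"
        using eventually_ge_at_top[of i]
      proof eventually_elim
        case (elim j)
        then have "r i \<le> r j" using r(1) by (simp add: strict_mono_less_eq)
        then show ?case using s_diff[of "r i" "r j"] q_le[of "r j"] by simp
      qed
      note * = Fatou_L2[OF _ _ _ lim this]
      have int: "integrable circ (\<lambda>x. (F x - s (r i) x)\<^sup>2)"
        "(LINT x|circ. (F x - s (r i) x)\<^sup>2) \<le> 2 * pi * (Q - q (r i))"
        by (rule *; use s_int in simp)+
      have sq: "sq_integrable (\<lambda>x. of_real (F x - s (r i) x))"
        using int(1) unfolding sq_integrable_def by (simp del: of_real_diff)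
      have "2 * pi * (norm (fc (\<lambda>x. of_real (F x - s (r i) x)) n))\<^sup>2 \<le> (LINT x|circ. (F x - s (r i) x)\<^sup>2)"
        using bessel_finite[OF sq, of "{n}"] by (simp del: of_real_diff)
      also note int(2)
      finally have "2 * pi * (norm (fc (\<lambda>x. of_real (F x - s (r i) x)) n))\<^sup>2 \<le> 2 * pi * (Q - q (r i))" .
      moreover have "fc (\<lambda>x. of_real (F x - s (r i) x)) n = fc (\<lambda>x. of_real (F x)) n - c n"
      proof -
        have "sq_integrable (\<lambda>x. of_real (F x))"
          using F2 by (simp add: sq_integrable_def)
        then have iF: "integrable circ (\<lambda>x. complex_of_real (F x))" by (rule sq_integrable_imp_integrable)
        have "n \<in> A (r i)" using that by (auto simp: A_def)
        then have "c n = (\<Sum>m\<in>A (r i). if n = m then c m else 0)"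
          by (simp add: A_def)
        also have "\<dots> = fc (S (r i)) n"
          unfolding S_def[abs_def]
          by (subst fc_sum) (auto intro!: integrable_circ_continuous continuous_intros simp: fc_cmult fc_cis intro!: sum.cong)
        also have "S (r i) = (\<lambda>x. of_real (s (r i) x))" by (simp add: S_real fun_eq_iff)
        finally show ?thesis using iF s_int(3)[of "r i"] by (simp add: fc_diff)
      qed
      ultimately show ?thesis by simp
    qed
    then have ev: "\<forall>\<^sub>F i in sequentially. norm (fc (\<lambda>x. of_real (F x)) n - c n) ^ 2 \<le> Q - q (r i)"
      using seq_suble[OF r(1)] by (intro eventually_sequentiallyI[of "nat \<bar>n\<bar>"]) (meson order_trans)
    have "(\<lambda>i. Q - q (r i)) \<longlonglongrightarrow> Q - Q"
      using LIMSEQ_subseq_LIMSEQ[OF q_lim r(1)] by (intro tendsto_intros) (simp add: o_def)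
    then have "norm (fc (\<lambda>x. of_real (F x)) n - c n) ^ 2 \<le> Q - Q"
      using ev by (rule tendsto_lowerbound) simp
    then show "fc (\<lambda>x. of_real (F x)) n = c n" by simp
  qed
qed

section \<open>Absolutely convergent Fourier series\<close>

text \<open>The index 0 is harmless since 1 / 0 = 0; the positive and negative integers are two
  copies of the series over the naturals.\<close>

lemma summable_inverse_square_int: "(\<lambda>n::int. 1 / (of_int n)\<^sup>2 :: real) summable_on UNIV"
proof -
  let ?f = "\<lambda>n::int. 1 / (of_int n)\<^sup>2 :: real"
  have nat: "(\<lambda>n::nat. 1 / (real (Suc n))\<^sup>2) summable_on UNIV"
  proof -
    have "summable (\<lambda>n. 1 / (real n)\<^sup>2)"
      using inverse_power_summable[of 2, where 'a=real] by (simp add: field_simps)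
    then have "summable (\<lambda>n. 1 / (real (Suc n))\<^sup>2)"
      by (rule summable_Suc_iff[THEN iffD2])
    then show ?thesis
      by (subst summable_on_UNIV_nonneg_real_iff) auto
  qed
  have "?f summable_on (\<lambda>n. int (Suc n)) ` UNIV"
    using nat by (subst summable_on_reindex) (auto simp: inj_on_def o_def)
  moreover have "?f summable_on (\<lambda>n. - int (Suc n)) ` UNIV"
    using nat by (subst summable_on_reindex) (auto simp: inj_on_def o_def power2_eq_square algebra_simps)
  moreover have "?f summable_on {0}" by simp
  ultimately have "?f summable_on ((\<lambda>n. int (Suc n)) ` UNIV \<union> (\<lambda>n. - int (Suc n)) ` UNIV \<union> {0})"
    by (intro summable_on_Un_disjoint) auto
  moreover have "(\<lambda>n. int (Suc n)) ` UNIV \<union> (\<lambda>n. - int (Suc n)) ` UNIV \<union> {0} = UNIV"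
  proof -
    have "n \<in> (\<lambda>n. int (Suc n)) ` UNIV \<union> (\<lambda>n. - int (Suc n)) ` UNIV \<union> {0}" for n :: int
    proof (cases n "0::int" rule: linorder_cases)
      case less
      then have "n = - int (Suc (nat (- n - 1)))" by simp
      then show ?thesis by blast
    next
      case greater
      then have "n = int (Suc (nat (n - 1)))" by simp
      then show ?thesis by blast
    qed simp
    then show ?thesis by blast
  qed
  ultimately show ?thesis by simp
qed

context
  fixes c :: "int \<Rightarrow> complex" and f :: "real \<Rightarrow> complex"
  assumes c: "(\<lambda>n. norm (c n)) summable_on UNIV"
    and f: "\<And>x. x \<in> {0..2*pi} \<Longrightarrow> f x = (\<Sum>\<^sub>\<infinity>n. c n * cis (of_int n * x))"
begin

text \<open>The bound does not depend on x: this is the Weierstrass M-test along finite index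
  sets.\<close>

lemma trig_series_tail:
  assumes "finite A" "x \<in> {0..2*pi}"
  shows "norm (f x - (\<Sum>n\<in>A. c n * cis (of_int n * x))) \<le> (\<Sum>\<^sub>\<infinity>n. norm (c n)) - (\<Sum>n\<in>A. norm (c n))"
proof -
  let ?g = "\<lambda>n. c n * cis (of_int n * x)"
  have norm: "(\<lambda>n. norm (?g n)) = (\<lambda>n. norm (c n))" by (simp add: norm_mult)
  have abs: "(\<lambda>n. norm (?g n)) summable_on B" for B
    unfolding norm using c by (rule summable_on_subset_banach) simp
  have g: "?g summable_on B" for B
    using abs by (rule abs_summable_summable)
  have "f x - (\<Sum>n\<in>A. ?g n) = (\<Sum>\<^sub>\<infinity>n\<in>UNIV - A. ?g n)"
    using assms by (subst infsum_Diff[OF g g]) (auto simp: f)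
  also have "norm \<dots> \<le> (\<Sum>\<^sub>\<infinity>n\<in>UNIV - A. norm (?g n))"
    using abs by (rule norm_infsum_bound)
  also have "\<dots> = (\<Sum>\<^sub>\<infinity>n. norm (c n)) - (\<Sum>n\<in>A. norm (c n))"
    unfolding norm using assms by (subst infsum_Diff[OF c]) auto
  finally show ?thesis .
qed

lemma trig_series_tail_tendsto:
  "((\<lambda>A. (\<Sum>\<^sub>\<infinity>n. norm (c n)) - (\<Sum>n\<in>A. norm (c n))) \<longlongrightarrow> 0) (finite_subsets_at_top UNIV)"
  using tendsto_diff[OF tendsto_const[of "\<Sum>\<^sub>\<infinity>n. norm (c n)"] infsum_tendsto[OF c]] by simp

lemma trig_series_continuous: "continuous_on {0..2*pi} f"
proof (rule uniform_limit_theorem)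
  show "\<forall>\<^sub>F A in finite_subsets_at_top UNIV. continuous_on {0..2*pi} (\<lambda>x. \<Sum>n\<in>A. c n * cis (of_int n * x))"
    by (intro always_eventually allI continuous_intros)
  show "uniform_limit {0..2*pi} (\<lambda>A x. \<Sum>n\<in>A. c n * cis (of_int n * x)) f (finite_subsets_at_top UNIV)"
  proof (rule uniform_limitI)
    fix e :: real assume "e > 0"
    have "\<forall>\<^sub>F A in finite_subsets_at_top UNIV. (\<Sum>\<^sub>\<infinity>n. norm (c n)) - (\<Sum>n\<in>A. norm (c n)) < e"
      using trig_series_tail_tendsto \<open>e > 0\<close> by (rule order_tendstoD)
    moreover have "\<forall>\<^sub>F A::int set in finite_subsets_at_top UNIV. finite A"
      by (rule eventually_finite_subsets_at_top_weakI)
    ultimately show "\<forall>\<^sub>F A in finite_subsets_at_top UNIV. \<forall>x\<in>{0..2*pi}. dist (\<Sum>n\<in>A. c n * cis (of_int n * x)) (f x) < e"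
    proof eventually_elim
      case (elim A)
      show ?case
      proof
        fix x assume "x \<in> {0..2*pi}"
        from trig_series_tail[OF elim(2) this] elim(1)
        show "dist (\<Sum>n\<in>A. c n * cis (of_int n * x)) (f x) < e"
          by (simp add: dist_norm norm_minus_commute)
      qed
    qed
  qed
qed simp

text \<open>Uniform convergence of the series permits termwise integration against \<open>G\<close>
  that is merely integrable. With G an exponential this recovers the coefficients; with an
  exponential times a function it gives the convolution formula.\<close>

lemma trig_series_integral:
  assumes G: "integrable circ G"
  shows "((\<lambda>n. c n * fc G (- n)) has_sum ((LINT x|circ. f x * G x) / (2 * of_real pi))) UNIV"
proof -
  let ?S = "\<lambda>A x. \<Sum>n\<in>A. c n * cis (of_int n * x)"
  have fG: "integrable circ (\<lambda>x. f x * G x)"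
    using integrable_circ_mult_continuous[OF G trig_series_continuous] by (simp add: mult.commute)
  have "(LINT x|circ. ?S A x * G x) = (\<Sum>n\<in>A. c n * (2 * of_real pi * fc G (- n)))" for A
  proof -
    have "(LINT x|circ. ?S A x * G x) = (LINT x|circ. (\<Sum>n\<in>A. c n * (G x * cis (- (of_int (- n) * x)))))"
      by (simp add: sum_distrib_left sum_distrib_right mult_ac)
    also have "\<dots> = (\<Sum>n\<in>A. c n * (LINT x|circ. G x * cis (- (of_int (- n) * x))))"
      using G by (subst Bochner_Integration.integral_sum) (auto intro!: integrable_circ_cis)
    finally show ?thesis by (simp only: LINT_fc)
  qed
  then have S: "(\<Sum>n\<in>A. c n * fc G (- n)) = (LINT x|circ. ?S A x * G x) / (2 * of_real pi)" for A
    by (simp add: sum_distrib_left sum_divide_distrib)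
  have SG: "integrable circ (\<lambda>x. ?S A x * G x)" for A
    using integrable_circ_mult_continuous[OF G, of "?S A"] by (simp add: mult.commute continuous_intros)
  have bound: "norm ((LINT x|circ. ?S A x * G x) - (LINT x|circ. f x * G x))
      \<le> ((\<Sum>\<^sub>\<infinity>n. norm (c n)) - (\<Sum>n\<in>A. norm (c n))) * (LINT x|circ. norm (G x))" if "finite A" for A
  proof -
    have "norm ((LINT x|circ. ?S A x * G x) - (LINT x|circ. f x * G x))
        = norm (LINT x|circ. ?S A x * G x - f x * G x)"
      using SG[of A] fG by simp
    also have "\<dots> \<le> (LINT x|circ. norm (?S A x * G x - f x * G x))"
      by (rule integral_norm_bound)
    also have "\<dots> \<le> (LINT x|circ. ((\<Sum>\<^sub>\<infinity>n. norm (c n)) - (\<Sum>n\<in>A. norm (c n))) * norm (G x))"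
    proof (rule integral_mono)
      fix x assume "x \<in> space circ"
      then have "norm (f x - ?S A x) * norm (G x) \<le> ((\<Sum>\<^sub>\<infinity>n. norm (c n)) - (\<Sum>n\<in>A. norm (c n))) * norm (G x)"
        using that by (intro mult_right_mono trig_series_tail) auto
      moreover have "?S A x * G x - f x * G x = - ((f x - ?S A x) * G x)" by (simp add: algebra_simps)
      ultimately show "norm (?S A x * G x - f x * G x) \<le> ((\<Sum>\<^sub>\<infinity>n. norm (c n)) - (\<Sum>n\<in>A. norm (c n))) * norm (G x)"
        by (simp only: norm_minus_cancel norm_mult)
    qed (use SG[of A] fG G in auto)
    finally show ?thesis by simp
  qed
  have "((\<lambda>A. (LINT x|circ. ?S A x * G x) - (LINT x|circ. f x * G x)) \<longlongrightarrow> 0) (finite_subsets_at_top UNIV)"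
  proof (rule Lim_null_comparison)
    show "\<forall>\<^sub>F A in finite_subsets_at_top UNIV. norm ((LINT x|circ. ?S A x * G x) - (LINT x|circ. f x * G x))
       \<le> ((\<Sum>\<^sub>\<infinity>n. norm (c n)) - (\<Sum>n\<in>A. norm (c n))) * (LINT x|circ. norm (G x))"
      by (rule eventually_finite_subsets_at_top_weakI) (rule bound)
    show "((\<lambda>A. ((\<Sum>\<^sub>\<infinity>n. norm (c n)) - (\<Sum>n\<in>A. norm (c n))) * (LINT x|circ. norm (G x))) \<longlongrightarrow> 0) (finite_subsets_at_top UNIV)"
      using tendsto_mult_right[OF trig_series_tail_tendsto, of "LINT x|circ. norm (G x)"] by simp
  qed
  then have "((\<lambda>A. LINT x|circ. ?S A x * G x) \<longlongrightarrow> (LINT x|circ. f x * G x)) (finite_subsets_at_top UNIV)"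
    by (simp add: LIM_zero_iff)
  then show ?thesis
    unfolding has_sum_def S by (intro tendsto_divide) auto
qed

lemma fc_trig_series: "fc f n = c n"
proof -
  have "((\<lambda>m. c m * fc (\<lambda>x. cis (of_int (- n) * x)) (- m)) has_sum ((LINT x|circ. f x * cis (of_int (- n) * x)) / (2 * of_real pi))) UNIV"
    by (intro trig_series_integral integrable_circ_continuous continuous_intros)
  moreover have "((\<lambda>m. c m * fc (\<lambda>x. cis (of_int (- n) * x)) (- m)) has_sum (c n)) UNIV"
    by (rule has_sum_finite_neutralI[of "{n}"]) (auto simp: fc_cis simp del: of_int_minus)
  ultimately show ?thesis
    by (simp add: fc_def) (rule has_sum_unique)
qed

end

text \<open>The sum of the series is continuous and has the same coefficients as \<open>u\<close>,
  so uniqueness for continuous functions gives equality at every point.\<close>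

lemma trig_series_expansion:
  assumes u: "continuous_on {0..2*pi} u" "u (2*pi) = u 0"
    and sum: "(\<lambda>n. norm (fc u n)) summable_on UNIV" and x: "x \<in> {0..2*pi}"
  shows "u x = (\<Sum>\<^sub>\<infinity>n. fc u n * cis (of_int n * x))"
proof -
  define f where "f x = (\<Sum>\<^sub>\<infinity>n. fc u n * cis (of_int n * x))" for x
  have cont: "continuous_on {0..2*pi} f"
    by (rule trig_series_continuous[OF sum]) (simp add: f_def)
  have fcf: "fc f n = fc u n" for n
    by (rule fc_trig_series[OF sum]) (simp add: f_def)
  have "f (2*pi) = f 0"
    unfolding f_def by (simp only: cis_int_2pi) simp
  moreover have "fc (\<lambda>x. u x - f x) n = 0" for n
    using u cont by (subst fc_diff) (auto intro!: integrable_circ_continuous simp: fcf)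
  ultimately have "u x - f x = 0"
    using u cont x by (intro fc_zero_continuous[of "\<lambda>x. u x - f x"]) (auto intro!: continuous_intros)
  then show ?thesis by (simp add: f_def)
qed

section \<open>Periodic functions\<close>

lemma periodic2pi_int:
  assumes "periodic2pi f"
  shows "f (x + of_int k * (2 * pi)) = f x"
proof -
  have nat: "f (x + of_nat n * (2 * pi)) = f x" for n x
  proof (induction n)
    case (Suc n)
    have "f (x + of_nat (Suc n) * (2 * pi)) = f ((x + of_nat n * (2 * pi)) + 2 * pi)"
      by (simp add: algebra_simps)
    then show ?case using assms Suc by (simp only: periodic2pi_def)
  qed simp
  show ?thesis
  proof (cases "k \<ge> 0")
    case True
    then show ?thesis using nat[of x "nat k"] by simp
  next
    case False
    then show ?thesis using nat[of "x + of_int k * (2 * pi)" "nat (- k)"] by (simp add: algebra_simps)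
  qed
qed

lemma reduce_mod_2pi:
  obtains k :: int where "x - of_int k * (2 * pi) \<in> {0..2*pi}"
proof -
  define k where "k = \<lfloor>x / (2 * pi)\<rfloor>"
  have "of_int k \<le> x / (2 * pi)" "x / (2 * pi) \<le> of_int k + 1"
    unfolding k_def by linarith+
  then have "of_int k * (2 * pi) \<le> x" "x \<le> of_int k * (2 * pi) + 2 * pi"
    by (simp_all add: field_simps)
  then show thesis by (intro that[of k]) auto
qed

lemma periodic2pi_eqI:
  assumes "periodic2pi f" "periodic2pi g" "\<And>x. x \<in> {0..2*pi} \<Longrightarrow> f x = g x"
  shows "f = g"
proof
  fix x
  obtain k :: int where k: "x - of_int k * (2 * pi) \<in> {0..2*pi}" by (rule reduce_mod_2pi)
  have "f (x - of_int k * (2 * pi)) = f x" "g (x - of_int k * (2 * pi)) = g x"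
    using periodic2pi_int[OF assms(1), of x "- k"] periodic2pi_int[OF assms(2), of x "- k"] by simp_all
  with assms(3)[OF k] show "f x = g x" by simp
qed

text \<open>The exceptional set on the line is covered by countably many translates of the one on a
  single period.\<close>

lemma AE_periodic2pi:
  assumes P: "AE x in circ. P x" and per: "\<And>x. P (x + 2 * pi) = P x"
  shows "AE x in lborel. P x"
proof -
  have per': "periodic2pi (\<lambda>x. of_bool (P x))"
    using per by (simp add: periodic2pi_def)
  have P': "AE x in lborel. x \<in> {0..2*pi} \<longrightarrow> P x"
    using P unfolding circ_def by (subst (asm) AE_restrict_space_iff) auto
  have shift: "AE x in lborel. x - of_int k * (2 * pi) \<in> {0..2*pi} \<longrightarrow> P x" for k :: int
  proof -
    obtain N where N: "N \<in> null_sets lborel" "{x. \<not> (x \<in> {0..2*pi} \<longrightarrow> P x)} \<subseteq> N"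
      using P' by (auto simp: eventually_ae_filter)
    have "{x. x - of_int k * (2 * pi) \<in> N} \<in> null_sets lborel"
      using N(1) by (rule null_sets_translation)
    moreover have "{x. \<not> (x - of_int k * (2 * pi) \<in> {0..2*pi} \<longrightarrow> P x)} \<subseteq> {x. x - of_int k * (2 * pi) \<in> N}"
    proof
      fix x assume "x \<in> {x. \<not> (x - of_int k * (2 * pi) \<in> {0..2*pi} \<longrightarrow> P x)}"
      moreover have "P (x - of_int k * (2 * pi)) = P x"
        using periodic2pi_int[OF per', of x "- k"] by (simp add: of_bool_eq_iff)
      ultimately show "x \<in> {x. x - of_int k * (2 * pi) \<in> N}" using N(2) by auto
    qed
    ultimately show ?thesis by (intro AE_I') auto
  qed
  have "AE x in lborel. \<forall>k::int. x - of_int k * (2 * pi) \<in> {0..2*pi} \<longrightarrow> P x"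
    unfolding AE_all_countable using shift by blast
  then show ?thesis
  proof eventually_elim
    case (elim x)
    obtain k :: int where "x - of_int k * (2 * pi) \<in> {0..2*pi}" by (rule reduce_mod_2pi)
    with elim show ?case by blast
  qed
qed

lemma L2perD:
  assumes "f \<in> L2per"
  shows "f \<in> borel_measurable borel" "periodic2pi f" "integrable circ (\<lambda>x. (f x)\<^sup>2)"
  using assms by (auto simp: L2per_def set_integrable_circ)

lemma L2perI:
  assumes "f \<in> borel_measurable borel" "periodic2pi f" "integrable circ (\<lambda>x. (f x)\<^sup>2)"
  shows "f \<in> L2per"
  using assms by (auto simp: L2per_def set_integrable_circ)

lemma L2per_sq_integrable: "f \<in> L2per \<Longrightarrow> sq_integrable (\<lambda>x. of_real (f x))"
  using L2perD[of f] by (auto simp: sq_integrable_def)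

lemma L2per_integrable: "f \<in> L2per \<Longrightarrow> integrable circ f"
  using sq_integrable_imp_integrable[OF L2per_sq_integrable, of f] by (simp add: complex_of_real_integrable_eq)

lemma L2per_lincomb:
  assumes "f \<in> L2per" "g \<in> L2per"
  shows "(\<lambda>x. f x + s * g x) \<in> L2per"
proof (rule L2perI)
  note [measurable] = L2perD(1)[OF assms(1)] L2perD(1)[OF assms(2)]
  show "(\<lambda>x. f x + s * g x) \<in> borel_measurable borel" by measurable
  show "periodic2pi (\<lambda>x. f x + s * g x)"
    using assms by (simp add: L2per_def periodic2pi_def)
  show "integrable circ (\<lambda>x. (f x + s * g x)\<^sup>2)"
  proof (rule Bochner_Integration.integrable_bound)
    show "integrable circ (\<lambda>x. 2 * (f x)\<^sup>2 + 2 * s\<^sup>2 * (g x)\<^sup>2)"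
      using L2perD(3)[OF assms(1)] L2perD(3)[OF assms(2)] by simp
    have "(a + s * b)\<^sup>2 \<le> 2 * a\<^sup>2 + 2 * s\<^sup>2 * b\<^sup>2" for a b :: real
      using zero_le_power2[of "a - s * b"] by (simp add: power2_eq_square algebra_simps)
    then show "AE x in circ. norm ((f x + s * g x)\<^sup>2) \<le> norm (2 * (f x)\<^sup>2 + 2 * s\<^sup>2 * (g x)\<^sup>2)"
      by (intro AE_I2) simp
  qed simp
qed

lemma L2per_continuous:
  assumes "continuous_on UNIV f" "periodic2pi f"
  shows "f \<in> L2per"
proof -
  have "continuous_on {0..2*pi} f" using assms(1) by (rule continuous_on_subset) simp
  then show ?thesis
    using assms by (intro L2perI borel_measurable_continuous_onI integrable_circ_continuous continuous_on_power)
qed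

text \<open>This makes the representatives selected by \<open>wderiv\<close> and \<open>CC\<close>
  harmless: any two candidates agree almost everywhere.\<close>

lemma L2per_eq_AE:
  assumes f: "f \<in> L2per" and g: "g \<in> L2per" and eq: "\<And>n. fourier_coeff f n = fourier_coeff g n"
  shows "AE x in circ. f x = g x" "AE x in lborel. f x = g x"
proof -
  have int: "integrable circ (\<lambda>x. complex_of_real (f x))" "integrable circ (\<lambda>x. complex_of_real (g x))"
    using f g by (auto intro: sq_integrable_imp_integrable L2per_sq_integrable)
  have "AE x in circ. complex_of_real (f x) - complex_of_real (g x) = 0"
    by (rule fc_zero_AE_zero) (use int eq in \<open>auto simp: fc_diff fourier_coeff_fc\<close>)
  then show *: "AE x in circ. f x = g x"
    by eventually_elim simp
  show "AE x in lborel. f x = g x"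
    using * L2perD(2)[OF f] L2perD(2)[OF g] by (intro AE_periodic2pi) (auto simp: periodic2pi_def)
qed

text \<open>\<open>is_weak_deriv\<close> integrates over arbitrary intervals, while
  \<open>L2per\<close> speaks of one period; finitely many translated periods cover the
  interval.\<close>

lemma L2per_set_integrable:
  assumes "f \<in> L2per"
  shows "set_integrable lborel {a..b} f"
proof -
  have shift: "set_integrable lborel {of_int k * (2 * pi)..of_int k * (2 * pi) + 2 * pi} f" for k :: int
  proof -
    let ?c = "of_int k * (2 * pi)"
    have "integrable lborel (\<lambda>x. indicator {0..2*pi} x *\<^sub>R f x)"
      using L2per_integrable[OF assms] by (simp add: circ_def integrable_restrict_space)
    from lborel_integrable_real_affine[OF this, of 1 "- ?c"]
    have "integrable lborel (\<lambda>x. indicator {0..2*pi} (x - ?c) *\<^sub>R f (x - ?c))" by simp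
    moreover have "f (x - ?c) = f x" for x
      using periodic2pi_int[OF L2perD(2)[OF assms], of x "- k"] by simp
    moreover have "indicator {0..2*pi} (x - ?c) = (indicator {?c..?c + 2 * pi} x :: real)" for x
      by (auto simp: indicator_def)
    ultimately show ?thesis by (simp add: set_integrable_def)
  qed
  define K where "K = {\<lfloor>a / (2 * pi)\<rfloor>..\<lfloor>b / (2 * pi)\<rfloor>}"
  have "set_integrable lborel (\<Union>k\<in>K. {of_int k * (2 * pi)..of_int k * (2 * pi) + 2 * pi}) f"
    by (rule set_integrable_UN) (auto simp: K_def shift)
  then show ?thesis
  proof (rule set_integrable_subset)
    show "{a..b} \<subseteq> (\<Union>k\<in>K. {of_int k * (2 * pi)..of_int k * (2 * pi) + 2 * pi})"
    proof
      fix x assume x: "x \<in> {a..b}"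
      define k where "k = \<lfloor>x / (2 * pi)\<rfloor>"
      have "k \<in> K" using x by (auto simp: k_def K_def intro!: floor_mono divide_right_mono)
      have "of_int k \<le> x / (2 * pi)" "x / (2 * pi) \<le> of_int k + 1"
        unfolding k_def by linarith+
      then have "of_int k * (2 * pi) \<le> x" "x \<le> of_int k * (2 * pi) + 2 * pi"
        by (simp_all add: field_simps)
      with \<open>k \<in> K\<close> show "x \<in> (\<Union>k\<in>K. {of_int k * (2 * pi)..of_int k * (2 * pi) + 2 * pi})" by auto
    qed
  qed simp
qed

section \<open>The spaces and the multiplier\<close>

lemma is_weak_deriv_continuous:
  assumes "is_weak_deriv u v"
  shows "continuous_on {0..2*pi} u"
proof -
  have v: "v \<in> L2per" using assms by (simp add: is_weak_deriv_def)
  have eq: "u x = u 0 + integral {0..x} v" if "x \<in> {0..2*pi}" for x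
  proof -
    have "u x - u 0 = (LBINT t:{0..x}. v t)"
      using assms that by (simp add: is_weak_deriv_def)
    also have "\<dots> = integral {0..x} v"
      using L2per_set_integrable[OF v] by (rule set_borel_integral_eq_integral(2))
    finally show ?thesis by simp
  qed
  have "v integrable_on {0..2*pi}"
    using L2per_set_integrable[OF v] by (rule set_borel_integral_eq_integral(1))
  then have "continuous_on {0..2*pi} (\<lambda>x. u 0 + integral {0..x} v)"
    by (intro continuous_intros indefinite_integral_continuous_1)
  then show ?thesis
    by (subst continuous_on_cong[OF refl eq])
qed

text \<open>Periodicity of \<open>u\<close> forces the weak derivative to have zero mean, which is
  the condition under which the integration by parts has no boundary term.\<close>

lemma fourier_coeff_weak_deriv:
  assumes uv: "is_weak_deriv u v" and per: "periodic2pi u"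
  shows "fourier_coeff v n = \<i> * of_int n * fourier_coeff u n"
proof -
  have v: "v \<in> L2per" using uv by (simp add: is_weak_deriv_def)
  have int: "integrable circ (\<lambda>x. complex_of_real (v x))"
    using L2per_integrable[OF v] by simp
  have eq: "u x = u 0 + (LINT t|circ. indicator {..x} t *\<^sub>R v t)" if "x \<in> {0..2*pi}" for x
  proof -
    have "u x - u 0 = (LBINT t:{0..x}. v t)"
      using uv that by (simp add: is_weak_deriv_def)
    also have "\<dots> = (LINT t|circ. indicator {..x} t *\<^sub>R v t)"
      unfolding set_lebesgue_integral_def circ_def using that
      by (subst integral_restrict_space) (auto simp: indicator_def intro!: Bochner_Integration.integral_cong)
    finally show ?thesis by simp
  qed
  have conv: "(LINT t|circ. indicator {..x} t *\<^sub>R complex_of_real (v t)) = of_real (LINT t|circ. indicator {..x} t *\<^sub>R v t)" for x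
    by (simp add: scaleR_conv_of_real flip: of_real_mult)
  have "(LINT t|circ. v t) = 0"
  proof -
    have "(LINT t|circ. v t) = (LINT t|circ. indicator {..2*pi} t *\<^sub>R v t)"
      by (rule Bochner_Integration.integral_cong) auto
    also have "\<dots> = u (2 * pi) - u 0" using eq[of "2*pi"] by simp
    also have "\<dots> = 0" using per[unfolded periodic2pi_def, rule_format, of 0] by simp
    finally show ?thesis .
  qed
  then have "(LINT t|circ. complex_of_real (v t)) = 0" by simp
  moreover have "complex_of_real (u x) = of_real (u 0) + (LINT t|circ. indicator {..x} t *\<^sub>R complex_of_real (v t))"
    if "x \<in> {0..2*pi}" for x
    unfolding conv of_real_add[symmetric] by (rule arg_cong[OF eq[OF that]])
  ultimately show ?thesis
    unfolding fourier_coeff_fc by (rule fc_antiderivative[OF int])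
qed

lemma is_weak_deriv_wderiv:
  assumes "u \<in> H1per0"
  shows "is_weak_deriv u (wderiv u)"
proof -
  have "\<exists>v. is_weak_deriv u v" using assms by (auto simp: H1per0_def)
  then show ?thesis unfolding wderiv_def by (rule someI_ex)
qed

lemma H1per0D:
  assumes "u \<in> H1per0"
  shows "periodic2pi u" "wderiv u \<in> L2per" "continuous_on {0..2*pi} u" "fourier_coeff u 0 = 0"
    "fourier_coeff (wderiv u) n = \<i> * of_int n * fourier_coeff u n"
proof -
  note wd = is_weak_deriv_wderiv[OF assms]
  show per: "periodic2pi u" using assms by (simp add: H1per0_def)
  show "wderiv u \<in> L2per" using wd by (simp add: is_weak_deriv_def)
  show "continuous_on {0..2*pi} u" using wd by (rule is_weak_deriv_continuous)
  show "fourier_coeff (wderiv u) n = \<i> * of_int n * fourier_coeff u n"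
    by (rule fourier_coeff_weak_deriv[OF wd per])
  have "(LINT x|circ. u x) = 0"
    using assms by (simp add: H1per0_def mean2pi_def LBINT_circ)
  then show "fourier_coeff u 0 = 0" by (simp add: fourier_coeff_fc fc_def)
qed

text \<open>For n \<noteq> 0, |u_n| = |v_n| / |n| \<le> |v_n|^2 + 1/n^2, and both parts are
  summable, the first by Bessel.\<close>

lemma abs_summable_fourier_coeff_weak_deriv:
  assumes uv: "is_weak_deriv u v" and per: "periodic2pi u"
  shows "(\<lambda>n. norm (fourier_coeff u n)) summable_on UNIV"
proof -
  have v: "v \<in> L2per" using uv by (simp add: is_weak_deriv_def)
  let ?b = "\<lambda>n. (norm (fourier_coeff v n))\<^sup>2 + 1 / (of_int n)\<^sup>2"
  have "?b summable_on UNIV"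
    using bessel_summable[OF L2per_sq_integrable[OF v]]
    by (intro summable_on_add summable_inverse_square_int) (simp add: fourier_coeff_fc)
  then have "?b summable_on (UNIV - {0})" by (rule summable_on_subset_banach) simp
  then have "(\<lambda>n. norm (fourier_coeff u n)) summable_on (UNIV - {0})"
  proof (rule summable_on_comparison_test)
    fix n :: int assume "n \<in> UNIV - {0}"
    then have n: "real_of_int \<bar>n\<bar> > 0" by simp
    have "norm (fourier_coeff v n) = of_int \<bar>n\<bar> * norm (fourier_coeff u n)"
      by (simp add: fourier_coeff_weak_deriv[OF uv per] norm_mult)
    then have "norm (fourier_coeff u n) = norm (fourier_coeff v n) * (1 / of_int \<bar>n\<bar>)"
      using n by (simp add: field_simps)
    also have "\<dots> \<le> (norm (fourier_coeff v n))\<^sup>2 + (1 / of_int \<bar>n\<bar>)\<^sup>2"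
    proof -
      have "a * b \<le> a\<^sup>2 + b\<^sup>2" if "a \<ge> 0" "b \<ge> 0" for a b :: real
        using zero_le_power2[of "a - b"] mult_nonneg_nonneg[OF that] by (simp add: power2_diff)
      from this[of "norm (fourier_coeff v n)" "1 / of_int \<bar>n\<bar>"] show ?thesis by simp
    qed
    finally show "norm (fourier_coeff u n) \<le> ?b n" by (simp add: power_divide)
  qed simp
  then have "(\<lambda>n. norm (fourier_coeff u n)) summable_on ((UNIV - {0}) \<union> {0})"
    by (intro summable_on_Un_disjoint) auto
  then show ?thesis by simp
qed

section \<open>Monotonicity and growth of the symbol n coth (n D)\<close>

lemma coth_minus: "coth (- x) = - coth x"
  by (simp add: coth_def)

lemma coth_gt_1: "x > 0 \<Longrightarrow> coth x > 1"
  by (simp add: coth_def cosh_def sinh_def)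

lemma coth_antimono:
  assumes "0 < x" "x \<le> y"
  shows "coth y \<le> coth x"
proof -
  have eq: "coth z = 1 / tanh z" for z by (simp add: coth_def tanh_def)
  have "tanh x > 0" "tanh x \<le> tanh y" using assms by auto
  then show ?thesis unfolding eq by (intro divide_left_mono mult_pos_pos) auto
qed

lemma mult_coth_strict_mono:
  assumes "0 < x" "x < y"
  shows "x * coth x < y * coth y"
proof (rule DERIV_pos_imp_increasing[OF assms(2)])
  fix z assume "x \<le> z" "z \<le> y"
  then have z: "z > 0" using assms by simp
  then have s: "sinh z > 0" by simp
  \<comment> \<open>The numerator is positive because sinh z > z and cosh z \<ge> 1 for z >
    0.\<close>
  have "((\<lambda>z. z * (cosh z / sinh z)) has_real_derivative (cosh z * sinh z - z) / (sinh z)\<^sup>2) (at z)"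
  proof -
    have "(sinh z)\<^sup>2 - (cosh z)\<^sup>2 = -1" by (simp add: cosh_square_eq)
    then have "z * (sinh z * sinh z - cosh z * cosh z) = - z"
      by (simp add: power2_eq_square)
    with s show ?thesis
      by (auto intro!: derivative_eq_intros simp: field_simps power2_eq_square)
  qed
  moreover have "cosh z * sinh z > z"
  proof -
    have "sinh z > sinh 0 + 1 * (z - 0)"
    proof -
      have "\<exists>t>0. t < z \<and> sinh z - sinh 0 = (z - 0) * cosh t"
        by (rule MVT2) (use z in \<open>auto intro!: derivative_eq_intros\<close>)
      then obtain t where t: "0 < t" "t < z" "sinh z - sinh 0 = (z - 0) * cosh t" by blast
      moreover have "cosh t > 1" using t(1) by (simp add: cosh_real_strict_mono flip: cosh_0)
      ultimately show ?thesis using z by simp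
    qed
    moreover have "cosh z * sinh z \<ge> 1 * sinh z"
      using s by (intro mult_right_mono cosh_real_ge_1) auto
    ultimately show ?thesis by simp
  qed
  ultimately show "\<exists>d. ((\<lambda>z. z * coth z) has_real_derivative d) (at z) \<and> 0 < d"
    using s unfolding coth_def by (intro exI[of _ "(cosh z * sinh z - z) / (sinh z)\<^sup>2"]) auto
qed

text \<open>The factor n gives the value 0 at n = 0, in agreement with \<open>CC\<close>
  annihilating the mean, so no case distinction is carried along.\<close>

definition lam :: "real \<Rightarrow> int \<Rightarrow> real" where
  "lam D n = of_int n * coth (of_int n * D)"

lemma lam_0 [simp]: "lam D 0 = 0"
  by (simp add: lam_def)

lemma lam_minus: "lam D (- n) = lam D n"
  by (simp add: lam_def coth_minus)

lemma lam_abs: "lam D \<bar>n\<bar> = lam D n"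
  by (cases "n \<ge> 0") (auto simp: lam_minus)

lemma lam_strict_mono:
  assumes "D > 0" "0 < m" "m < n"
  shows "lam D m < lam D n"
proof -
  have "(of_int m * D) * coth (of_int m * D) < (of_int n * D) * coth (of_int n * D)"
    using assms by (intro mult_coth_strict_mono) auto
  then have "lam D m * D < lam D n * D" by (simp add: lam_def mult_ac)
  then show ?thesis using assms by simp
qed

lemma lam_mono:
  assumes "D > 0" "0 < m" "m \<le> \<bar>n\<bar>"
  shows "lam D m \<le> lam D n"
  using lam_strict_mono[of D m "\<bar>n\<bar>"] assms by (cases "m = \<bar>n\<bar>") (auto simp: lam_abs)

lemma lam_1: "lam D 1 = coth D"
  by (simp add: lam_def)

lemma lam_1_pos: "D > 0 \<Longrightarrow> lam D 1 > 0"
  using coth_gt_1[of D] by (simp add: lam_1)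

lemma lam_nonneg: "lam D n \<ge> 0" if "D > 0"
proof (cases "n = 0")
  case False
  then have "1 \<le> \<bar>n\<bar>" by linarith
  with lam_mono[of D 1 n] lam_1_pos[of D] that show ?thesis by simp
qed simp

text \<open>\<open>coth\<close> decreases, so the symbol grows at most linearly. One factor |n| is
  later absorbed by the decay of the coefficients of w or of w^2.\<close>

lemma lam_le:
  assumes "D > 0"
  shows "lam D n \<le> coth D * of_int \<bar>n\<bar>"
proof (cases "n = 0")
  case False
  then have "1 * D \<le> of_int \<bar>n\<bar> * D" using assms by (intro mult_right_mono) auto
  then have "coth (of_int \<bar>n\<bar> * D) \<le> coth D" using assms by (intro coth_antimono) auto
  then have "of_int \<bar>n\<bar> * coth (of_int \<bar>n\<bar> * D) \<le> of_int \<bar>n\<bar> * coth D" by (intro mult_left_mono) auto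
  then show ?thesis using lam_abs[of D n] by (simp add: lam_def mult.commute)
qed simp

lemma fourier_coeff_minus: "fourier_coeff f (- n) = cnj (fourier_coeff f n)"
  using fc_cnj[of "\<lambda>x. of_real (f x)" "- n"] by (simp add: fourier_coeff_fc)

text \<open>The required coefficients are square summable, since |coth (n D)| \<le> coth D for n
  \<noteq> 0, and conjugate symmetric, since \<open>coth\<close> is odd. So Riesz-Fischer provides a
  real function, and the choice in \<open>CC\<close> is legitimate.\<close>

lemma CC_L2per:
  assumes D: "D > 0" and f: "f \<in> L2per"
  shows "CC D f \<in> L2per"
    and "fourier_coeff (CC D f) n = (if n = 0 then 0 else - \<i> * of_real (coth (of_int n * D)) * fourier_coeff f n)"
proof -
  define c where "c n = (if n = 0 then 0 else - \<i> * of_real (coth (of_int n * D)) * fourier_coeff f n)" for n :: int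
  have bound: "\<bar>coth (of_int n * D)\<bar> \<le> coth D" if "n \<noteq> 0" for n :: int
  proof -
    have "\<bar>coth (of_int n * D)\<bar> = coth (of_int \<bar>n\<bar> * D)"
      using coth_gt_1[of "of_int \<bar>n\<bar> * D"] D that coth_minus[of "of_int n * D"] mult_neg_pos[of "of_int n" D]
      by (cases "n \<ge> 0") auto
    moreover have "1 * D \<le> of_int \<bar>n\<bar> * D" using D that by (intro mult_right_mono) auto
    ultimately show ?thesis using D by (auto intro!: coth_antimono)
  qed
  have "(\<lambda>n. (coth D)\<^sup>2 * (norm (fourier_coeff f n))\<^sup>2) summable_on UNIV"
    using bessel_summable[OF L2per_sq_integrable[OF f]]
    by (intro summable_on_cmult_right) (simp add: fourier_coeff_fc)
  then have sum: "(\<lambda>n. (norm (c n))\<^sup>2) summable_on UNIV"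
  proof (rule summable_on_comparison_test)
    fix n :: int
    show "(norm (c n))\<^sup>2 \<le> (coth D)\<^sup>2 * (norm (fourier_coeff f n))\<^sup>2"
    proof (cases "n = 0")
      case False
      then have "norm (c n) \<le> coth D * norm (fourier_coeff f n)"
        using bound[OF False] by (auto simp: c_def norm_mult intro!: mult_right_mono)
      then show ?thesis
        by (simp add: power_mono flip: power_mult_distrib)
    qed (simp add: c_def)
  qed simp
  have sym: "c (- n) = cnj (c n)" for n
    by (simp add: c_def fourier_coeff_minus coth_minus)
  obtain F where "F \<in> borel_measurable borel" "periodic2pi F" "integrable circ (\<lambda>x. (F x)\<^sup>2)"
      "\<And>n. fc (\<lambda>x. of_real (F x)) n = c n"
    using Riesz_Fischer[OF sum sym] by blast
  then have "F \<in> L2per \<and> (\<forall>n. fourier_coeff F n = c n)"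
    by (simp add: L2perI fourier_coeff_fc)
  then have "\<exists>F. F \<in> L2per \<and> (\<forall>n. fourier_coeff F n = c n)" by blast
  from someI_ex[OF this] have "CC D f \<in> L2per \<and> (\<forall>n. fourier_coeff (CC D f) n = c n)"
    unfolding CC_def c_def .
  then show "CC D f \<in> L2per" 
    "fourier_coeff (CC D f) n = (if n = 0 then 0 else - \<i> * of_real (coth (of_int n * D)) * fourier_coeff f n)"
    by (simp_all add: c_def)
qed

lemma CC_wderiv:
  assumes "D > 0" "u \<in> H1per0"
  shows "CC D (wderiv u) \<in> L2per" "fourier_coeff (CC D (wderiv u)) n = of_real (lam D n) * fourier_coeff u n"
proof -
  note L2 = H1per0D(2)[OF assms(2)]
  show "CC D (wderiv u) \<in> L2per" by (rule CC_L2per(1)[OF assms(1) L2])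
  have "- \<i> * of_real c * (\<i> * of_int n * z) = of_real (of_int n * c) * z" for c z
    by (simp add: complex_eq_iff algebra_simps)
  then show "fourier_coeff (CC D (wderiv u)) n = of_real (lam D n) * fourier_coeff u n"
    by (simp only: CC_L2per(2)[OF assms(1) L2] H1per0D(5)[OF assms(2)] lam_def) simp
qed

section \<open>The second variation\<close>

lemma H1per0_lincomb:
  assumes u: "u \<in> H1per0" and v: "v \<in> H1per0"
  shows "(\<lambda>x. u x + s * v x) \<in> H1per0"
proof -
  note du = is_weak_deriv_wderiv[OF u] and dv = is_weak_deriv_wderiv[OF v]
  have L2: "wderiv u \<in> L2per" "wderiv v \<in> L2per" using u v by (auto dest: H1per0D)
  have "is_weak_deriv (\<lambda>x. u x + s * v x) (\<lambda>x. wderiv u x + s * wderiv v x)"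
    unfolding is_weak_deriv_def
  proof (intro conjI allI impI)
    fix a b :: real assume "a \<le> b"
    then have "u b - u a = (LBINT t:{a..b}. wderiv u t)" "v b - v a = (LBINT t:{a..b}. wderiv v t)"
      using du dv by (auto simp: is_weak_deriv_def)
    then show "u b + s * v b - (u a + s * v a) = (LBINT t:{a..b}. wderiv u t + s * wderiv v t)"
      using L2per_set_integrable[OF L2(1), of a b] L2per_set_integrable[OF L2(2), of a b]
      by (simp add: set_integral_add algebra_simps)
  qed (use L2 in \<open>auto intro: L2per_lincomb\<close>)
  moreover have "integrable circ u" "integrable circ v"
    using u v by (auto intro: integrable_circ_continuous dest: H1per0D)
  ultimately show ?thesis
    using u v by (auto simp: H1per0_def periodic2pi_def mean2pi_def LBINT_circ)
qed

text \<open>Linearity can be claimed only almost everywhere: the representatives for u, v and their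
  combination are chosen independently of each other.\<close>

lemma CC_wderiv_lincomb:
  assumes D: "D > 0" and u: "u \<in> H1per0" and v: "v \<in> H1per0"
  shows "AE x in circ. CC D (wderiv (\<lambda>x. u x + s * v x)) x = CC D (wderiv u) x + s * CC D (wderiv v) x"
proof (rule L2per_eq_AE(1))
  note uv = H1per0_lincomb[OF u v, of s]
  show "CC D (wderiv (\<lambda>x. u x + s * v x)) \<in> L2per" "(\<lambda>x. CC D (wderiv u) x + s * CC D (wderiv v) x) \<in> L2per"
    using CC_wderiv[OF D] u v uv by (auto intro: L2per_lincomb)
  fix n
  have lin: "fourier_coeff (\<lambda>x. f x + s * g x) n = fourier_coeff f n + s * fourier_coeff g n"
    if "integrable circ f" "integrable circ g" for f g
    using that by (simp add: fourier_coeff_fc fc_add fc_cmult)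
  have "integrable circ u" "integrable circ v"
    using u v by (auto intro: integrable_circ_continuous dest: H1per0D)
  moreover have "integrable circ (CC D (wderiv u))" "integrable circ (CC D (wderiv v))"
    using CC_wderiv[OF D] u v by (auto intro: L2per_integrable)
  ultimately show "fourier_coeff (CC D (wderiv (\<lambda>x. u x + s * v x))) n
      = fourier_coeff (\<lambda>x. CC D (wderiv u) x + s * CC D (wderiv v) x) n"
    by (simp add: lin CC_wderiv[OF D] u v uv algebra_simps)
qed

text \<open>Along w + s u the functional is a cubic polynomial in s whose coefficients are the
  integrals of \<open>a\<close>, \<open>b\<close>, \<open>c\<close>, \<open>d\<close> below. Thus
  the iterated derivative at 0 is 2 times the integral of \<open>c\<close>, with no differentiation
  under the integral sign.\<close>

lemma second_var_eq:
  assumes D: "k * h > 0" and w: "w \<in> H1per0" and u: "u \<in> H1per0"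
  shows "second_var g h k m Q w u =
    2 * (LINT x|circ. (Q - 2 * g * (w x + h)) * u x * CC (k*h) (wderiv u) x
        - g * (u x)\<^sup>2 * (1 / k + CC (k*h) (wderiv w) x))"
proof -
  define W where "W = CC (k*h) (wderiv w)"
  define U where "U = CC (k*h) (wderiv u)"
  have cont: "continuous_on {0..2*pi} w" "continuous_on {0..2*pi} u"
    using u w by (auto dest: H1per0D)
  have int: "integrable circ W" "integrable circ U"
    unfolding W_def U_def using CC_wderiv(1)[OF D] u w by (auto intro: L2per_integrable)
  then have meas [measurable]: "W \<in> borel_measurable circ" "U \<in> borel_measurable circ" 
    "w \<in> borel_measurable circ" "u \<in> borel_measurable circ"
    using cont by (auto intro: continuous_measurable_circ)
  have intc: "integrable circ (\<lambda>x. f x * (c + W x))" "integrable circ (\<lambda>x. f x * U x)"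
    if "continuous_on {0..2*pi} f" for f c
    using integrable_circ_mult_continuous[of "\<lambda>x. c + W x" f] integrable_circ_mult_continuous[OF int(2) that] int that
    by (simp_all add: mult.commute)
  let ?v = "\<lambda>x. w x + h"
  define a where "a x = (Q * ?v x - g * (?v x)\<^sup>2) * (1 / k + W x) + m\<^sup>2 / (k*h)" for x
  define b where "b x = (Q * u x - 2 * g * ?v x * u x) * (1 / k + W x) + (Q * ?v x - g * (?v x)\<^sup>2) * U x" for x
  define c where "c x = ((Q - 2 * g * ?v x) * u x) * U x - (g * (u x)\<^sup>2) * (1 / k + W x)" for x
  define d where "d x = (- g * (u x)\<^sup>2) * U x" for x
  have abcd: "integrable circ a" "integrable circ b" "integrable circ c" "integrable circ d"
    unfolding a_def[abs_def] b_def[abs_def] c_def[abs_def] d_def[abs_def]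
    by (intro Bochner_Integration.integrable_add Bochner_Integration.integrable_diff intc continuous_intros cont circ.integrable_const)+
  have Lam: "Lam g k m Q (\<lambda>x. w x + s * u x) h
      = integral\<^sup>L circ a + s * integral\<^sup>L circ b + s^2 * integral\<^sup>L circ c + s^3 * integral\<^sup>L circ d" for s
  proof -
    have "Lam g k m Q (\<lambda>x. w x + s * u x) h =
       (LINT x|circ. (Q * (w x + s * u x + h) - g * (w x + s * u x + h)\<^sup>2)
          * (1 / k + CC (k*h) (wderiv (\<lambda>x. w x + s * u x)) x) + m\<^sup>2 / (k*h))"
      by (simp add: Lam_def LBINT_circ)
    also have "\<dots> = (LINT x|circ. a x + s * b x + s^2 * c x + s^3 * d x)"
    proof (rule integral_cong_AE)
      have [measurable]: "CC (k*h) (wderiv (\<lambda>x. w x + s * u x)) \<in> borel_measurable circ"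
        using L2per_integrable[OF CC_wderiv(1)[OF D H1per0_lincomb[OF w u]]] by auto
      show "(\<lambda>x. (Q * (w x + s * u x + h) - g * (w x + s * u x + h)\<^sup>2)
          * (1 / k + CC (k*h) (wderiv (\<lambda>x. w x + s * u x)) x) + m\<^sup>2 / (k*h)) \<in> borel_measurable circ"
        by measurable
      show "(\<lambda>x. a x + s * b x + s^2 * c x + s^3 * d x) \<in> borel_measurable circ"
        using abcd by auto
      show "AE x in circ. (Q * (w x + s * u x + h) - g * (w x + s * u x + h)\<^sup>2)
          * (1 / k + CC (k*h) (wderiv (\<lambda>x. w x + s * u x)) x) + m\<^sup>2 / (k*h) = a x + s * b x + s^2 * c x + s^3 * d x"
        using CC_wderiv_lincomb[OF D w u, of s]
      proof eventually_elim
        case (elim x)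
        \<comment> \<open>Naming the two quotients makes them atoms, which leaves a polynomial
          identity.\<close>
        define K where "K = 1 / k"
        define L where "L = m\<^sup>2 / (k * h)"
        show ?case
          unfolding elim a_def b_def c_def d_def W_def[symmetric] U_def[symmetric] K_def[symmetric] L_def[symmetric]
          by algebra
      qed
    qed
    also have "\<dots> = integral\<^sup>L circ a + s * integral\<^sup>L circ b + s^2 * integral\<^sup>L circ c + s^3 * integral\<^sup>L circ d"
      using abcd by simp
    finally show ?thesis .
  qed
  have "deriv (\<lambda>s. Lam g k m Q (\<lambda>x. w x + s * u x) h)
     = (\<lambda>s. integral\<^sup>L circ b + 2 * s * integral\<^sup>L circ c + 3 * s^2 * integral\<^sup>L circ d)"
    unfolding Lam
    by (intro ext DERIV_imp_deriv) (auto intro!: derivative_eq_intros simp: power2_eq_square power3_eq_cube)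
  moreover have "deriv (\<lambda>s. integral\<^sup>L circ b + 2 * s * integral\<^sup>L circ c + 3 * s^2 * integral\<^sup>L circ d) 0 = 2 * integral\<^sup>L circ c"
    by (intro DERIV_imp_deriv) (auto intro!: derivative_eq_intros)
  ultimately show ?thesis
    by (simp add: second_var_def c_def[abs_def] W_def U_def)
qed

section \<open>Pointwise expansion and Parseval identities in H1\<close>

lemma H1per0_abs_summable: "u \<in> H1per0 \<Longrightarrow> (\<lambda>n. norm (fourier_coeff u n)) summable_on UNIV"
  by (rule abs_summable_fourier_coeff_weak_deriv[OF is_weak_deriv_wderiv H1per0D(1)])

lemma H1per0_expansion:
  assumes u: "u \<in> H1per0" and x: "x \<in> {0..2*pi}"
  shows "of_real (u x) = (\<Sum>\<^sub>\<infinity>n. fourier_coeff u n * cis (of_int n * x))"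
proof -
  have "u (2 * pi) = u 0"
    using H1per0D(1)[OF u, unfolded periodic2pi_def, rule_format, of 0] by simp
  then show ?thesis
    using H1per0_abs_summable[OF u] x H1per0D(3)[OF u]
    unfolding fourier_coeff_fc
    by (intro trig_series_expansion) (auto intro!: continuous_intros)
qed

text \<open>Equality everywhere and not only almost everywhere, because members of
  \<open>H1per0\<close> are continuous and equal their Fourier series at each point.\<close>

lemma H1per0_eqI:
  assumes u: "u \<in> H1per0" and v: "v \<in> H1per0" and eq: "\<And>n. fourier_coeff u n = fourier_coeff v n"
  shows "u = v"
proof (rule periodic2pi_eqI)
  fix x assume "x \<in> {0..2*pi}"
  then have "complex_of_real (u x) = of_real (v x)"
    using H1per0_expansion[OF u] H1per0_expansion[OF v] eq by simp
  then show "u x = v x" by simp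
qed (use u v in \<open>auto dest: H1per0D\<close>)

lemma H1per0_has_sum_integral:
  assumes u: "u \<in> H1per0" and G: "integrable circ G"
  shows "((\<lambda>n. fourier_coeff u n * fc G (- n)) has_sum ((LINT x|circ. of_real (u x) * G x) / (2 * of_real pi))) UNIV"
  using H1per0_expansion[OF u] H1per0_abs_summable[OF u] G by (intro trig_series_integral)

text \<open>Parseval for u paired with its image under a real symbol l; it is used with l =
  \<open>lam\<close> and with l = 1.\<close>

lemma H1per0_has_sum_real_integral:
  assumes u: "u \<in> H1per0" and G: "integrable circ G"
    and eq: "\<And>n. fourier_coeff G n = of_real (l n) * fourier_coeff u n"
  shows "((\<lambda>n. l n * (norm (fourier_coeff u n))\<^sup>2) has_sum ((LINT x|circ. u x * G x) / (2 * pi))) UNIV"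
proof -
  have G': "integrable circ (\<lambda>x. complex_of_real (G x))" using G by simp
  have "fourier_coeff u n * fc (\<lambda>x. of_real (G x)) (- n) = of_real (l n * (norm (fourier_coeff u n))\<^sup>2)" for n
    unfolding fourier_coeff_fc[symmetric]
    by (simp only: fourier_coeff_minus eq of_real_mult complex_norm_square complex_cnj_mult
        complex_cnj_complex_of_real mult_ac)
  moreover have "(LINT x|circ. of_real (u x) * complex_of_real (G x)) / (2 * of_real pi)
      = of_real ((LINT x|circ. u x * G x) / (2 * pi))"
    by (simp flip: of_real_mult) simp
  ultimately show ?thesis
    using H1per0_has_sum_integral[OF u G'] by (simp only: has_sum_of_real_iff)
qed

section \<open>The zero function as a critical point and its diagonal second variation\<close>

lemma zero_H1per0: "(\<lambda>x. 0) \<in> H1per0"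
proof -
  have "is_weak_deriv (\<lambda>x. 0) (\<lambda>x. 0)"
    by (simp add: is_weak_deriv_def L2per_def periodic2pi_def set_integrable_def set_lebesgue_integral_def)
  then show ?thesis
    by (auto simp: H1per0_def periodic2pi_def mean2pi_def set_lebesgue_integral_def)
qed

lemma fourier_coeff_zero [simp]: "fourier_coeff (\<lambda>x. 0) n = 0"
  by (simp add: fourier_coeff_fc)

lemma zero_L2per: "(\<lambda>x. 0) \<in> L2per"
  by (simp add: L2per_def periodic2pi_def set_integrable_def)

lemma CC_wderiv_zero:
  assumes "D > 0"
  shows "AE x in circ. CC D (wderiv (\<lambda>x. 0)) x = 0" "AE x in lborel. CC D (wderiv (\<lambda>x. 0)) x = 0"
  using L2per_eq_AE[OF CC_wderiv(1)[OF assms zero_H1per0] zero_L2per] 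
  by (simp_all add: CC_wderiv(2)[OF assms zero_H1per0])

lemma CC_zero:
  assumes "D > 0"
  shows "AE x in lborel. CC D (\<lambda>x. 0) x = 0"
  using L2per_eq_AE(2)[OF CC_L2per(1)[OF assms zero_L2per] zero_L2per]
  by (simp add: CC_L2per(2)[OF assms zero_L2per])

lemma critical_point_zero:
  assumes "k * h > 0"
  shows "critical_point g h k Q (\<lambda>x. 0)"
  unfolding critical_point_def solves_eq_def
proof (intro conjI zero_H1per0)
  show "AE x in lborel. (Q - 2 * g * h) / g * CC (k * h) (wderiv (\<lambda>x. 0)) x =
        0 / k + 0 * CC (k * h) (wderiv (\<lambda>x. 0)) x + CC (k * h) (\<lambda>y. 0 * wderiv (\<lambda>x. 0) y) x -
        mean2pi (\<lambda>y. 0 * CC (k * h) (wderiv (\<lambda>x. 0)) y)"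
    using CC_wderiv_zero(2)[OF assms] CC_zero[OF assms]
    by eventually_elim (simp add: mean2pi_def set_lebesgue_integral_def)
qed

lemma second_var_zero:
  assumes D: "k * h > 0" and g: "g > 0" and u: "u \<in> H1per0"
  shows "((\<lambda>n. 4 * pi * g * ((Q - 2*g*h) / g * lam (k*h) n - 1 / k) * (norm (fourier_coeff u n))\<^sup>2)
     has_sum second_var g h k m Q (\<lambda>x. 0) u) UNIV"
proof -
  define U where "U = CC (k*h) (wderiv u)"
  have U: "U \<in> L2per" "\<And>n. fourier_coeff U n = of_real (lam (k*h) n) * fourier_coeff u n"
    unfolding U_def using CC_wderiv[OF D u] by auto
  have cont: "continuous_on {0..2*pi} u" using u by (rule H1per0D)
  have intU: "integrable circ U" using U(1) by (rule L2per_integrable)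
  have intu: "integrable circ u" using cont by (rule integrable_circ_continuous)
  have intuu: "integrable circ (\<lambda>x. u x * u x)" "integrable circ (\<lambda>x. u x * U x)"
    using integrable_circ_mult_continuous[OF intu cont] integrable_circ_mult_continuous[OF intU cont]
    by (simp_all add: mult.commute)
  have s1: "((\<lambda>n. lam (k*h) n * (norm (fourier_coeff u n))\<^sup>2) has_sum ((LINT x|circ. u x * U x) / (2 * pi))) UNIV"
    by (rule H1per0_has_sum_real_integral[OF u intU U(2)])
  have s2: "((\<lambda>n. 1 * (norm (fourier_coeff u n))\<^sup>2) has_sum ((LINT x|circ. u x * u x) / (2 * pi))) UNIV"
    by (rule H1per0_has_sum_real_integral[OF u intu]) simp
  have sv: "second_var g h k m Q (\<lambda>x. 0) u = 
     4 * pi * (Q - 2*g*h) * ((LINT x|circ. u x * U x) / (2 * pi)) + (- 4 * pi * g / k) * ((LINT x|circ. u x * u x) / (2 * pi))"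
  proof -
    have "second_var g h k m Q (\<lambda>x. 0) u = 2 * (LINT x|circ. (Q - 2 * g * h) * (u x * U x) - g / k * (u x * u x))"
      unfolding second_var_eq[OF D zero_H1per0 u] U_def[symmetric]
    proof (rule arg_cong[where f = "(*) 2"], rule integral_cong_AE)
      have [measurable]: "CC (k*h) (wderiv (\<lambda>x. 0)) \<in> borel_measurable circ"
        using L2per_integrable[OF CC_wderiv(1)[OF D zero_H1per0]] by auto
      have [measurable]: "u \<in> borel_measurable circ" "U \<in> borel_measurable circ" using intu intU by auto
      show "(\<lambda>x. (Q - 2 * g * (0 + h)) * u x * U x - g * (u x)\<^sup>2 * (1 / k + CC (k * h) (wderiv (\<lambda>x. 0)) x)) \<in> borel_measurable circ"
        by measurable
      show "(\<lambda>x. (Q - 2 * g * h) * (u x * U x) - g / k * (u x * u x)) \<in> borel_measurable circ"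
        by measurable
      show "AE x in circ. (Q - 2 * g * (0 + h)) * u x * U x - g * (u x)\<^sup>2 * (1 / k + CC (k * h) (wderiv (\<lambda>x. 0)) x)
          = (Q - 2 * g * h) * (u x * U x) - g / k * (u x * u x)"
        using CC_wderiv_zero(1)[OF D] by eventually_elim (simp add: power2_eq_square)
    qed
    also have "(LINT x|circ. (Q - 2 * g * h) * (u x * U x) - g / k * (u x * u x))
        = (Q - 2 * g * h) * (LINT x|circ. u x * U x) - g / k * (LINT x|circ. u x * u x)"
      using intuu by (subst Bochner_Integration.integral_diff) auto
    finally show ?thesis by (simp add: algebra_simps)
  qed
  have "((\<lambda>n. 4 * pi * (Q - 2*g*h) * (lam (k*h) n * (norm (fourier_coeff u n))\<^sup>2)
      + (- 4 * pi * g / k) * (1 * (norm (fourier_coeff u n))\<^sup>2)) has_sum second_var g h k m Q (\<lambda>x. 0) u) UNIV"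
    unfolding sv by (intro has_sum_add has_sum_cmult_right s1 s2)
  moreover have "4 * pi * (Q - 2*g*h) * (lam (k*h) n * (norm (fourier_coeff u n))\<^sup>2) + (- 4 * pi * g / k) * (1 * (norm (fourier_coeff u n))\<^sup>2)
     = 4 * pi * g * ((Q - 2*g*h) / g * lam (k*h) n - 1 / k) * (norm (fourier_coeff u n))\<^sup>2" for n
  proof -
    have "4 * pi * g * ((Q - 2*g*h) / g * L - 1 / k) * S = 4 * pi * (g * ((Q - 2*g*h) / g)) * L * S - 4 * pi * g * (1 / k) * S" for L S
      by algebra
    then show ?thesis using g by simp
  qed
  ultimately show ?thesis by simp
qed

section \<open>Smooth functions\<close>

lemma is_weak_deriv_C1:
  assumes "\<And>x. (u has_real_derivative u' x) (at x)" "continuous_on UNIV u'" "periodic2pi u'"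
  shows "is_weak_deriv u u'"
  unfolding is_weak_deriv_def
proof (intro conjI allI impI L2per_continuous assms)
  fix a b :: real assume "a \<le> b"
  then have "(LBINT x. indicator {a..b} x *\<^sub>R u' x) = u b - u a"
    using assms by (intro integral_FTC_atLeastAtMost)
      (auto intro: continuous_on_subset has_field_derivative_at_within simp flip: has_real_derivative_iff_has_vector_derivative)
  then show "u b - u a = (LBINT t:{a..b}. u' t)" by (simp add: set_lebesgue_integral_def)
qed

lemma fc_lincomb2:
  "fc (\<lambda>x. a * cis (of_int m * x) + b * cis (of_int l * x)) n = a * (if n = m then 1 else 0) + b * (if n = l then 1 else 0)"
  by (subst fc_add) (auto simp: fc_cmult fc_cis intro!: integrable_circ_continuous continuous_intros)

lemma fourier_coeff_cos_sin:
  assumes "m > 0"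
  shows "fourier_coeff (\<lambda>x. a * cos (of_int m * x) + b * sin (of_int m * x)) n
    = (if n = m then Complex (a / 2) (- b / 2) else if n = - m then Complex (a / 2) (b / 2) else 0)"
proof -
  have "complex_of_real (a * cos t + b * sin t) = Complex (a / 2) (- b / 2) * cis t + Complex (a / 2) (b / 2) * cis (- t)" for t
    by (simp add: complex_eq_iff)
  then have "complex_of_real (a * cos (of_int m * x) + b * sin (of_int m * x))
    = Complex (a / 2) (- b / 2) * cis (of_int m * x) + Complex (a / 2) (b / 2) * cis (of_int (- m) * x)" for x
    by simp
  then show ?thesis
    unfolding fourier_coeff_fc using assms by (simp only: fc_lincomb2) auto
qed

lemma cos_sin_H1per0:
  assumes "m > 0"
  shows "(\<lambda>x. a * cos (of_int m * x) + b * sin (of_int m * x)) \<in> H1per0"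
proof -
  let ?u = "\<lambda>x. a * cos (of_int m * x) + b * sin (of_int m * x)"
  let ?u' = "\<lambda>x. of_int m * (b * cos (of_int m * x) - a * sin (of_int m * x))"
  have per: "cis (of_int m * (x + 2 * pi)) = cis (of_int m * x)" for x
    using cis_int_2pi[of m] by (simp only: ring_distribs cis_mult[symmetric]) simp
  have per': "cos (of_int m * (x + 2 * pi)) = cos (of_int m * x)" "sin (of_int m * (x + 2 * pi)) = sin (of_int m * x)" for x
    using arg_cong[OF per[of x], of Re] arg_cong[OF per[of x], of Im] by simp_all
  have "periodic2pi ?u'" unfolding periodic2pi_def per' by simp
  then have "is_weak_deriv ?u ?u'"
    by (intro is_weak_deriv_C1) (auto intro!: derivative_eq_intros continuous_intros simp: algebra_simps)
  moreover have "mean2pi ?u = Re (fourier_coeff ?u 0)"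
  proof -
    have "fourier_coeff ?u 0 = of_real (LINT x|circ. ?u x) / (2 * of_real pi)"
      unfolding fourier_coeff_fc fc_def by (simp only: of_int_0 mult_zero_left minus_zero cis_zero mult_1_right integral_complex_of_real)
    then show ?thesis by (simp add: mean2pi_def LBINT_circ)
  qed
  ultimately show ?thesis
    using assms fourier_coeff_cos_sin[OF assms, of a b 0] by (auto simp: H1per0_def periodic2pi_def per')
qed

section \<open>The trivial solution\<close>

lemma H1per0_integrable:
  assumes "u \<in> H1per0"
  shows "integrable circ u" "integrable circ (\<lambda>x. complex_of_real (u x))"
  using integrable_circ_continuous[OF H1per0D(3)[OF assms]] by simp_all

lemma tanh_eq_inverse_lam: "tanh D = 1 / lam D 1"
  by (simp add: lam_1 coth_def tanh_def)

context
  fixes g h k m Q \<mu> :: real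
  assumes g: "g > 0" and h: "h > 0" and k: "k > 0" and \<mu>: "\<mu> = (Q - 2*g*h) / g"
begin

lemma D_pos: "k * h > 0"
  using h k by simp

lemma second_var_zero_mu:
  assumes "u \<in> H1per0"
  shows "((\<lambda>n. 4 * pi * g * (\<mu> * lam (k*h) n - 1 / k) * (norm (fourier_coeff u n))\<^sup>2)
     has_sum second_var g h k m Q (\<lambda>x. 0) u) UNIV"
  unfolding \<mu> by (rule second_var_zero[OF D_pos g assms])

text \<open>The assumption makes \<mu> positive, so \<mu> lam n increases with |n| and the modes 1
  and -1 are the worst. Since tanh (k h) = 1 / lam 1, their margin is a multiple of \<mu> minus the
  critical value.\<close>

lemma mult_lam_bound:
  assumes "\<mu> \<ge> tanh (k*h) / k" "n \<noteq> 0"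
  shows "\<mu> * lam (k*h) n - 1 / k \<ge> (\<mu> - tanh (k*h) / k) * lam (k*h) 1"
    and "\<bar>n\<bar> \<ge> 2 \<Longrightarrow> \<mu> * lam (k*h) n - 1 / k > 0"
proof -
  have l1: "lam (k*h) 1 > 0" by (rule lam_1_pos[OF D_pos])
  have \<mu>_pos: "\<mu> > 0"
    using assms(1) l1 k by (intro less_le_trans[OF _ assms(1)]) (simp add: tanh_eq_inverse_lam)
  have eq: "(\<mu> - tanh (k*h) / k) * lam (k*h) 1 = \<mu> * lam (k*h) 1 - 1 / k"
    using l1 by (simp add: tanh_eq_inverse_lam left_diff_distrib)
  have "1 \<le> \<bar>n\<bar>" using assms(2) by linarith
  then have "\<mu> * lam (k*h) 1 \<le> \<mu> * lam (k*h) n"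
    using \<mu>_pos by (intro mult_left_mono lam_mono D_pos) auto
  then show "\<mu> * lam (k*h) n - 1 / k \<ge> (\<mu> - tanh (k*h) / k) * lam (k*h) 1"
    unfolding eq by simp
  assume "\<bar>n\<bar> \<ge> 2"
  then have "lam (k*h) 1 < lam (k*h) n"
    using lam_strict_mono[OF D_pos, of 1 "\<bar>n\<bar>"] by (simp add: lam_abs)
  then have "\<mu> * lam (k*h) 1 < \<mu> * lam (k*h) n"
    using \<mu>_pos by (rule mult_strict_left_mono)
  moreover have "\<mu> * lam (k*h) 1 - 1 / k \<ge> 0"
    unfolding eq[symmetric] using assms(1) l1 by (intro mult_nonneg_nonneg) auto
  ultimately show "\<mu> * lam (k*h) n - 1 / k > 0" by simp
qed

text \<open>At and above the critical value every term of the series is nonnegative, so each single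
  term is a lower bound; one nonzero coefficient then decides strict positivity.\<close>

lemma second_var_zero_nonneg:
  assumes "\<mu> \<ge> tanh (k*h) / k" and u: "u \<in> H1per0"
  shows "second_var g h k m Q (\<lambda>x. 0) u \<ge> 4 * pi * g * (\<mu> * lam (k*h) n - 1 / k) * (norm (fourier_coeff u n))\<^sup>2"
    and "second_var g h k m Q (\<lambda>x. 0) u \<ge> 0"
proof -
  let ?t = "\<lambda>n. 4 * pi * g * (\<mu> * lam (k*h) n - 1 / k) * (norm (fourier_coeff u n))\<^sup>2"
  have nonneg: "?t j \<ge> 0" for j
  proof (cases "j = 0")
    case True
    then show ?thesis using H1per0D(4)[OF u] by simp
  next
    case False
    have "0 \<le> (\<mu> - tanh (k*h) / k) * lam (k*h) 1"
      using assms(1) lam_1_pos[OF D_pos] by (intro mult_nonneg_nonneg) auto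
    with mult_lam_bound(1)[OF assms(1) False] have "\<mu> * lam (k*h) j - 1 / k \<ge> 0" by linarith
    then show ?thesis using g by (intro mult_nonneg_nonneg) auto
  qed
  have "sum ?t F \<le> second_var g h k m Q (\<lambda>x. 0) u" if "finite F" for F
    using nonneg that by (intro finite_sum_le_has_sum[OF second_var_zero_mu[OF u]]) auto
  from this[of "{n}"] this[of "{}"]
  show "second_var g h k m Q (\<lambda>x. 0) u \<ge> ?t n" "second_var g h k m Q (\<lambda>x. 0) u \<ge> 0" by simp_all
qed

lemma zero_strictly_stable:
  assumes "\<mu> > tanh (k*h) / k"
  shows "strictly_variationally_stable g h k m Q (\<lambda>x. 0)"
  unfolding strictly_variationally_stable_def
proof (intro conjI ballI impI critical_point_zero[OF D_pos])
  fix u assume u: "u \<in> H1per0" "u \<noteq> (\<lambda>x. 0)"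
  then obtain n where n: "fourier_coeff u n \<noteq> 0"
    using H1per0_eqI[OF u(1) zero_H1per0] by auto
  then have n0: "n \<noteq> 0" using H1per0D(4)[OF u(1)] by auto
  have "0 < (\<mu> - tanh (k*h) / k) * lam (k*h) 1"
    using assms lam_1_pos[OF D_pos] by (intro mult_pos_pos) auto
  also have "\<dots> \<le> \<mu> * lam (k*h) n - 1 / k"
    using assms n0 by (intro mult_lam_bound(1)) auto
  finally have "0 < 4 * pi * g * (\<mu> * lam (k*h) n - 1 / k) * (norm (fourier_coeff u n))\<^sup>2"
    using g n by (intro mult_pos_pos) auto
  also have "\<dots> \<le> second_var g h k m Q (\<lambda>x. 0) u"
    using assms u by (intro second_var_zero_nonneg(1)) auto
  finally show "0 < second_var g h k m Q (\<lambda>x. 0) u" .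
qed

lemma zero_unstable:
  assumes "\<mu> < tanh (k*h) / k"
  shows "variationally_unstable g h k m Q (\<lambda>x. 0)"
  unfolding variationally_unstable_def
proof (intro conjI critical_point_zero[OF D_pos] bexI)
  define u :: "real \<Rightarrow> real" where "u x = 1 * cos (of_int 1 * x) + 0 * sin (of_int 1 * x)" for x
  show u: "u \<in> H1per0" unfolding u_def[abs_def] by (rule cos_sin_H1per0) simp
  have c: "fourier_coeff u n = (if n = 1 \<or> n = -1 then 1 / 2 else 0)" for n
    unfolding u_def[abs_def] by (subst fourier_coeff_cos_sin) (auto simp: complex_eq_iff)
  let ?t = "\<lambda>n. 4 * pi * g * (\<mu> * lam (k*h) n - 1 / k) * (norm (fourier_coeff u n))\<^sup>2"
  have "(?t has_sum (\<Sum>n\<in>{1,-1}. ?t n)) UNIV"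
    by (rule has_sum_finite_neutralI[of "{1,-1}"]) (auto simp: c)
  then have "second_var g h k m Q (\<lambda>x. 0) u = (\<Sum>n\<in>{1,-1}. ?t n)"
    using second_var_zero_mu[OF u] by (rule has_sum_unique[rotated])
  also have "\<dots> = 2 * pi * g * (\<mu> * lam (k*h) 1 - 1 / k)"
    by (simp add: c lam_minus[of _ 1, simplified] power2_eq_square)
  also have "\<dots> < 0"
  proof -
    have "\<mu> * lam (k*h) 1 < tanh (k*h) / k * lam (k*h) 1"
      using assms lam_1_pos[OF D_pos] by (rule mult_strict_right_mono)
    also have "\<dots> = 1 / k" using lam_1_pos[OF D_pos] by (simp add: tanh_eq_inverse_lam)
    finally show ?thesis using g by (intro mult_pos_neg) auto
  qed
  finally show "second_var g h k m Q (\<lambda>x. 0) u < 0" .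
qed

context
  assumes crit: "\<mu> = tanh (k*h) / k"
begin

lemma critical_multiplier_1: "\<mu> * lam (k*h) n - 1 / k = 0" if "n = 1 \<or> n = -1"
  using that crit lam_1_pos[OF D_pos] lam_minus[of "k*h" 1] by (auto simp: tanh_eq_inverse_lam)

text \<open>Testing the polarized form with v = u gives (4q - 2q)/2 = q, so q(u) = 0 and all modes
  with |n| \<ge> 2 vanish. Conversely, adding a combination of cos x and sin x changes no term of
  the series, since the multipliers at 1 and -1 are zero.\<close>

lemma zero_kernel:
  "second_var_kernel g h k m Q (\<lambda>x. 0) = {\<lambda>x. a * cos x + b * sin x | a b. True}"
proof (intro subset_antisym subsetI)
  fix u assume "u \<in> second_var_kernel g h k m Q (\<lambda>x. 0)"
  then have u: "u \<in> H1per0" and ker: "second_var_form g h k m Q (\<lambda>x. 0) u u = 0"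
    by (auto simp: second_var_kernel_def)
  let ?sv = "second_var g h k m Q (\<lambda>x. 0)"
  have u2: "(\<lambda>x. u x + 1 * u x) \<in> H1per0" by (rule H1per0_lincomb[OF u u])
  have int: "integrable circ (\<lambda>x. complex_of_real (u x))"
    using u by (rule H1per0_integrable)
  have "fourier_coeff (\<lambda>x. u x + 1 * u x) n = 2 * fourier_coeff u n" for n
    using int by (simp add: fourier_coeff_fc fc_cmult)
  with second_var_zero_mu[OF u2]
  have "((\<lambda>n. 4 * pi * g * (\<mu> * lam (k*h) n - 1 / k) * (norm (2 * fourier_coeff u n))\<^sup>2) has_sum ?sv (\<lambda>x. u x + 1 * u x)) UNIV"
    by simp
  moreover have "((\<lambda>n. 4 * (4 * pi * g * (\<mu> * lam (k*h) n - 1 / k) * (norm (fourier_coeff u n))\<^sup>2)) has_sum 4 * ?sv u) UNIV"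
    by (intro has_sum_cmult_right second_var_zero_mu u)
  moreover have "4 * pi * g * (\<mu> * lam (k*h) n - 1 / k) * (norm (2 * fourier_coeff u n))\<^sup>2
      = 4 * (4 * pi * g * (\<mu> * lam (k*h) n - 1 / k) * (norm (fourier_coeff u n))\<^sup>2)" for n
    by (simp add: norm_mult power_mult_distrib)
  ultimately have "?sv (\<lambda>x. u x + 1 * u x) = 4 * ?sv u"
    by (metis (no_types, lifting) has_sum_cong has_sum_unique)
  with ker have sv0: "?sv u = 0" by (simp add: second_var_form_def)
  have zero: "fourier_coeff u n = 0" if "\<bar>n\<bar> \<ge> 2" for n
  proof (rule ccontr)
    assume "fourier_coeff u n \<noteq> 0"
    moreover have "\<mu> * lam (k*h) n - 1 / k > 0"
      using that crit by (intro mult_lam_bound(2)) auto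
    ultimately have "0 < 4 * pi * g * (\<mu> * lam (k*h) n - 1 / k) * (norm (fourier_coeff u n))\<^sup>2"
      using g by (intro mult_pos_pos) auto
    also have "\<dots> \<le> ?sv u"
      using crit u by (intro second_var_zero_nonneg(1)) auto
    finally show False using sv0 by simp
  qed
  define a where "a = 2 * Re (fourier_coeff u 1)"
  define b where "b = - 2 * Im (fourier_coeff u 1)"
  have "u = (\<lambda>x. a * cos (of_int 1 * x) + b * sin (of_int 1 * x))"
  proof (rule H1per0_eqI[OF u])
    fix n :: int
    consider "n = 0" | "n = 1" | "n = -1" | "\<bar>n\<bar> \<ge> 2" by linarith
    then show "fourier_coeff u n = fourier_coeff (\<lambda>x. a * cos (of_int 1 * x) + b * sin (of_int 1 * x)) n"
      unfolding fourier_coeff_cos_sin[OF zero_less_one]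
      by cases (auto simp: a_def b_def H1per0D(4)[OF u] zero complex_eq_iff fourier_coeff_minus[of u 1, simplified])
  qed (rule cos_sin_H1per0, simp)
  then show "u \<in> {\<lambda>x. a * cos x + b * sin x | a b. True}" by auto
next
  fix u :: "real \<Rightarrow> real" assume "u \<in> {\<lambda>x. a * cos x + b * sin x | a b. True}"
  then obtain a b where u_def: "u = (\<lambda>x. a * cos (of_int 1 * x) + b * sin (of_int 1 * x))" by auto
  have u: "u \<in> H1per0" unfolding u_def by (rule cos_sin_H1per0) simp
  have cu: "fourier_coeff u n = 0" if "n \<noteq> 1" "n \<noteq> -1" for n
    unfolding u_def using that by (subst fourier_coeff_cos_sin) auto
  have add: "second_var g h k m Q (\<lambda>x. 0) (\<lambda>x. u x + v x) = second_var g h k m Q (\<lambda>x. 0) v" if v: "v \<in> H1per0" for v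
  proof -
    have uv: "(\<lambda>x. u x + v x) \<in> H1per0" using H1per0_lincomb[OF u v, of 1] by simp
    have int: "integrable circ (\<lambda>x. complex_of_real (u x))" "integrable circ (\<lambda>x. complex_of_real (v x))"
      using u v by (auto intro: H1per0_integrable)
    have c: "fourier_coeff (\<lambda>x. u x + v x) n = fourier_coeff u n + fourier_coeff v n" for n
      using int by (simp add: fourier_coeff_fc fc_add)
    have "4 * pi * g * (\<mu> * lam (k*h) n - 1 / k) * (norm (fourier_coeff (\<lambda>x. u x + v x) n))\<^sup>2
      = 4 * pi * g * (\<mu> * lam (k*h) n - 1 / k) * (norm (fourier_coeff v n))\<^sup>2" for n
    proof (cases "n = 1 \<or> n = -1")
      case True
      then show ?thesis by (simp only: critical_multiplier_1)
    next
      case False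
      then show ?thesis using cu[of n] by (simp add: c)
    qed
    then show ?thesis
      using second_var_zero_mu[OF uv] second_var_zero_mu[OF v]
      by (simp only: has_sum_unique)
  qed
  have "second_var g h k m Q (\<lambda>x. 0) u = 0"
  proof -
    have "fourier_coeff (\<lambda>x. 0) n = 0" for n by simp
    then have "((\<lambda>n::int. 0) has_sum second_var g h k m Q (\<lambda>x. 0) (\<lambda>x. 0)) UNIV"
      using second_var_zero_mu[OF zero_H1per0] by simp
    then have "second_var g h k m Q (\<lambda>x. 0) (\<lambda>x. 0) = 0"
      by (rule has_sum_unique) (simp add: has_sum_0)
    with add[OF zero_H1per0] show ?thesis by simp
  qed
  with add u show "u \<in> second_var_kernel g h k m Q (\<lambda>x. 0)"
    by (simp add: second_var_kernel_def second_var_form_def)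
qed

lemma zero_weakly_stable: "weakly_variationally_stable g h k m Q (\<lambda>x. 0)"
  unfolding weakly_variationally_stable_def
  using second_var_zero_nonneg(2) crit critical_point_zero[OF D_pos] by auto

lemma zero_degenerate: "degenerate g h k m Q (\<lambda>x. 0)"
  unfolding degenerate_def zero_kernel
proof (intro conjI critical_point_zero[OF D_pos] bexI)
  show "(\<lambda>x. 1 * cos x + 0 * sin x) \<in> {\<lambda>x. a * cos x + b * sin x | a b. True}" by blast
  show "(\<lambda>x::real. 1 * cos x + 0 * sin x) \<noteq> (\<lambda>x. 0)"
    by (metis (mono_tags, lifting) add.right_neutral cos_zero mult_1 mult_zero_left zero_neq_one)
qed

end

end

section \<open>Twice differentiable functions\<close>

lemma periodic2pi_bounded:
  assumes "continuous_on UNIV f" "periodic2pi f"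
  obtains B where "\<And>x. \<bar>f x\<bar> \<le> B"
proof -
  have "bounded (f ` {0..2*pi})"
    using assms(1) by (intro compact_imp_bounded compact_continuous_image) (auto intro: continuous_on_subset)
  then obtain B where B: "\<forall>x\<in>{0..2*pi}. \<bar>f x\<bar> \<le> B"
    by (auto simp: bounded_iff)
  have "\<bar>f x\<bar> \<le> B" for x
  proof -
    obtain j :: int where j: "x - of_int j * (2 * pi) \<in> {0..2*pi}" by (rule reduce_mod_2pi)
    show ?thesis using bspec[OF B j] periodic2pi_int[OF assms(2), of x "- j"] by simp
  qed
  then show thesis by (rule that)
qed

lemma SUP_abs_upper:
  fixes f :: "real \<Rightarrow> real"
  assumes "continuous_on UNIV f" "periodic2pi f"
  shows "\<bar>f x\<bar> \<le> (SUP x. \<bar>f x\<bar>)" "0 \<le> (SUP x. \<bar>f x\<bar>)"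
proof -
  obtain B where "\<And>x. \<bar>f x\<bar> \<le> B" using periodic2pi_bounded[OF assms] by blast
  then have "bdd_above (range (\<lambda>x. \<bar>f x\<bar>))" by (intro bdd_aboveI2)
  then have *: "\<bar>f x\<bar> \<le> (SUP x. \<bar>f x\<bar>)" for x by (rule cSUP_upper[rotated]) simp
  show "\<bar>f x\<bar> \<le> (SUP x. \<bar>f x\<bar>)" by (rule *)
  show "0 \<le> (SUP x. \<bar>f x\<bar>)" using *[of 0] by simp
qed

lemma deriv_periodic2pi:
  assumes "periodic2pi f" "\<And>x. f differentiable (at x)"
  shows "periodic2pi (deriv f)"
  unfolding periodic2pi_def
proof
  fix x
  have "(f has_real_derivative deriv f (x + 2 * pi)) (at (x + 2 * pi))"
    using assms(2) by (simp add: DERIV_deriv_iff_real_differentiable)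
  then have "((\<lambda>y. f (y + 2 * pi)) has_real_derivative deriv f (x + 2 * pi)) (at x)"
    by (simp add: DERIV_shift)
  moreover have "(\<lambda>y. f (y + 2 * pi)) = f" using assms(1) by (auto simp: periodic2pi_def)
  ultimately show "deriv f (x + 2 * pi) = deriv f x"
    by (simp add: DERIV_imp_deriv)
qed

lemma C2per_eD:
  assumes "w \<in> C2per_e \<alpha>" "\<alpha> > 0"
  shows "periodic2pi w" "even_fun w" "(w has_real_derivative deriv w x) (at x)"
    "(deriv w has_real_derivative deriv (deriv w) x) (at x)"
    "periodic2pi (deriv w)" "periodic2pi (deriv (deriv w))"
    "continuous_on UNIV w" "continuous_on UNIV (deriv w)" "continuous_on UNIV (deriv (deriv w))"
proof -
  have diff: "w differentiable (at x)" "deriv w differentiable (at x)" for x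
    using assms by (auto simp: C2per_e_def)
  show per: "periodic2pi w" "even_fun w" using assms by (auto simp: C2per_e_def)
  have D1: "(w has_real_derivative deriv w x) (at x)" for x
    using diff by (simp add: DERIV_deriv_iff_real_differentiable)
  have D2: "(deriv w has_real_derivative deriv (deriv w) x) (at x)" for x
    using diff by (simp add: DERIV_deriv_iff_real_differentiable)
  show "(w has_real_derivative deriv w x) (at x)" "(deriv w has_real_derivative deriv (deriv w) x) (at x)"
    by (rule D1 D2)+
  show "periodic2pi (deriv w)" using per(1) diff(1) by (rule deriv_periodic2pi)
  then show "periodic2pi (deriv (deriv w))" using diff(2) by (rule deriv_periodic2pi)
  show "continuous_on UNIV w" "continuous_on UNIV (deriv w)"
    using D1 D2 by (meson DERIV_continuous continuous_at_imp_continuous_on)+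
  obtain K where K: "\<And>x y. \<bar>deriv (deriv w) x - deriv (deriv w) y\<bar> \<le> K * \<bar>x - y\<bar> powr \<alpha>"
    using assms by (auto simp: C2per_e_def)
  \<comment> \<open>Continuity of the second derivative comes from the Hoelder bound, with \<alpha>
    > 0.\<close>
  have "isCont (deriv (deriv w)) x" for x
    unfolding isCont_def
  proof (rule LIM_zero_cancel, rule Lim_null_comparison)
    show "\<forall>\<^sub>F y in at x. norm (deriv (deriv w) y - deriv (deriv w) x) \<le> K * \<bar>y - x\<bar> powr \<alpha>"
      using K by (intro always_eventually) auto
    have "((\<lambda>y. K * \<bar>y - x\<bar> powr \<alpha>) \<longlongrightarrow> K * \<bar>x - x\<bar> powr \<alpha>) (at x)"
      using assms(2) by (intro tendsto_intros) auto
    then show "((\<lambda>y. K * \<bar>y - x\<bar> powr \<alpha>) \<longlongrightarrow> 0) (at x)" by simp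
  qed
  then show "continuous_on UNIV (deriv (deriv w))"
    by (simp add: continuous_at_imp_continuous_on)
qed

text \<open>A real supremum is informative only for bounded sets, so each one in
  \<open>C2_norm\<close> needs its own bound: periodicity for the first three, the Hoelder constant
  for the last. The last is nonnegative by the sample pair (0, 1), and may then be dropped.\<close>

lemma C2_norm_bounds:
  assumes w: "w \<in> C2per_e \<alpha>" and \<alpha>: "\<alpha> > 0"
  shows "\<bar>w x\<bar> \<le> C2_norm \<alpha> w" "\<bar>deriv w x\<bar> \<le> C2_norm \<alpha> w" "\<bar>deriv (deriv w) x\<bar> \<le> C2_norm \<alpha> w"
proof -
  note d = C2per_eD[OF w \<alpha>]
  let ?q = "\<lambda>(x, y). \<bar>deriv (deriv w) x - deriv (deriv w) y\<bar> / \<bar>x - y\<bar> powr \<alpha>"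
  obtain K where K: "\<And>x y. \<bar>deriv (deriv w) x - deriv (deriv w) y\<bar> \<le> K * \<bar>x - y\<bar> powr \<alpha>"
    using w by (auto simp: C2per_e_def)
  have "?q p \<le> K" if "p \<in> {(x, y). x \<noteq> y}" for p
    using that K by (auto simp: divide_le_eq)
  then have "bdd_above (?q ` {(x, y). x \<noteq> y})" by (auto intro!: bdd_aboveI2)
  then have "?q (0, 1) \<le> (SUP p \<in> {(x, y). x \<noteq> y}. ?q p)"
    by (intro cSUP_upper) auto
  moreover have "0 \<le> ?q (0, 1)" by simp
  ultimately have "0 \<le> (SUP p \<in> {(x, y). x \<noteq> y}. ?q p)" by linarith
  with SUP_abs_upper(1)[OF d(7,1), of x] SUP_abs_upper(1)[OF d(8,5), of x] SUP_abs_upper(1)[OF d(9,6), of x]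
    SUP_abs_upper(2)[OF d(7,1)] SUP_abs_upper(2)[OF d(8,5)] SUP_abs_upper(2)[OF d(9,6)]
  show "\<bar>w x\<bar> \<le> C2_norm \<alpha> w" "\<bar>deriv w x\<bar> \<le> C2_norm \<alpha> w" "\<bar>deriv (deriv w) x\<bar> \<le> C2_norm \<alpha> w"
    by (simp_all add: C2_norm_def)
qed

text \<open>The Lipschitz bound serves when |x - y| \<le> 1; beyond that the trivial bound 2
  does.\<close>

lemma cos_Hoelder:
  fixes x y \<alpha> :: real
  assumes "0 < \<alpha>" "\<alpha> < 1"
  shows "\<bar>cos x - cos y\<bar> \<le> 2 * \<bar>x - y\<bar> powr \<alpha>"
proof (cases "\<bar>x - y\<bar> \<le> 1")
  case True
  have "\<bar>cos x - cos y\<bar> \<le> 1 * \<bar>x - y\<bar>"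
  proof -
    have "\<bar>cos x - cos y\<bar> = 2 * (\<bar>sin ((x + y) / 2)\<bar> * \<bar>sin ((y - x) / 2)\<bar>)"
      by (simp add: cos_diff_cos abs_mult)
    also have "\<dots> \<le> 2 * (1 * \<bar>(y - x) / 2\<bar>)"
      by (intro mult_left_mono mult_mono abs_sin_x_le_abs_x) auto
    finally show ?thesis by (simp add: abs_minus_commute)
  qed
  also have "\<bar>x - y\<bar> \<le> \<bar>x - y\<bar> powr \<alpha>"
    using True assms powr_mono'[of \<alpha> 1 "\<bar>x - y\<bar>"] by (cases "x = y") auto
  finally have "\<bar>cos x - cos y\<bar> \<le> \<bar>x - y\<bar> powr \<alpha>" by simp
  moreover have "0 \<le> \<bar>x - y\<bar> powr \<alpha>" by simp
  ultimately show ?thesis by linarith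
next
  case False
  then have "1 \<le> \<bar>x - y\<bar> powr \<alpha>" using assms by (intro ge_one_powr_ge_zero) auto
  moreover have "\<bar>cos x - cos y\<bar> \<le> 2"
    using cos_le_one[of x] cos_ge_minus_one[of x] cos_le_one[of y] cos_ge_minus_one[of y] by linarith
  ultimately show ?thesis by linarith
qed

text \<open>The branch asymptotics concern the norm of w - \<epsilon> cos;
  \<open>C2_norm_bounds\<close> can be applied to this difference once it is known to lie in the
  space.\<close>

lemma C2per_e_minus_cos:
  assumes w: "w \<in> C2per_e \<alpha>" and \<alpha>: "0 < \<alpha>" "\<alpha> < 1"
  shows "(\<lambda>x. w x - e * cos x) \<in> C2per_e \<alpha>"
    "deriv (\<lambda>x. w x - e * cos x) = (\<lambda>x. deriv w x + e * sin x)"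
    "deriv (deriv (\<lambda>x. w x - e * cos x)) = (\<lambda>x. deriv (deriv w) x + e * cos x)"
proof -
  note d = C2per_eD[OF w \<alpha>(1)]
  have D1: "((\<lambda>x. w x - e * cos x) has_real_derivative deriv w x + e * sin x) (at x)" for x
    using d(3)[of x] by (auto intro!: derivative_eq_intros)
  then show eq1: "deriv (\<lambda>x. w x - e * cos x) = (\<lambda>x. deriv w x + e * sin x)"
    by (intro ext DERIV_imp_deriv)
  have D2: "((\<lambda>x. deriv w x + e * sin x) has_real_derivative deriv (deriv w) x + e * cos x) (at x)" for x
    using d(4)[of x] by (auto intro!: derivative_eq_intros)
  then show eq2: "deriv (deriv (\<lambda>x. w x - e * cos x)) = (\<lambda>x. deriv (deriv w) x + e * cos x)"
    unfolding eq1 by (intro ext DERIV_imp_deriv)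
  obtain K where K: "\<And>x y. \<bar>deriv (deriv w) x - deriv (deriv w) y\<bar> \<le> K * \<bar>x - y\<bar> powr \<alpha>"
    using w by (auto simp: C2per_e_def)
  have "\<bar>(deriv (deriv w) x + e * cos x) - (deriv (deriv w) y + e * cos y)\<bar> \<le> (K + 2 * \<bar>e\<bar>) * \<bar>x - y\<bar> powr \<alpha>" for x y
  proof -
    have "\<bar>(deriv (deriv w) x + e * cos x) - (deriv (deriv w) y + e * cos y)\<bar>
       \<le> \<bar>deriv (deriv w) x - deriv (deriv w) y\<bar> + \<bar>e\<bar> * \<bar>cos x - cos y\<bar>"
      unfolding abs_mult[symmetric] right_diff_distrib by linarith
    also have "\<dots> \<le> K * \<bar>x - y\<bar> powr \<alpha> + \<bar>e\<bar> * (2 * \<bar>x - y\<bar> powr \<alpha>)"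
      by (intro add_mono mult_left_mono K cos_Hoelder \<alpha>) auto
    finally show ?thesis by (simp add: algebra_simps)
  qed
  then show "(\<lambda>x. w x - e * cos x) \<in> C2per_e \<alpha>"
    unfolding C2per_e_def using d(1,2) D1 D2
    by (auto simp: periodic2pi_def even_fun_def eq1 eq2[unfolded eq1] real_differentiable_def intro: D1 D2)
qed

lemma norm_fc_le:
  assumes "F \<in> borel_measurable circ" "\<And>x. x \<in> {0..2*pi} \<Longrightarrow> norm (F x) \<le> B"
  shows "norm (fc F n) \<le> B"
proof -
  have int: "integrable circ F" using assms by (rule integrable_circ_bounded)
  have "norm (LINT x|circ. F x * cis (- (of_int n * x))) \<le> (LINT x|circ. norm (F x * cis (- (of_int n * x))))"
    by (rule integral_norm_bound)
  also have "\<dots> \<le> (LINT x|circ. B)"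
    using assms int by (intro integral_mono) (auto simp: norm_mult)
  also have "\<dots> = 2 * pi * B" by (simp add: measure_circ)
  finally show ?thesis by (simp add: fc_def norm_divide norm_mult divide_le_eq mult.commute)
qed

lemma norm_fourier_coeff_le:
  assumes "continuous_on UNIV f" "\<And>x. \<bar>f x\<bar> \<le> B"
  shows "norm (fourier_coeff f n) \<le> B"
  unfolding fourier_coeff_fc using assms
  by (intro norm_fc_le) (auto intro!: measurable_circ borel_measurable_continuous_onI continuous_intros)

lemma C2per_e_weak_deriv:
  assumes w: "w \<in> C2per_e \<alpha>" and \<alpha>: "\<alpha> > 0"
  shows "is_weak_deriv w (deriv w)" "is_weak_deriv (deriv w) (deriv (deriv w))"
    "fourier_coeff (deriv w) n = \<i> * of_int n * fourier_coeff w n"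
    "fourier_coeff (deriv (deriv w)) n = - ((of_int n)\<^sup>2 * fourier_coeff w n)"
proof -
  note d = C2per_eD[OF w \<alpha>]
  show 1: "is_weak_deriv w (deriv w)" "is_weak_deriv (deriv w) (deriv (deriv w))"
    using d by (auto intro!: is_weak_deriv_C1)
  show 2: "fourier_coeff (deriv w) n = \<i> * of_int n * fourier_coeff w n"
    by (rule fourier_coeff_weak_deriv[OF 1(1) d(1)])
  show "fourier_coeff (deriv (deriv w)) n = - ((of_int n)\<^sup>2 * fourier_coeff w n)"
    unfolding fourier_coeff_weak_deriv[OF 1(2) d(5)] 2 by (simp add: power2_eq_square complex_eq_iff algebra_simps)
qed

text \<open>Up to sign, n^2 times the coefficient of w is that of the second derivative, and a
  coefficient never exceeds the supremum of its function.\<close>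

lemma C2per_e_coeff_bound:
  assumes w: "w \<in> C2per_e \<alpha>" and \<alpha>: "\<alpha> > 0"
    and N: "C2_norm \<alpha> w \<le> N"
  shows "norm (fourier_coeff w n) \<le> N" "(of_int n)\<^sup>2 * norm (fourier_coeff w n) \<le> N"
proof -
  note d = C2per_eD[OF w \<alpha>] and b = C2_norm_bounds[OF w \<alpha>]
  show "norm (fourier_coeff w n) \<le> N"
    using b(1) N by (intro norm_fourier_coeff_le d) (meson order_trans)
  have "norm (fourier_coeff (deriv (deriv w)) n) \<le> N"
    using b(3) N by (intro norm_fourier_coeff_le d) (meson order_trans)
  then show "(of_int n)\<^sup>2 * norm (fourier_coeff w n) \<le> N"
    unfolding C2per_e_weak_deriv(4)[OF w \<alpha>] by (simp add: norm_mult norm_power)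
qed

lemma C2per_e_H1per0: "w \<in> C2per_e \<alpha> \<Longrightarrow> \<alpha> > 0 \<Longrightarrow> mean2pi w = 0 \<Longrightarrow> w \<in> H1per0"
  using C2per_e_weak_deriv(1) C2per_eD(1) by (auto simp: H1per0_def)

lemma even_fourier_coeff:
  assumes "even_fun w" "periodic2pi w"
  shows "fourier_coeff w (- n) = fourier_coeff w n"
proof -
  let ?f = "\<lambda>x. indicator {0..2*pi} x *\<^sub>R (complex_of_real (w x) * cis (of_int n * x))"
  \<comment> \<open>The reflection x -> 2 pi - x preserves the period and turns e^{inx} into
    e^{-inx}.\<close>
  have "(LINT x|lborel. ?f x) = \<bar>- 1\<bar> *\<^sub>R (LINT x|lborel. ?f (2 * pi + (- 1) * x))"
    by (rule lborel_integral_real_affine) simp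
  also have "(\<lambda>x. ?f (2 * pi + (- 1) * x)) = (\<lambda>x. indicator {0..2*pi} x *\<^sub>R (complex_of_real (w x) * cis (- (of_int n * x))))"
  proof
    fix x
    have "w (2 * pi + (- 1) * x) = w x"
      using assms by (metis add.commute even_fun_def mult_minus1 periodic2pi_def)
    moreover have "cis (of_int n * (2 * pi + (- 1) * x)) = cis (of_int n * (2 * pi)) * cis (- (of_int n * x))"
      by (simp only: cis_mult) (simp add: algebra_simps)
    then have "cis (of_int n * (2 * pi + (- 1) * x)) = cis (- (of_int n * x))"
      by (simp only: cis_int_2pi) simp
    moreover have "indicator {0..2*pi} (2 * pi + (- 1) * x) = (indicator {0..2*pi} x :: real)"
      by (auto simp: indicator_def)
    ultimately show "?f (2 * pi + (- 1) * x) = indicator {0..2*pi} x *\<^sub>R (complex_of_real (w x) * cis (- (of_int n * x)))"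
      by simp
  qed
  finally show ?thesis
    by (simp add: fourier_coeff_fc fc_def circ_def integral_restrict_space)
qed

lemma even_fourier_coeff_real:
  assumes "even_fun w" "periodic2pi w"
  shows "fourier_coeff w n = of_real (Re (fourier_coeff w n))"
  using even_fourier_coeff[OF assms, of n] fourier_coeff_minus[of w n]
  by (simp add: complex_eq_iff)

section \<open>The equation in Fourier variables\<close>

lemma L2per_mult_continuous:
  assumes f: "f \<in> L2per" and w: "continuous_on UNIV w" "periodic2pi w"
  shows "(\<lambda>x. w x * f x) \<in> L2per"
proof (rule L2perI)
  note [measurable] = L2perD(1)[OF f] borel_measurable_continuous_onI[OF w(1)]
  show "(\<lambda>x. w x * f x) \<in> borel_measurable borel" by measurable
  show "periodic2pi (\<lambda>x. w x * f x)"
    using L2perD(2)[OF f] w(2) by (simp add: periodic2pi_def)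
  have "continuous_on {0..2*pi} (\<lambda>x. (w x)\<^sup>2)"
    using w(1) by (intro continuous_intros) (auto intro: continuous_on_subset)
  from integrable_circ_mult_continuous[OF L2perD(3)[OF f] this]
  show "integrable circ (\<lambda>x. (w x * f x)\<^sup>2)"
    by (simp add: power_mult_distrib mult.commute)
qed

text \<open>Convolution formula with asymmetric regularity: \<open>w\<close> has absolutely summable
  coefficients, \<open>T\<close> is only integrable. It is termwise integration against T times
  e^{-inx}.\<close>

lemma fourier_coeff_mult_H1per0:
  assumes w: "w \<in> H1per0" and T: "integrable circ T"
  shows "((\<lambda>m. fourier_coeff w m * fourier_coeff T (n - m)) has_sum fourier_coeff (\<lambda>x. w x * T x) n) UNIV"
proof -
  have T': "integrable circ (\<lambda>x. complex_of_real (T x))" using T by simp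
  have "integrable circ (\<lambda>x. of_real (T x) * cis (of_int (- n) * x))"
    by (rule integrable_circ_cis[OF T'])
  from H1per0_has_sum_integral[OF w this]
  have "((\<lambda>m. fourier_coeff w m * fourier_coeff T (- m - - n)) has_sum
      ((LINT x|circ. of_real (w x) * (of_real (T x) * cis (of_int (- n) * x))) / (2 * of_real pi))) UNIV"
    unfolding fc_shift fourier_coeff_fc .
  moreover have "(LINT x|circ. of_real (w x) * (of_real (T x) * cis (of_int (- n) * x))) / (2 * of_real pi)
      = fourier_coeff (\<lambda>x. w x * T x) n"
    by (simp add: fourier_coeff_fc fc_def mult.assoc)
  ultimately show ?thesis by simp
qed

text \<open>Since w w' is half the derivative of w^2, the term \<open>CC\<close> (w w') acts on w^2
  with symbol lam n / 2. The subtracted mean is visible only at n = 0, which is excluded.\<close>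

lemma solves_eq_fourier:
  assumes D: "k * h > 0" and w: "w \<in> C2per_e \<alpha>" "\<alpha> > 0" "mean2pi w = 0"
    and eq: "solves_eq h k \<mu> w" and n: "n \<noteq> 0"
  shows "of_real (\<mu> * lam (k*h) n - 1 / k) * fourier_coeff w n
    = fourier_coeff (\<lambda>x. w x * CC (k*h) (wderiv w) x) n
      + of_real (lam (k*h) n / 2) * fourier_coeff (\<lambda>x. w x * w x) n"
proof -
  define T where "T = CC (k*h) (wderiv w)"
  note d = C2per_eD[OF w(1,2)]
  have wH: "w \<in> H1per0" using w by (intro C2per_e_H1per0)
  have T: "T \<in> L2per" "fourier_coeff T n = of_real (lam (k*h) n) * fourier_coeff w n"
    unfolding T_def by (rule CC_wderiv[OF D wH])+
  define P where "P x = w x * wderiv w x" for x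
  have P: "P \<in> L2per"
    unfolding P_def[abs_def] by (intro L2per_mult_continuous H1per0D(2)[OF wH] d)
  have P_coeff: "fourier_coeff P n = \<i> * of_int n / 2 * fourier_coeff (\<lambda>x. w x * w x) n"
  proof -
    have wd: "is_weak_deriv (\<lambda>x. w x * w x) (\<lambda>x. 2 * (w x * deriv w x))"
      using d(3) d(1,5,7,8) by (intro is_weak_deriv_C1)
        (auto intro!: derivative_eq_intros continuous_intros simp: periodic2pi_def algebra_simps)
    \<comment> \<open>\<open>wderiv\<close> is a mere choice; it is replaced by the classical
      derivative through equality of coefficients.\<close>
    have "AE x in circ. wderiv w x = deriv w x"
      using C2per_e_weak_deriv(1)[OF w(1,2)]
      by (intro L2per_eq_AE(1) H1per0D(2)[OF wH])
         (auto simp: is_weak_deriv_def H1per0D(5)[OF wH] C2per_e_weak_deriv(3)[OF w(1,2)])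
    then have "fourier_coeff P n = fourier_coeff (\<lambda>x. w x * deriv w x) n"
      unfolding fourier_coeff_fc
    proof (intro fc_cong_AE)
      show "(\<lambda>x. complex_of_real (P x)) \<in> borel_measurable circ"
        using L2per_integrable[OF P] by (auto simp flip: complex_of_real_integrable_eq)
      show "(\<lambda>x. complex_of_real (w x * deriv w x)) \<in> borel_measurable circ"
        using d(7,8) by (intro measurable_circ borel_measurable_continuous_onI continuous_intros)
    qed (auto simp: P_def)
    moreover have "fourier_coeff (\<lambda>x. 2 * (w x * deriv w x)) n = 2 * fourier_coeff (\<lambda>x. w x * deriv w x) n"
      unfolding fourier_coeff_fc by (simp only: of_real_mult of_real_numeral fc_cmult)
    moreover have "periodic2pi (\<lambda>x. w x * w x)" using d(1) by (simp add: periodic2pi_def)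
    ultimately show ?thesis
      using fourier_coeff_weak_deriv[OF wd, of n] by simp
  qed
  define C where "C = CC (k*h) P"
  have "- \<i> * of_real c * (\<i> * of_int n / 2 * z) = of_real (of_int n * c / 2) * z" for c z
    by (simp add: complex_eq_iff algebra_simps)
  then have C: "C \<in> L2per" "fourier_coeff C n = of_real (lam (k*h) n / 2) * fourier_coeff (\<lambda>x. w x * w x) n"
    unfolding C_def using CC_L2per[OF D P] n by (simp_all only: P_coeff lam_def if_False)
  have wT: "(\<lambda>x. w x * T x) \<in> L2per" by (intro L2per_mult_continuous T d)
  have iw: "integrable circ w" using wH by (rule H1per0_integrable)
  have iT: "integrable circ T" "integrable circ (\<lambda>x. w x * T x)" "integrable circ C"
    using T wT C by (auto intro: L2per_integrable)
  define c where "c = mean2pi (\<lambda>y. w y * T y)"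
  have ae: "AE x in circ. \<mu> * T x = w x / k + w x * T x + C x - c"
    using eq unfolding solves_eq_def T_def[symmetric] P_def[symmetric] C_def[symmetric] c_def[symmetric]
    by (rule AE_circ)
  have "of_real \<mu> * fourier_coeff T n = fc (\<lambda>x. of_real (\<mu> * T x)) n"
    by (simp add: fourier_coeff_fc fc_cmult)
  also have "\<dots> = fc (\<lambda>x. of_real (w x / k + w x * T x + C x - c)) n"
  proof (rule fc_cong_AE)
    show "AE x in circ. complex_of_real (\<mu> * T x) = of_real (w x / k + w x * T x + C x - c)"
      using ae by eventually_elim (simp only:)
  qed (use iw iT in auto)
  also have "\<dots> = fc (\<lambda>x. of_real (1 / k) * of_real (w x) + of_real (w x * T x) + of_real (C x) - of_real c * cis (of_int 0 * x)) n"
    by simp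
  also have "\<dots> = of_real (1 / k) * fourier_coeff w n + fourier_coeff (\<lambda>x. w x * T x) n + fourier_coeff C n - of_real c * (if n = 0 then 1 else 0)"
  proof -
    have i: "integrable circ (\<lambda>x. of_real (1 / k) * complex_of_real (w x))" 
      "integrable circ (\<lambda>x. complex_of_real (w x * T x))" "integrable circ (\<lambda>x. complex_of_real (C x))"
      "integrable circ (\<lambda>x. of_real c * cis (of_int 0 * x))"
      using iw iT unfolding complex_of_real_integrable_eq by (auto simp flip: of_real_mult simp: complex_of_real_integrable_eq)
    show ?thesis
      unfolding fourier_coeff_fc
      by (simp only: fc_diff fc_add Bochner_Integration.integrable_add i fc_cmult fc_cis)
  qed
  finally show ?thesis
    unfolding T_def[symmetric] using n by (simp add: T C algebra_simps)
qed

text \<open>The last clause bounds the coefficients of (w^2)' by 2 N^2. The factor |n| gained there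
  offsets the linear growth of lam n in front of \<open>B\<close>.\<close>

lemma solves_eq_real_fourier:
  fixes a :: "int \<Rightarrow> real"
  assumes D: "k * h > 0" and w: "w \<in> C2per_e \<alpha>" "\<alpha> > 0" "mean2pi w = 0"
    and eq: "solves_eq h k \<mu> w" and n: "n \<noteq> 0"
    and N: "\<And>x. \<bar>w x\<bar> \<le> N" "\<And>x. \<bar>deriv w x\<bar> \<le> N"
    and a: "\<And>n. fourier_coeff w n = of_real (a n)"
  obtains A B where "((\<lambda>m. a m * (lam (k*h) (n - m) * a (n - m))) has_sum A) UNIV"
    "((\<lambda>m. a m * a (n - m)) has_sum B) UNIV"
    "(\<mu> * lam (k*h) n - 1 / k) * a n = A + lam (k*h) n / 2 * B"
    "of_int \<bar>n\<bar> * \<bar>B\<bar> \<le> 2 * N\<^sup>2"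
proof -
  note d = C2per_eD[OF w(1,2)]
  have wH: "w \<in> H1per0" using w by (intro C2per_e_H1per0)
  have iw: "integrable circ w" using wH by (rule H1per0_integrable)
  let ?T = "CC (k*h) (wderiv w)"
  let ?A = "Re (fourier_coeff (\<lambda>x. w x * ?T x) n)"
  let ?B = "Re (fourier_coeff (\<lambda>x. w x * w x) n)"
  show thesis
  proof (rule that[of ?A ?B])
    have "integrable circ ?T" using CC_wderiv(1)[OF D wH] by (rule L2per_integrable)
    from has_sum_Re[OF fourier_coeff_mult_H1per0[OF wH this, of n]]
    show "((\<lambda>m. a m * (lam (k*h) (n - m) * a (n - m))) has_sum ?A) UNIV"
      by (simp add: CC_wderiv(2)[OF D wH] a)
    from has_sum_Re[OF fourier_coeff_mult_H1per0[OF wH iw, of n]]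
    show "((\<lambda>m. a m * a (n - m)) has_sum ?B) UNIV"
      by (simp add: a)
    from arg_cong[OF solves_eq_fourier[OF D w eq n], of Re]
    show "(\<mu> * lam (k*h) n - 1 / k) * a n = ?A + lam (k*h) n / 2 * ?B"
      by (simp add: a)
    have wd: "is_weak_deriv (\<lambda>x. w x * w x) (\<lambda>x. 2 * (w x * deriv w x))"
      using d(3) d(1,5,7,8) by (intro is_weak_deriv_C1)
        (auto intro!: derivative_eq_intros continuous_intros simp: periodic2pi_def algebra_simps)
    have per: "periodic2pi (\<lambda>x. w x * w x)" using d(1) by (simp add: periodic2pi_def)
    have "norm (fourier_coeff (\<lambda>x. 2 * (w x * deriv w x)) n) \<le> 2 * N\<^sup>2"
    proof (rule norm_fourier_coeff_le)
      show "continuous_on UNIV (\<lambda>x. 2 * (w x * deriv w x))" by (intro continuous_intros d)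
      fix x
      have "\<bar>w x\<bar> * \<bar>deriv w x\<bar> \<le> N * N" using N[of x] by (intro mult_mono) auto
      then show "\<bar>2 * (w x * deriv w x)\<bar> \<le> 2 * N\<^sup>2" by (simp add: abs_mult power2_eq_square)
    qed
    then have "of_int \<bar>n\<bar> * norm (fourier_coeff (\<lambda>x. w x * w x) n) \<le> 2 * N\<^sup>2"
      by (simp add: fourier_coeff_weak_deriv[OF wd per] norm_mult)
    moreover have "of_int \<bar>n\<bar> * \<bar>?B\<bar> \<le> of_int \<bar>n\<bar> * norm (fourier_coeff (\<lambda>x. w x * w x) n)"
      by (intro mult_left_mono abs_Re_le_cmod) simp
    ultimately show "of_int \<bar>n\<bar> * \<bar>?B\<bar> \<le> 2 * N\<^sup>2" by linarith
  qed
qed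

section \<open>Integrals against cosine polynomials and the two-mode form\<close>

lemma LINT_mult_cos:
  assumes "integrable circ G"
  shows "(LINT x|circ. G x * cos (of_int n * x)) = 2 * pi * Re (fourier_coeff G n)"
proof -
  have "integrable circ (\<lambda>x. complex_of_real (G x))" using assms by simp
  from integral_Re[OF integrable_fc[OF this, of n]]
  show ?thesis by (simp add: LINT_fc fourier_coeff_fc)
qed

text \<open>Degree 4 suffices because products of two functions in the span of cos x and cos 2x have
  frequencies up to 4.\<close>

definition cos_poly :: "(nat \<Rightarrow> real) \<Rightarrow> real \<Rightarrow> real" where
  "cos_poly p x = (\<Sum>j\<le>4. p j * cos (of_int (int j) * x))"

lemma LINT_mult_cos_poly:
  assumes G: "integrable circ G"
  shows "(LINT x|circ. G x * cos_poly p x) = 2 * pi * (\<Sum>j\<le>4. p j * Re (fourier_coeff G (int j)))"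
    and "integrable circ (\<lambda>x. G x * cos_poly p x)"
proof -
  have int: "integrable circ (\<lambda>x. G x * cos (of_int n * x))" for n
    by (rule integrable_circ_mult_continuous[OF G]) (intro continuous_intros)
  have "(LINT x|circ. G x * cos_poly p x) = (LINT x|circ. (\<Sum>j\<le>4. p j * (G x * cos (of_int (int j) * x))))"
    by (simp only: cos_poly_def sum_distrib_left mult.left_commute)
  also have "\<dots> = (\<Sum>j\<le>4. p j * (LINT x|circ. G x * cos (of_int (int j) * x)))"
  proof (subst Bochner_Integration.integral_sum)
    show "integrable circ (\<lambda>x. p j * (G x * cos (of_int (int j) * x)))" for j
      by (rule integrable_mult_right) (rule int)
  qed (simp only: integral_mult_right_zero)
  also have "\<dots> = 2 * pi * (\<Sum>j\<le>4. p j * Re (fourier_coeff G (int j)))"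
    unfolding LINT_mult_cos[OF G] sum_distrib_left by (simp only: mult_ac)
  finally show "(LINT x|circ. G x * cos_poly p x) = 2 * pi * (\<Sum>j\<le>4. p j * Re (fourier_coeff G (int j)))" .
  show "integrable circ (\<lambda>x. G x * cos_poly p x)"
    unfolding cos_poly_def by (rule integrable_circ_mult_continuous[OF G]) (intro continuous_intros)
qed

text \<open>The second variation at w in the direction cos x + s cos 2x, divided by 2 pi g. The
  coupling constants are lam i + lam j + lam (i + j) for the interactions (1,1,2), (1,2,3) and
  (2,2,4).\<close>

definition mode_form :: "real \<Rightarrow> real \<Rightarrow> real \<Rightarrow> (int \<Rightarrow> real) \<Rightarrow> real \<Rightarrow> real" where
  "mode_form D k \<mu> a s = (\<mu> * lam D 1 - 1 / k) + s\<^sup>2 * (\<mu> * lam D 2 - 1 / k)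
    - a 2 * (2 * lam D 1 + lam D 2)
    - 2 * s * ((2 * lam D 1 + lam D 2) * a 1 + (lam D 1 + lam D 2 + lam D 3) * a 3)
    - s\<^sup>2 * (2 * lam D 2 + lam D 4) * a 4"

section \<open>Negativity of the two-mode form\<close>

definition inverse_square_sum :: real where
  "inverse_square_sum = (\<Sum>\<^sub>\<infinity>n::int. 1 / (of_int n)\<^sup>2)"

lemma inverse_square_sum_nonneg: "inverse_square_sum \<ge> 0"
  unfolding inverse_square_sum_def by (rule infsum_nonneg) simp

text \<open>At m = 0 the hypothesis reads |t 0| \<le> 0, because division by zero gives 0; over all
  integers the lemma therefore applies to terms that vanish there.\<close>

lemma has_sum_bound_inverse_square:
  fixes t :: "int \<Rightarrow> real"
  assumes t: "(t has_sum S) X" and b: "\<And>m. m \<in> X \<Longrightarrow> \<bar>t m\<bar> \<le> C / (of_int m)\<^sup>2" and C: "C \<ge> 0"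
  shows "\<bar>S\<bar> \<le> C * inverse_square_sum"
proof -
  let ?f = "\<lambda>m::int. C / (of_int m)\<^sup>2"
  have all: "?f summable_on UNIV"
    using summable_on_cmult_right[OF summable_inverse_square_int, of C] by simp
  then have f: "?f summable_on X" by (rule summable_on_subset_banach) simp
  have norm: "(\<lambda>m. norm (t m)) summable_on X"
    using f by (rule summable_on_comparison_test) (use b in auto)
  have "\<bar>S\<bar> = norm (infsum t X)" using infsumI[OF t] by simp
  also have "\<dots> \<le> (\<Sum>\<^sub>\<infinity>m\<in>X. norm (t m))" by (rule norm_infsum_bound[OF norm])
  also have "\<dots> \<le> infsum ?f X"
    using b by (intro infsum_mono norm f) auto
  also have "\<dots> \<le> infsum ?f UNIV"
    using C by (intro infsum_mono2 f all) auto
  also have "\<dots> = C * inverse_square_sum"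
    unfolding inverse_square_sum_def using infsum_cmult_right'[of C "\<lambda>m. 1 / (of_int m)\<^sup>2" UNIV] by simp
  finally show ?thesis .
qed

lemma abs_le_divide_square:
  fixes m :: int
  assumes "(of_int m)\<^sup>2 * \<bar>x\<bar> \<le> (c::real)" "m \<noteq> 0"
  shows "\<bar>x\<bar> \<le> c / (of_int m)\<^sup>2"
  using assms by (simp add: field_simps)

lemma abs_mult_le_square:
  fixes m :: int
  assumes "(of_int m)\<^sup>2 * \<bar>x\<bar> \<le> (c::real)"
  shows "of_int \<bar>m\<bar> * \<bar>x\<bar> \<le> c"
proof -
  have "\<bar>m\<bar> * 1 \<le> \<bar>m\<bar> * \<bar>m\<bar>"
  proof (cases "m = 0")
    case False
    then show ?thesis by (intro mult_left_mono) linarith+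
  qed simp
  then have "real_of_int \<bar>m\<bar> \<le> of_int (\<bar>m\<bar> * \<bar>m\<bar>)" by linarith
  then have "of_int \<bar>m\<bar> * \<bar>x\<bar> \<le> (of_int m)\<^sup>2 * \<bar>x\<bar>"
    by (intro mult_right_mono) (auto simp: power2_eq_square simp flip: abs_mult)
  with assms show ?thesis by linarith
qed

text \<open>The whole perturbation argument for a bare even sequence, with one threshold \<rho>
  uniform in all data. Here \<delta> stands for the C2 norm of w - \<epsilon> cos divided by
  |\<epsilon>|; the bound 8 \<epsilon>^2 is 2 N^2 for N = 2 |\<epsilon>|.\<close>

lemma mode_form_negative:
  fixes D k :: real
  assumes D: "D > 0" and k: "k > 0"
  defines "\<mu>1 \<equiv> 1 / (k * lam D 1)"
  shows "\<exists>\<rho>>0. \<forall>\<mu> \<epsilon> \<delta> a. \<bar>\<mu> - \<mu>1\<bar> < \<rho> \<longrightarrow> 0 \<le> \<delta> \<longrightarrow> \<delta> < \<rho> \<longrightarrow> \<epsilon> \<noteq> 0 \<longrightarrow> \<bar>\<epsilon>\<bar> < 1 \<longrightarrow>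
     a 0 = 0 \<longrightarrow> (\<forall>n. a (- n) = a n) \<longrightarrow> (\<forall>n. (of_int n)\<^sup>2 * \<bar>a n\<bar> \<le> 2 * \<bar>\<epsilon>\<bar>) \<longrightarrow>
     (\<forall>n. \<bar>n\<bar> \<ge> 2 \<longrightarrow> (of_int n)\<^sup>2 * \<bar>a n\<bar> \<le> \<delta> * \<bar>\<epsilon>\<bar>) \<longrightarrow> \<bar>a 1 - \<epsilon> / 2\<bar> \<le> \<delta> * \<bar>\<epsilon>\<bar> \<longrightarrow>
     (\<forall>n. n \<noteq> 0 \<longrightarrow> (\<exists>A B. ((\<lambda>m. a m * (lam D (n - m) * a (n - m))) has_sum A) UNIV \<and>
        ((\<lambda>m. a m * a (n - m)) has_sum B) UNIV \<and>
        (\<mu> * lam D n - 1 / k) * a n = A + lam D n / 2 * B \<and> of_int \<bar>n\<bar> * \<bar>B\<bar> \<le> 8 * \<epsilon>\<^sup>2)) \<longrightarrow>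
     (\<exists>s. mode_form D k \<mu> a s < 0)"
proof -
  define l where "l = lam D"
  define Z where "Z = inverse_square_sum"
  have Z: "Z \<ge> 0" unfolding Z_def by (rule inverse_square_sum_nonneg)
  have l1: "l 1 > 0" unfolding l_def by (rule lam_1_pos[OF D])
  have l0: "l n \<ge> 0" for n unfolding l_def by (rule lam_nonneg[OF D])
  have l12: "l 1 < l 2" unfolding l_def by (rule lam_strict_mono[OF D]) auto
  have lmono: "0 < m \<Longrightarrow> m \<le> \<bar>n\<bar> \<Longrightarrow> l m \<le> l n" for m n unfolding l_def by (rule lam_mono[OF D])
  have lle: "l n \<le> l 1 * of_int \<bar>n\<bar>" for n unfolding l_def lam_1 by (rule lam_le[OF D])
  have lminus: "l (- n) = l n" for n unfolding l_def by (rule lam_minus)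
  have \<mu>1: "\<mu>1 > 0" "\<mu>1 * l 1 = 1 / k" using l1 k by (auto simp: \<mu>1_def l_def)
  define L where "L = 2 * l 1 + l 2"
  define B0 where "B0 = \<mu>1 * l 2 - 1 / k"
  have L: "L > 0" using l1 l12 by (simp add: L_def)
  have B0: "B0 > 0" using mult_strict_left_mono[OF l12 \<mu>1(1)] by (simp add: B0_def \<mu>1(2))
  \<comment> \<open>For |n| \<ge> 2, \<mu>1 l n - 1/k = \<mu>1 (l n - l 1) \<ge> \<mu>1 (1 - l 1 / l
    2) l n. Half of this is kept as \<open>\<kappa> * l n\<close>, the other half absorbs the
    deviation of \<mu> from \<mu>1.\<close>
  define \<kappa> where "\<kappa> = \<mu>1 * (1 - l 1 / l 2) / 2"
  have \<kappa>: "\<kappa> > 0" using \<mu>1(1) l1 l12 by (simp add: \<kappa>_def)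
  \<comment> \<open>The two quadratic terms of the equation are at most 4 l 1 Z e^2 and 4 l 1 e^2;
    division by \<kappa> gives \<open>M\<close>.\<close>
  define M where "M = 4 * l 1 * (Z + 1) / \<kappa>"
  have M: "M \<ge> 0" using l1 Z \<kappa> by (simp add: M_def)
  \<comment> \<open>The constants are chosen so that the form is at most \<open>(K1 * \<rho> + K2 * \<delta> - c) * \<epsilon>\<^sup>2\<close>.\<close>
  define K1 where "K1 = l 2 * (L / B0)\<^sup>2"
  define K2 where "K2 = 6 * M * Z + 2 * (L / B0) * (l 1 + l 2 + l 3) + (L / B0)\<^sup>2 * (2 * l 2 + l 4)"
  have K: "K1 \<ge> 0" "K2 \<ge> 0" using M Z L B0 l0 by (auto simp: K1_def K2_def)
  \<comment> \<open>The gain L^2 (a 1)^2 / B0 from the optimal s, at the lower bound |a 1| = e/4, is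
    c e^2.\<close>
  define c where "c = L\<^sup>2 / (16 * B0)"
  have c: "c > 0" using L B0 by (simp add: c_def)
  \<comment> \<open>The three entries ensure in turn the lower bound on the multipliers for |n|
    \<ge> 2, the estimate |a 1| \<ge> e/4, and the sign of the final expression.\<close>
  define \<rho> where "\<rho> = min \<kappa> (min (1 / 8) (c / (2 * (K1 + K2 + 1))))"
  have \<rho>: "\<rho> > 0" using \<kappa> c K by (simp add: \<rho>_def)
  have \<rho>_small: "\<rho> * (K1 + K2) < c"
  proof -
    have "\<rho> * (K1 + K2) \<le> c / (2 * (K1 + K2 + 1)) * (K1 + K2)"
      using K by (intro mult_right_mono) (auto simp: \<rho>_def)
    also have "\<dots> < c" using c K by (simp add: divide_less_eq)
    finally show ?thesis .
  qed
  have main: "\<exists>s. mode_form D k \<mu> a s < 0"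
    if \<mu>: "\<bar>\<mu> - \<mu>1\<bar> < \<rho>" and \<delta>: "0 \<le> \<delta>" "\<delta> < \<rho>" and \<epsilon>: "\<epsilon> \<noteq> 0" "\<bar>\<epsilon>\<bar> < 1"
      and a0: "a 0 = 0" and am: "\<And>n. a (- n) = a n" and a2: "\<And>n. (of_int n)\<^sup>2 * \<bar>a n\<bar> \<le> 2 * \<bar>\<epsilon>\<bar>"
      and ad: "\<And>n. \<bar>n\<bar> \<ge> 2 \<Longrightarrow> (of_int n)\<^sup>2 * \<bar>a n\<bar> \<le> \<delta> * \<bar>\<epsilon>\<bar>" and a1: "\<bar>a 1 - \<epsilon> / 2\<bar> \<le> \<delta> * \<bar>\<epsilon>\<bar>"
      and eqn: "\<And>n. n \<noteq> 0 \<Longrightarrow> \<exists>A B. ((\<lambda>m. a m * (l (n - m) * a (n - m))) has_sum A) UNIV \<and>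
        ((\<lambda>m. a m * a (n - m)) has_sum B) UNIV \<and>
        (\<mu> * l n - 1 / k) * a n = A + l n / 2 * B \<and> of_int \<bar>n\<bar> * \<bar>B\<bar> \<le> 8 * \<epsilon>\<^sup>2"
    for \<mu> \<epsilon> \<delta> :: real and a :: "int \<Rightarrow> real"
  proof -
    define e where "e = \<bar>\<epsilon>\<bar>"
    have e: "e > 0" "e < 1" "\<epsilon>\<^sup>2 = e * e" using \<epsilon> by (auto simp: e_def power2_eq_square)
    have \<delta>8: "\<delta> \<le> 1 / 8" using \<delta>(2) by (simp add: \<rho>_def)
    have la: "l n * \<bar>a n\<bar> \<le> 2 * l 1 * e" for n
    proof -
      have "l n * \<bar>a n\<bar> \<le> (l 1 * of_int \<bar>n\<bar>) * \<bar>a n\<bar>" by (intro mult_right_mono lle) simp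
      also have "\<dots> = l 1 * (of_int \<bar>n\<bar> * \<bar>a n\<bar>)" by (simp only: mult.assoc)
      also have "\<dots> \<le> l 1 * (2 * e)"
        using l1 abs_mult_le_square[OF a2[of n]] by (intro mult_left_mono) (auto simp: e_def)
      finally show ?thesis by simp
    qed
    have a_sq: "\<bar>a m\<bar> \<le> 2 * e / (of_int m)\<^sup>2" for m
      using abs_le_divide_square[OF a2, of m] a0 by (cases "m = 0") (auto simp: e_def)
    \<comment> \<open>High modes improve from first to second order: the right-hand side of the
      equation is quadratic in \<open>a\<close>, and the multiplier on the left is at least
      \<open>\<kappa> * l n\<close>.\<close>
    have high: "l n * \<bar>a n\<bar> \<le> M * (e * e)" if n: "\<bar>n\<bar> \<ge> 2" for n
    proof -
      have n0: "n \<noteq> 0" using n by auto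
      obtain A B where A: "((\<lambda>m. a m * (l (n - m) * a (n - m))) has_sum A) UNIV"
        and eq: "(\<mu> * l n - 1 / k) * a n = A + l n / 2 * B" and B: "of_int \<bar>n\<bar> * \<bar>B\<bar> \<le> 8 * \<epsilon>\<^sup>2"
        using eqn[OF n0] by blast
      have "\<bar>A\<bar> \<le> (4 * l 1 * (e * e)) * Z"
        unfolding Z_def
      proof (rule has_sum_bound_inverse_square[OF A])
        fix m
        have "\<bar>a m * (l (n - m) * a (n - m))\<bar> = \<bar>a m\<bar> * (l (n - m) * \<bar>a (n - m)\<bar>)"
          using l0[of "n - m"] by (simp add: abs_mult)
        also have "\<dots> \<le> 2 * e / (of_int m)\<^sup>2 * (2 * l 1 * e)"
          using e l0 by (intro mult_mono a_sq la mult_nonneg_nonneg) auto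
        finally show "\<bar>a m * (l (n - m) * a (n - m))\<bar> \<le> 4 * l 1 * (e * e) / (of_int m)\<^sup>2"
          by (simp add: mult_ac)
      qed (use l1 e in auto)
      moreover have "\<bar>l n / 2 * B\<bar> \<le> 4 * l 1 * (e * e)"
      proof -
        have "\<bar>l n / 2 * B\<bar> = l n * (\<bar>B\<bar> / 2)" using l0[of n] by (simp add: abs_mult)
        also have "\<dots> \<le> (l 1 * of_int \<bar>n\<bar>) * (\<bar>B\<bar> / 2)" by (intro mult_right_mono lle) simp
        also have "\<dots> = l 1 / 2 * (of_int \<bar>n\<bar> * \<bar>B\<bar>)" by simp
        also have "\<dots> \<le> l 1 / 2 * (8 * (e * e))" using l1 B e(3) by (intro mult_left_mono) auto
        finally show ?thesis by (simp add: mult_ac)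
      qed
      ultimately have "\<bar>(\<mu> * l n - 1 / k) * a n\<bar> \<le> 4 * l 1 * (e * e) * Z + 4 * l 1 * (e * e)"
        unfolding eq by linarith
      moreover have "\<kappa> * l n \<le> \<mu> * l n - 1 / k"
      proof -
        have ln: "l 2 \<le> l n" using n by (intro lmono) auto
        have "2 * \<kappa> * l n = \<mu>1 * l n - \<mu>1 * l 1 * (l n / l 2)" by (simp add: \<kappa>_def field_simps)
        also have "\<dots> \<le> \<mu>1 * l n - \<mu>1 * l 1 * 1"
          using \<mu>1 l1 l12 ln k by (intro diff_left_mono mult_left_mono) (auto simp: le_divide_eq)
        finally have 1: "2 * \<kappa> * l n \<le> \<mu>1 * l n - 1 / k" using \<mu>1(2) by simp
        have "(\<mu>1 - \<mu>) * l n \<le> \<kappa> * l n"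
          using \<mu> l0 by (intro mult_right_mono) (auto simp: \<rho>_def)
        with 1 show ?thesis by (simp add: algebra_simps)
      qed
      then have "\<kappa> * l n * \<bar>a n\<bar> \<le> (\<mu> * l n - 1 / k) * \<bar>a n\<bar>" by (rule mult_right_mono) simp
      moreover have "(\<mu> * l n - 1 / k) * \<bar>a n\<bar> \<le> \<bar>(\<mu> * l n - 1 / k) * a n\<bar>"
        unfolding abs_mult by (intro mult_right_mono) auto
      ultimately have "\<kappa> * l n * \<bar>a n\<bar> \<le> 4 * l 1 * (e * e) * Z + 4 * l 1 * (e * e)" by linarith
      moreover have "\<kappa> * (M * (e * e)) = 4 * l 1 * (e * e) * Z + 4 * l 1 * (e * e)"
      proof -
        have "\<kappa> * M = 4 * l 1 * (Z + 1)" using \<kappa> by (simp add: M_def)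
        then have "\<kappa> * M * (e * e) = 4 * l 1 * (Z + 1) * (e * e)" by simp
        then show ?thesis by (simp add: algebra_simps)
      qed
      ultimately have "\<kappa> * (l n * \<bar>a n\<bar>) \<le> \<kappa> * (M * (e * e))"
        by (simp add: mult.assoc)
      then show ?thesis using \<kappa> by simp
    qed
    \<comment> \<open>Isolating the modes 1 and 2 in the first coefficient: m = 2 and m = -1
      together give L a_1 a_2, while m = 0 and m = 1 contain a_0 = 0. In the rest, \<open>ad\<close>
      bounds one factor by \<delta> e / m^2 and \<open>high\<close> bounds the other by M
      e^2.\<close>
    obtain R where R: "(\<mu> * l 1 - 1 / k - L * a 2) * a 1 = R" "\<bar>R\<bar> \<le> (3 / 2 * M * \<delta> * (e * e * e)) * Z"
    proof -
      obtain A B where A: "((\<lambda>m. a m * (l (1 - m) * a (1 - m))) has_sum A) UNIV"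
        and B: "((\<lambda>m. a m * a (1 - m)) has_sum B) UNIV"
        and eq: "(\<mu> * l 1 - 1 / k) * a 1 = A + l 1 / 2 * B"
        using eqn[of 1] by auto
      let ?t = "\<lambda>m. a m * (l (1 - m) * a (1 - m)) + l 1 / 2 * (a m * a (1 - m))"
      \<comment> \<open>Outside \<open>?F\<close> both indices \<open>m\<close> and \<open>1 - m\<close> have modulus at least 2.\<close>
      let ?F = "{-1, 0, 1, 2::int}"
      have t: "(?t has_sum (A + l 1 / 2 * B)) UNIV"
        by (intro has_sum_add has_sum_cmult_right A B)
      have F: "(?t has_sum (L * a 2 * a 1)) ?F"
        by (rule has_sum_finiteI) (use a0 am[of 1] lminus[of 1] in \<open>auto simp: L_def algebra_simps\<close>)
      have "(?t has_sum (A + l 1 / 2 * B - L * a 2 * a 1)) (UNIV - ?F)"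
        by (rule has_sum_Diff[OF t F]) simp
      then have "\<bar>A + l 1 / 2 * B - L * a 2 * a 1\<bar> \<le> (3 / 2 * M * \<delta> * (e * e * e)) * Z"
        unfolding Z_def
      proof (rule has_sum_bound_inverse_square)
        fix m assume m: "m \<in> UNIV - ?F"
        then have m2: "\<bar>m\<bar> \<ge> 2" "\<bar>1 - m\<bar> \<ge> 2" by auto
        \<comment> \<open>Merges the weights of the two convolutions: l (1 - m) + l 1 / 2 is at most
          3/2 l (1 - m), so \<open>high\<close> covers both.\<close>
        have "l 1 \<le> l (1 - m)" using m2 by (intro lmono) auto
        have "\<bar>?t m\<bar> = \<bar>a m\<bar> * ((l (1 - m) + l 1 / 2) * \<bar>a (1 - m)\<bar>)"
        proof -
          have "?t m = a m * ((l (1 - m) + l 1 / 2) * a (1 - m))" by (simp add: algebra_simps)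
          then show ?thesis using l0[of "1 - m"] l1 by (simp add: abs_mult)
        qed
        also have "\<dots> \<le> \<bar>a m\<bar> * ((3 / 2 * l (1 - m)) * \<bar>a (1 - m)\<bar>)"
          using \<open>l 1 \<le> l (1 - m)\<close> by (intro mult_left_mono mult_right_mono) auto
        also have "\<dots> = \<bar>a m\<bar> * (3 / 2 * (l (1 - m) * \<bar>a (1 - m)\<bar>))" by simp
        also have "\<dots> \<le> (\<delta> * e / (of_int m)\<^sup>2) * (3 / 2 * (M * (e * e)))"
        proof (rule mult_mono)
          show "3 / 2 * (l (1 - m) * \<bar>a (1 - m)\<bar>) \<le> 3 / 2 * (M * (e * e))"
            using high[OF m2(2)] by simp
          show "\<bar>a m\<bar> \<le> \<delta> * e / (of_int m)\<^sup>2"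
            using abs_le_divide_square[OF ad[OF m2(1)]] m2 by (auto simp: e_def)
        qed (use \<delta> e l0 in auto)
        finally show "\<bar>?t m\<bar> \<le> (3 / 2 * M * \<delta> * (e * e * e)) / (of_int m)\<^sup>2"
          by (simp add: mult_ac)
      qed (use M \<delta> e in auto)
      then show thesis
        by (intro that[of "A + l 1 / 2 * B - L * a 2 * a 1"]) (use eq in \<open>auto simp: algebra_simps\<close>)
    qed
    have a1_low: "e / 4 \<le> \<bar>a 1\<bar>" and a1_up: "\<bar>a 1\<bar> \<le> e"
    proof -
      have "\<delta> * e \<le> 1 / 8 * e" using \<delta>8 e by (intro mult_right_mono) auto
      then have "\<bar>a 1 - \<epsilon> / 2\<bar> \<le> e / 8" using a1 by (simp add: e_def)
      then show "e / 4 \<le> \<bar>a 1\<bar>" "\<bar>a 1\<bar> \<le> e" unfolding e_def by linarith+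
    qed
    \<comment> \<open>Division of \<open>R\<close> by |a 1| \<ge> e/4 turns the factor 3/2 into 6
      and the order e^3 into e^2.\<close>
    have first: "\<mu> * l 1 - 1 / k - L * a 2 \<le> 6 * M * Z * \<delta> * (e * e)"
    proof -
      have "\<bar>\<mu> * l 1 - 1 / k - L * a 2\<bar> * (e / 4) \<le> \<bar>\<mu> * l 1 - 1 / k - L * a 2\<bar> * \<bar>a 1\<bar>"
        using a1_low by (intro mult_left_mono) auto
      also have "\<dots> = \<bar>R\<bar>" unfolding R(1)[symmetric] by (simp add: abs_mult)
      also have "\<dots> \<le> (6 * M * Z * \<delta> * (e * e)) * (e / 4)" using R(2) by (simp add: mult_ac)
      finally have "\<bar>\<mu> * l 1 - 1 / k - L * a 2\<bar> \<le> 6 * M * Z * \<delta> * (e * e)"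
        using e by (subst (asm) mult_le_cancel_right) auto
      then show ?thesis by linarith
    qed
    \<comment> \<open>Minimizer of the quadratic s^2 B0 - 2 s L a_1, with \<open>B0\<close> the
      limit value of the multiplier of mode 2.\<close>
    define s where "s = a 1 * L / B0"
    have s_abs: "\<bar>s\<bar> \<le> L / B0 * e"
    proof -
      have "\<bar>s\<bar> = L / B0 * \<bar>a 1\<bar>" using L B0 by (simp add: s_def abs_mult)
      also have "\<dots> \<le> L / B0 * e" using L B0 a1_up by (intro mult_left_mono) auto
      finally show ?thesis .
    qed
    have s_sq: "s\<^sup>2 \<le> (L / B0)\<^sup>2 * (e * e)"
    proof -
      have "\<bar>s\<bar>\<^sup>2 \<le> (L / B0 * e)\<^sup>2" using s_abs by (intro power_mono) auto
      then show ?thesis by (simp add: power2_eq_square mult_ac)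
    qed
    have square: "s\<^sup>2 * B0 - 2 * s * L * a 1 \<le> - c * (e * e)"
    proof -
      have "s\<^sup>2 * B0 - 2 * s * L * a 1 = - (L\<^sup>2 / B0 * (a 1)\<^sup>2)"
        using B0 by (simp add: s_def power2_eq_square field_simps)
      moreover have "(e / 4)\<^sup>2 \<le> (a 1)\<^sup>2"
        using a1_low e power_mono[of "e / 4" "\<bar>a 1\<bar>" 2] by simp
      then have "L\<^sup>2 / B0 * (e / 4)\<^sup>2 \<le> L\<^sup>2 / B0 * (a 1)\<^sup>2"
        using B0 by (intro mult_left_mono) auto
      moreover have "L\<^sup>2 / B0 * (e / 4)\<^sup>2 = c * (e * e)" by (simp add: c_def power2_eq_square)
      ultimately show ?thesis by simp
    qed
    have second: "s\<^sup>2 * ((\<mu> - \<mu>1) * l 2) \<le> K1 * \<rho> * (e * e)"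
    proof -
      have "(\<mu> - \<mu>1) * l 2 \<le> \<rho> * l 2" using \<mu> l0 by (intro mult_right_mono) auto
      then have "s\<^sup>2 * ((\<mu> - \<mu>1) * l 2) \<le> s\<^sup>2 * (\<rho> * l 2)" by (intro mult_left_mono) auto
      also have "\<dots> \<le> ((L / B0)\<^sup>2 * (e * e)) * (\<rho> * l 2)"
        using \<rho> l0 by (intro mult_right_mono s_sq) auto
      finally show ?thesis by (simp add: K1_def mult_ac)
    qed
    have a_small: "\<bar>a n\<bar> \<le> \<delta> * e" if "\<bar>n\<bar> \<ge> 2" for n
    proof -
      have "1 * \<bar>a n\<bar> \<le> (of_int n)\<^sup>2 * \<bar>a n\<bar>"
      proof (intro mult_right_mono)
        have "1 \<le> \<bar>n\<bar>" using that by simp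
        then have "1 \<le> \<bar>real_of_int n\<bar>" by linarith
        then show "1 \<le> (real_of_int n)\<^sup>2" by (metis one_le_power power2_abs)
      qed simp
      with ad[OF that] show ?thesis by (simp add: e_def)
    qed
    have third: "- 2 * s * ((l 1 + l 2 + l 3) * a 3) \<le> 2 * (L / B0) * (l 1 + l 2 + l 3) * \<delta> * (e * e)"
    proof -
      have "- 2 * s * ((l 1 + l 2 + l 3) * a 3) \<le> \<bar>- 2 * s * ((l 1 + l 2 + l 3) * a 3)\<bar>" by simp
      also have "\<dots> = 2 * \<bar>s\<bar> * ((l 1 + l 2 + l 3) * \<bar>a 3\<bar>)" using l0[of 1] l0[of 2] l0[of 3] by (simp add: abs_mult)
      also have "\<dots> \<le> 2 * (L / B0 * e) * ((l 1 + l 2 + l 3) * (\<delta> * e))"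
        using l0[of 1] l0[of 2] l0[of 3] L B0 e by (intro mult_mono mult_left_mono s_abs a_small) auto
      finally show ?thesis by (simp add: mult_ac)
    qed
    have fourth: "- s\<^sup>2 * (2 * l 2 + l 4) * a 4 \<le> (L / B0)\<^sup>2 * (2 * l 2 + l 4) * \<delta> * (e * e)"
    proof -
      have "- s\<^sup>2 * (2 * l 2 + l 4) * a 4 = (s\<^sup>2 * (2 * l 2 + l 4)) * (- a 4)" by simp
      also have "\<dots> \<le> (s\<^sup>2 * (2 * l 2 + l 4)) * \<delta>"
      proof (intro mult_left_mono)
        \<comment> \<open>The factor s^2 already supplies e^2, so the e in the bound for a_4 may be
          discarded using e < 1.\<close>
        have "\<delta> * e \<le> \<delta> * 1" using \<delta> e by (intro mult_left_mono) auto
        with a_small[of 4] show "- a 4 \<le> \<delta>" by simp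
      qed (use l0 in auto)
      also have "\<dots> \<le> (((L / B0)\<^sup>2 * (e * e)) * (2 * l 2 + l 4)) * \<delta>"
        using \<delta> l0[of 2] l0[of 4] by (intro mult_right_mono s_sq) auto
      finally show ?thesis by (simp add: mult_ac)
    qed
    have "mode_form D k \<mu> a s = (\<mu> * l 1 - 1 / k - L * a 2) + (s\<^sup>2 * B0 - 2 * s * L * a 1) + s\<^sup>2 * ((\<mu> - \<mu>1) * l 2)
        + - 2 * s * ((l 1 + l 2 + l 3) * a 3) + - s\<^sup>2 * (2 * l 2 + l 4) * a 4"
      unfolding mode_form_def l_def[symmetric] by (simp add: L_def B0_def algebra_simps)
    also have "\<dots> \<le> 6 * M * Z * \<delta> * (e * e) + - c * (e * e) + K1 * \<rho> * (e * e)
        + 2 * (L / B0) * (l 1 + l 2 + l 3) * \<delta> * (e * e) + (L / B0)\<^sup>2 * (2 * l 2 + l 4) * \<delta> * (e * e)"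
      by (intro add_mono first square second third fourth)
    also have "\<dots> = (K1 * \<rho> + K2 * \<delta> - c) * (e * e)"
      by (simp add: K2_def algebra_simps)
    also have "\<dots> < 0"
    proof (rule mult_neg_pos)
      have "K2 * \<delta> \<le> K2 * \<rho>" using K \<delta> by (intro mult_left_mono) auto
      with \<rho>_small show "K1 * \<rho> + K2 * \<delta> - c < 0" by (simp add: algebra_simps)
    qed (use e in auto)
    finally show ?thesis by blast
  qed
  show ?thesis
  proof (rule exI[of _ \<rho>], intro conjI allI impI)
    show "\<rho> > 0" by (rule \<rho>)
  next
    fix \<mu> \<epsilon> \<delta> :: real and a :: "int \<Rightarrow> real"
    assume "\<bar>\<mu> - \<mu>1\<bar> < \<rho>" "0 \<le> \<delta>" "\<delta> < \<rho>" "\<epsilon> \<noteq> 0" "\<bar>\<epsilon>\<bar> < 1" "a 0 = 0" "\<forall>n. a (- n) = a n"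
      "\<forall>n. (of_int n)\<^sup>2 * \<bar>a n\<bar> \<le> 2 * \<bar>\<epsilon>\<bar>" "\<forall>n. \<bar>n\<bar> \<ge> 2 \<longrightarrow> (of_int n)\<^sup>2 * \<bar>a n\<bar> \<le> \<delta> * \<bar>\<epsilon>\<bar>"
      "\<bar>a 1 - \<epsilon> / 2\<bar> \<le> \<delta> * \<bar>\<epsilon>\<bar>"
      "\<forall>n. n \<noteq> 0 \<longrightarrow> (\<exists>A B. ((\<lambda>m. a m * (lam D (n - m) * a (n - m))) has_sum A) UNIV \<and>
        ((\<lambda>m. a m * a (n - m)) has_sum B) UNIV \<and>
        (\<mu> * lam D n - 1 / k) * a n = A + lam D n / 2 * B \<and> of_int \<bar>n\<bar> * \<bar>B\<bar> \<le> 8 * \<epsilon>\<^sup>2)"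
    then show "\<exists>s. mode_form D k \<mu> a s < 0"
      by (intro main[of \<mu> \<delta> \<epsilon> a, unfolded l_def]) blast+
  qed
qed

section \<open>The second variation in a two-mode direction\<close>

lemma fourier_coeff_cos:
  assumes "m > 0"
  shows "fourier_coeff (\<lambda>x. cos (of_int m * x)) n = (if \<bar>n\<bar> = m then 1 / 2 else 0)"
  using fourier_coeff_cos_sin[OF assms, of 1 0 n] assms by (auto simp: complex_eq_iff)

lemma cos_H1per0: "m > 0 \<Longrightarrow> (\<lambda>x. cos (of_int m * x)) \<in> H1per0"
  using cos_sin_H1per0[of m 1 0] by simp

lemma CC_wderiv_cos:
  assumes D: "D > 0" and m: "m > 0"
  shows "AE x in circ. CC D (wderiv (\<lambda>x. cos (of_int m * x))) x = lam D m * cos (of_int m * x)"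
proof -
  let ?c = "\<lambda>x::real. cos (of_int m * x)"
  have "continuous_on UNIV ?c" by (intro continuous_intros)
  then have c: "?c \<in> L2per" by (rule L2per_continuous[OF _ H1per0D(1)[OF cos_H1per0[OF m]]])
  from L2per_lincomb[OF zero_L2per this, of "lam D m"]
  have L: "(\<lambda>x. lam D m * ?c x) \<in> L2per" by simp
  show ?thesis
  proof (rule L2per_eq_AE(1)[OF CC_wderiv(1)[OF D cos_H1per0[OF m]] L])
    fix n
    have "fourier_coeff (\<lambda>x. lam D m * ?c x) n = of_real (lam D m) * fourier_coeff ?c n"
      unfolding fourier_coeff_fc by (simp only: of_real_mult fc_cmult)
    then show "fourier_coeff (CC D (wderiv ?c)) n = fourier_coeff (\<lambda>x. lam D m * ?c x) n"
      using lam_abs[of D n] by (auto simp: CC_wderiv(2)[OF D cos_H1per0[OF m]] fourier_coeff_cos[OF m])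
  qed
qed


text \<open>For this direction u, both u \<open>CC\<close> (u') and u^2 are cosine polynomials, so
  the integrals against \<mu> - 2w and 1/k + \<open>CC\<close> (w') read off finitely many
  coefficients of w. This evaluation is exact.\<close>

lemma second_var_two_mode:
  assumes D: "k * h > 0" and w: "w \<in> H1per0" and a: "\<And>n. fourier_coeff w n = of_real (a n)"
  shows "(\<lambda>x::real. cos (of_int 1 * x) + s * cos (of_int 2 * x)) \<in> H1per0"
    and "second_var g h k m (g * \<mu> + 2 * g * h) w (\<lambda>x. cos (of_int 1 * x) + s * cos (of_int 2 * x))
      = 2 * pi * g * mode_form (k*h) k \<mu> a s"
proof -
  let ?l = "lam (k*h)"
  let ?u = "\<lambda>x. cos (of_int 1 * x) + s * cos (of_int 2 * x)"
  show u: "?u \<in> H1per0" by (intro H1per0_lincomb cos_H1per0) auto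
  define W where "W = CC (k*h) (wderiv w)"
  have W: "W \<in> L2per" "\<And>n. fourier_coeff W n = of_real (?l n) * of_real (a n)"
    unfolding W_def by (auto simp: CC_wderiv[OF D w] a)
  \<comment> \<open>Product-to-sum coefficients of u \<open>CC\<close> (u') and, in
    \<open>q\<close>, of u^2, listed by frequency 0 to 4. They are verified by expanding both sides
    into powers of cos x.\<close>
  define p where "p = (\<lambda>j::nat. [(?l 1 + s\<^sup>2 * ?l 2) / 2, s * (?l 1 + ?l 2) / 2, ?l 1 / 2, s * (?l 1 + ?l 2) / 2, s\<^sup>2 * ?l 2 / 2] ! j)"
  define q where "q = (\<lambda>j::nat. [(1 + s\<^sup>2) / 2, s, 1 / 2, s, s\<^sup>2 / 2] ! j)"
  have cos3: "cos (3 * x) = 4 * cos x ^ 3 - 3 * cos x" for x :: real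
    by (rule cos_treble_cos)
  have cos4: "cos (4 * x) = 8 * cos x ^ 4 - 8 * cos x ^ 2 + 1" for x :: real
  proof -
    have "cos (4 * x) = cos (2 * (2 * x))" by simp
    also have "\<dots> = 2 * (2 * cos x ^ 2 - 1) ^ 2 - 1" by (simp only: cos_double_cos)
    also have "\<dots> = 8 * cos x ^ 4 - 8 * cos x ^ 2 + 1" by algebra
    finally show ?thesis .
  qed
  have cp: "cos_poly r x = r 0 + r 1 * cos x + r 2 * cos (2 * x) + r 3 * cos (3 * x) + r 4 * cos (4 * x)" for r x
    by (simp add: cos_poly_def numeral_eq_Suc)
  have p_eq: "?u x * (?l 1 * cos (of_int 1 * x) + s * (?l 2 * cos (of_int 2 * x))) = cos_poly p x" for x
    unfolding cp p_def
    by (simp add: cos3 cos4 cos_double_cos) (simp add: field_simps power2_eq_square power3_eq_cube power4_eq_xxxx)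
  have q_eq: "(?u x)\<^sup>2 = cos_poly q x" for x
    unfolding cp q_def
    by (simp add: cos3 cos4 cos_double_cos) (simp add: field_simps power2_eq_square power3_eq_cube power4_eq_xxxx)
  have U: "AE x in circ. CC (k*h) (wderiv ?u) x = ?l 1 * cos (of_int 1 * x) + s * (?l 2 * cos (of_int 2 * x))"
  proof -
    have "AE x in circ. CC (k*h) (wderiv ?u) x = CC (k*h) (wderiv (\<lambda>x. cos (of_int 1 * x))) x + s * CC (k*h) (wderiv (\<lambda>x. cos (of_int 2 * x))) x"
      by (intro CC_wderiv_lincomb D cos_H1per0) auto
    moreover have "AE x in circ. CC (k*h) (wderiv (\<lambda>x. cos (of_int 1 * x))) x = ?l 1 * cos (of_int 1 * x)"
      by (rule CC_wderiv_cos[OF D]) simp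
    moreover have "AE x in circ. CC (k*h) (wderiv (\<lambda>x. cos (of_int 2 * x))) x = ?l 2 * cos (of_int 2 * x)"
      by (rule CC_wderiv_cos[OF D]) simp
    ultimately show ?thesis by eventually_elim (simp only:)
  qed
  \<comment> \<open>With Q = g \<mu> + 2 g h the weight Q - 2 g (w + h) is g times \<open>G\<close>;
    the depth h cancels.\<close>
  define G where "G x = \<mu> - 2 * w x" for x
  define H where "H x = 1 / k + W x" for x
  have iw: "integrable circ w" "integrable circ (\<lambda>x. complex_of_real (w x))" using w by (rule H1per0_integrable)+
  have iW: "integrable circ W" "integrable circ (\<lambda>x. complex_of_real (W x))" using W(1) by (auto intro: L2per_integrable)
  have G: "integrable circ G" and H: "integrable circ H"
    unfolding G_def[abs_def] H_def[abs_def] using iw iW by simp_all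
  have const: "integrable circ (\<lambda>x. complex_of_real c * cis (of_int 0 * x))" for c by simp
  have G_coeff: "Re (fourier_coeff G n) = (if n = 0 then \<mu> else 0) - 2 * a n" for n
  proof -
    have "fourier_coeff G n = fc (\<lambda>x. of_real \<mu> * cis (of_int 0 * x) - 2 * of_real (w x)) n"
      by (simp add: fourier_coeff_fc G_def)
    also have "\<dots> = of_real \<mu> * (if n = 0 then 1 else 0) - 2 * of_real (a n)"
      using iw const[of \<mu>] unfolding a[symmetric] fourier_coeff_fc
      by (subst fc_diff) (simp_all only: fc_cmult fc_cis integrable_mult_right)
    finally show ?thesis by simp
  qed
  have H_coeff: "Re (fourier_coeff H n) = (if n = 0 then 1 / k else 0) + ?l n * a n" for n
  proof -
    have "fourier_coeff H n = fc (\<lambda>x. of_real (1 / k) * cis (of_int 0 * x) + of_real (W x)) n"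
      by (simp add: fourier_coeff_fc H_def)
    also have "\<dots> = of_real (1 / k) * (if n = 0 then 1 else 0) + of_real (?l n) * of_real (a n)"
      using iW const[of "1 / k"] unfolding W(2)[symmetric] unfolding fourier_coeff_fc
      by (subst fc_add) (simp_all only: fc_cmult fc_cis)
    finally show ?thesis by simp
  qed
  have "a 0 = 0" using H1per0D(4)[OF w] a[of 0] by simp
  have sumG: "(\<Sum>j\<le>4. p j * Re (fourier_coeff G (int j))) = \<mu> * p 0 - 2 * (p 1 * a 1 + p 2 * a 2 + p 3 * a 3 + p 4 * a 4)"
    using \<open>a 0 = 0\<close> unfolding G_coeff by (simp add: numeral_eq_Suc algebra_simps)
  have sumH: "(\<Sum>j\<le>4. q j * Re (fourier_coeff H (int j))) = q 0 / k + (q 1 * (?l 1 * a 1) + q 2 * (?l 2 * a 2) + q 3 * (?l 3 * a 3) + q 4 * (?l 4 * a 4))"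
    unfolding H_coeff by (simp add: numeral_eq_Suc algebra_simps)
  let ?Q = "g * \<mu> + 2 * g * h"
  have "(LINT x|circ. (?Q - 2 * g * (w x + h)) * ?u x * CC (k*h) (wderiv ?u) x - g * (?u x)\<^sup>2 * (1 / k + W x))
     = (LINT x|circ. g * (G x * cos_poly p x) - g * (H x * cos_poly q x))"
  proof (rule integral_cong_AE)
    have [measurable]: "w \<in> borel_measurable circ" "W \<in> borel_measurable circ" "CC (k*h) (wderiv ?u) \<in> borel_measurable circ"
      using iw iW L2per_integrable[OF CC_wderiv(1)[OF D u]] by auto
    have [measurable]: "(\<lambda>x. cos (of_int j * x)) \<in> borel_measurable circ" for j
      by (intro continuous_measurable_circ continuous_intros)
    show "(\<lambda>x. (?Q - 2 * g * (w x + h)) * ?u x * CC (k*h) (wderiv ?u) x - g * (?u x)\<^sup>2 * (1 / k + W x)) \<in> borel_measurable circ"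
      by measurable
    show "(\<lambda>x. g * (G x * cos_poly p x) - g * (H x * cos_poly q x)) \<in> borel_measurable circ"
      using LINT_mult_cos_poly(2)[OF G, of p] LINT_mult_cos_poly(2)[OF H, of q] by auto
    show "AE x in circ. (?Q - 2 * g * (w x + h)) * ?u x * CC (k*h) (wderiv ?u) x - g * (?u x)\<^sup>2 * (1 / k + W x)
        = g * (G x * cos_poly p x) - g * (H x * cos_poly q x)"
      using U
    proof eventually_elim
      case (elim x)
      have "(?Q - 2 * g * (w x + h)) * ?u x * CC (k*h) (wderiv ?u) x = g * (G x * (?u x * CC (k*h) (wderiv ?u) x))"
        by (simp only: G_def) algebra
      also have "\<dots> = g * (G x * cos_poly p x)" by (simp only: elim p_eq)
      finally have 1: "(?Q - 2 * g * (w x + h)) * ?u x * CC (k*h) (wderiv ?u) x = g * (G x * cos_poly p x)" .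
      have 2: "g * (?u x)\<^sup>2 * (1 / k + W x) = g * (H x * cos_poly q x)"
        unfolding q_eq H_def by (simp only: mult_ac)
      show ?case unfolding 1 2 ..
    qed
  qed
  also have "\<dots> = g * (LINT x|circ. G x * cos_poly p x) - g * (LINT x|circ. H x * cos_poly q x)"
    using LINT_mult_cos_poly(2)[OF G, of p] LINT_mult_cos_poly(2)[OF H, of q] by simp
  also have "\<dots> = pi * g * mode_form (k*h) k \<mu> a s"
  proof -
    define K where "K = inverse k"
    have K: "x / k = x * K" for x by (simp add: K_def divide_inverse)
    show ?thesis
      unfolding LINT_mult_cos_poly(1)[OF G] LINT_mult_cos_poly(1)[OF H] sumG sumH mode_form_def K
      by (simp add: p_def q_def field_simps power2_eq_square)
  qed
  finally show "second_var g h k m ?Q w ?u = 2 * pi * g * mode_form (k*h) k \<mu> a s"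
    unfolding second_var_eq[OF D w u] W_def by simp
qed

section \<open>Instability of the branch\<close>

text \<open>The threshold \<rho> depends on k and h alone, while the relative C2 error of the branch
  and the deviation of \<mu> from the critical value tend to 0; so the two-mode form becomes
  negative for all small nonzero parameters.\<close>

lemma branch_instability:
  assumes g: "g > 0" and h: "h > 0" and k: "k > 0" and \<alpha>: "0 < \<alpha>" "\<alpha> < 1"
    and br: "primary_even_branch h k \<alpha> \<epsilon>0 \<mu> w"
  shows "\<forall>\<^sub>F \<epsilon> in at 0. w \<epsilon> \<in> H1per0 \<and> solves_eq h k (\<mu> \<epsilon>) (w \<epsilon>) \<and>
     (\<exists>u\<in>H1per0. even_fun u \<and> second_var g h k m (g * \<mu> \<epsilon> + 2*g*h) (w \<epsilon>) u < 0)"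
proof -
  have D: "k * h > 0" using h k by simp
  have \<epsilon>0: "\<epsilon>0 > 0"
    and sol: "\<And>\<epsilon>. \<epsilon> \<in> {-\<epsilon>0<..<\<epsilon>0} \<Longrightarrow> w \<epsilon> \<in> C2per_e \<alpha> \<and> mean2pi (w \<epsilon>) = 0 \<and> solves_eq h k (\<mu> \<epsilon>) (w \<epsilon>)"
    and cont: "continuous_on {-\<epsilon>0<..<\<epsilon>0} \<mu>" and \<mu>0: "\<mu> 0 = tanh (k*h) / k"
    and lead: "((\<lambda>\<epsilon>. C2_norm \<alpha> (\<lambda>x. w \<epsilon> x - \<epsilon> * cos x) / \<bar>\<epsilon>\<bar>) \<longlongrightarrow> 0) (at 0)"
    using br unfolding primary_even_branch_def by auto
  have \<mu>1: "\<mu> 0 = 1 / (k * lam (k*h) 1)"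
    by (simp add: \<mu>0 tanh_eq_inverse_lam)
  obtain \<rho> where \<rho>: "\<rho> > 0" and neg: "\<forall>\<mu>' \<epsilon> \<delta> a. \<bar>\<mu>' - \<mu> 0\<bar> < \<rho> \<longrightarrow> 0 \<le> \<delta> \<longrightarrow> \<delta> < \<rho> \<longrightarrow> \<epsilon> \<noteq> 0 \<longrightarrow> \<bar>\<epsilon>\<bar> < 1 \<longrightarrow>
     a 0 = 0 \<longrightarrow> (\<forall>n. a (- n) = a n) \<longrightarrow> (\<forall>n. (of_int n)\<^sup>2 * \<bar>a n\<bar> \<le> 2 * \<bar>\<epsilon>\<bar>) \<longrightarrow>
     (\<forall>n. \<bar>n\<bar> \<ge> 2 \<longrightarrow> (of_int n)\<^sup>2 * \<bar>a n\<bar> \<le> \<delta> * \<bar>\<epsilon>\<bar>) \<longrightarrow> \<bar>a 1 - \<epsilon> / 2\<bar> \<le> \<delta> * \<bar>\<epsilon>\<bar> \<longrightarrow>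
     (\<forall>n. n \<noteq> 0 \<longrightarrow> (\<exists>A B. ((\<lambda>m. a m * (lam (k*h) (n - m) * a (n - m))) has_sum A) UNIV \<and>
        ((\<lambda>m. a m * a (n - m)) has_sum B) UNIV \<and>
        (\<mu>' * lam (k*h) n - 1 / k) * a n = A + lam (k*h) n / 2 * B \<and> of_int \<bar>n\<bar> * \<bar>B\<bar> \<le> 8 * \<epsilon>\<^sup>2)) \<longrightarrow>
     (\<exists>s. mode_form (k*h) k \<mu>' a s < 0)"
    using mode_form_negative[OF D k] unfolding \<mu>1[symmetric] by (elim exE conjE)
  have "isCont \<mu> 0"
    using cont \<epsilon>0 by (subst (asm) continuous_on_eq_continuous_at) auto
  then have "(\<mu> \<longlongrightarrow> \<mu> 0) (at 0)" by (simp add: isCont_def)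
  then have ev1: "\<forall>\<^sub>F \<epsilon> in at 0. \<bar>\<mu> \<epsilon> - \<mu> 0\<bar> < \<rho>"
    using \<rho> by (auto dest: tendstoD simp: dist_real_def)
  \<comment> \<open>The bound by \<rho> is what the two-mode argument needs; the bound by 1 gives
    the crude estimates 2 |\<epsilon>| for w, w' and n^2 |a_n|.\<close>
  have ev2: "\<forall>\<^sub>F \<epsilon> in at 0. C2_norm \<alpha> (\<lambda>x. w \<epsilon> x - \<epsilon> * cos x) / \<bar>\<epsilon>\<bar> < min \<rho> 1"
    using lead \<rho> by (intro order_tendstoD) auto
  have ev3: "\<forall>\<^sub>F \<epsilon>::real in at 0. \<epsilon> \<noteq> 0 \<and> \<bar>\<epsilon>\<bar> < min \<epsilon>0 1"
    unfolding eventually_at using \<epsilon>0 by (intro exI[of _ "min \<epsilon>0 1"]) (auto simp: dist_real_def)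
  from ev1 ev2 ev3 show ?thesis
  proof eventually_elim
    case (elim \<epsilon>)
    then have \<epsilon>: "\<epsilon> \<noteq> 0" "\<bar>\<epsilon>\<bar> < 1" "\<epsilon> \<in> {-\<epsilon>0<..<\<epsilon>0}" by auto
    note w = sol[OF \<epsilon>(3), THEN conjunct1] and mean = sol[OF \<epsilon>(3), THEN conjunct2, THEN conjunct1]
      and eq = sol[OF \<epsilon>(3), THEN conjunct2, THEN conjunct2]
    have wH: "w \<epsilon> \<in> H1per0" using w \<alpha>(1) mean by (rule C2per_e_H1per0)
    define r where "r x = w \<epsilon> x - \<epsilon> * cos x" for x
    have r: "r \<in> C2per_e \<alpha>" "deriv r = (\<lambda>x. deriv (w \<epsilon>) x + \<epsilon> * sin x)"
      unfolding r_def[abs_def] by (rule C2per_e_minus_cos[OF w \<alpha>])+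
    define \<delta> where "\<delta> = C2_norm \<alpha> r / \<bar>\<epsilon>\<bar>"
    have \<delta>_eq: "C2_norm \<alpha> r = \<delta> * \<bar>\<epsilon>\<bar>" using \<epsilon> by (simp add: \<delta>_def)
    have "0 \<le> C2_norm \<alpha> r" using C2_norm_bounds(1)[OF r(1) \<alpha>(1), of 0] by linarith
    then have \<delta>: "0 \<le> \<delta>" "\<delta> < \<rho>" "\<delta> \<le> 1"
      using elim(2) by (auto simp: \<delta>_def r_def[abs_def])
    have \<delta>\<epsilon>: "\<delta> * \<bar>\<epsilon>\<bar> \<le> 1 * \<bar>\<epsilon>\<bar>" using \<delta> by (intro mult_right_mono) auto
    define a where "a n = Re (fourier_coeff (w \<epsilon>) n)" for n
    note per = C2per_eD(1)[OF w \<alpha>(1)] and ev = C2per_eD(2)[OF w \<alpha>(1)]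
    have a: "fourier_coeff (w \<epsilon>) n = of_real (a n)" for n
      unfolding a_def by (rule even_fourier_coeff_real[OF ev per])
    \<comment> \<open>Coefficients of \<epsilon> cos x, so that a - c are those of the remainder
      \<open>r\<close>.\<close>
    define c where "c n = (if \<bar>n\<bar> = 1 then \<epsilon> / 2 else 0)" for n :: int
    have rc: "fourier_coeff r n = of_real (a n - c n)" for n
    proof -
      have "fourier_coeff r n = fc (\<lambda>x. of_real (w \<epsilon> x) - of_real \<epsilon> * of_real (cos (of_int 1 * x))) n"
        by (simp add: fourier_coeff_fc r_def)
      also have "\<dots> = fourier_coeff (w \<epsilon>) n - of_real \<epsilon> * fourier_coeff (\<lambda>x. cos (of_int 1 * x)) n"
        unfolding fourier_coeff_fc
        using H1per0_integrable(2)[OF wH] H1per0_integrable(2)[OF cos_H1per0[of 1]]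
        by (subst fc_diff) (simp_all only: fc_cmult integrable_mult_right zero_less_one)
      also have "\<dots> = of_real (a n - c n)"
        by (simp add: a c_def fourier_coeff_cos[of 1, simplified])
      finally show ?thesis .
    qed
    have r_bound: "\<bar>a n - c n\<bar> \<le> \<delta> * \<bar>\<epsilon>\<bar>" "(of_int n)\<^sup>2 * \<bar>a n - c n\<bar> \<le> \<delta> * \<bar>\<epsilon>\<bar>" for n
      using C2per_e_coeff_bound[OF r(1) \<alpha>(1) order_refl, of n]
      unfolding \<delta>_eq rc norm_of_real by simp_all
    have "\<exists>s. mode_form (k*h) k (\<mu> \<epsilon>) a s < 0"
    proof (rule neg[rule_format, OF elim(1) \<delta>(1,2) \<epsilon>(1,2)])
      show "a 0 = 0" using H1per0D(4)[OF wH] a[of 0] by simp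
      show "a (- n) = a n" for n using even_fourier_coeff[OF ev per, of n] by (simp add: a_def)
      show "(of_int n)\<^sup>2 * \<bar>a n\<bar> \<le> 2 * \<bar>\<epsilon>\<bar>" for n
      proof -
        have "(of_int n)\<^sup>2 * \<bar>c n\<bar> \<le> \<bar>\<epsilon>\<bar>" by (auto simp: c_def simp flip: of_int_abs power2_abs[of "real_of_int n"])
        moreover have "(of_int n)\<^sup>2 * \<bar>a n\<bar> \<le> (of_int n)\<^sup>2 * (\<bar>a n - c n\<bar> + \<bar>c n\<bar>)" by (intro mult_left_mono) auto
        ultimately show ?thesis using r_bound(2)[of n] \<delta>\<epsilon> by (simp add: distrib_left)
      qed
      show "(of_int n)\<^sup>2 * \<bar>a n\<bar> \<le> \<delta> * \<bar>\<epsilon>\<bar>" if "2 \<le> \<bar>n\<bar>" for n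
        using r_bound(2)[of n] that by (auto simp: c_def)
      show "\<bar>a 1 - \<epsilon> / 2\<bar> \<le> \<delta> * \<bar>\<epsilon>\<bar>" using r_bound(1)[of 1] by (simp add: c_def)
      fix n :: int assume n: "n \<noteq> 0"
      have N1: "\<bar>w \<epsilon> x\<bar> \<le> 2 * \<bar>\<epsilon>\<bar>" for x
      proof -
        have "\<bar>\<epsilon> * cos x\<bar> \<le> \<bar>\<epsilon>\<bar> * 1" unfolding abs_mult by (intro mult_left_mono) auto
        then show ?thesis
          using C2_norm_bounds(1)[OF r(1) \<alpha>(1), of x] \<delta>\<epsilon> unfolding \<delta>_eq r_def by linarith
      qed
      have N2: "\<bar>deriv (w \<epsilon>) x\<bar> \<le> 2 * \<bar>\<epsilon>\<bar>" for x
      proof -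
        have "\<bar>\<epsilon> * sin x\<bar> \<le> \<bar>\<epsilon>\<bar> * 1" unfolding abs_mult by (intro mult_left_mono) auto
        then show ?thesis
          using C2_norm_bounds(2)[OF r(1) \<alpha>(1), of x] \<delta>\<epsilon> unfolding \<delta>_eq r(2) by linarith
      qed
      obtain A B where "((\<lambda>m. a m * (lam (k*h) (n - m) * a (n - m))) has_sum A) UNIV"
        "((\<lambda>m. a m * a (n - m)) has_sum B) UNIV"
        "(\<mu> \<epsilon> * lam (k*h) n - 1 / k) * a n = A + lam (k*h) n / 2 * B"
        "of_int \<bar>n\<bar> * \<bar>B\<bar> \<le> 2 * (2 * \<bar>\<epsilon>\<bar>)\<^sup>2"
        by (rule solves_eq_real_fourier[OF D w \<alpha>(1) mean eq n N1 N2 a])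
      then show "\<exists>A B. ((\<lambda>m. a m * (lam (k*h) (n - m) * a (n - m))) has_sum A) UNIV \<and>
        ((\<lambda>m. a m * a (n - m)) has_sum B) UNIV \<and>
        (\<mu> \<epsilon> * lam (k*h) n - 1 / k) * a n = A + lam (k*h) n / 2 * B \<and> of_int \<bar>n\<bar> * \<bar>B\<bar> \<le> 8 * \<epsilon>\<^sup>2"
        by (intro exI[of _ A] exI[of _ B]) (simp add: power_mult_distrib)
    qed
    then obtain s where s: "mode_form (k*h) k (\<mu> \<epsilon>) a s < 0" ..
    let ?u = "\<lambda>x::real. cos (of_int 1 * x) + s * cos (of_int 2 * x)"
    have "second_var g h k m (g * \<mu> \<epsilon> + 2*g*h) (w \<epsilon>) ?u < 0"
      unfolding second_var_two_mode(2)[OF D wH a] using s g by (intro mult_pos_neg) auto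
    moreover have "even_fun ?u" by (simp add: even_fun_def)
    ultimately show ?case
      using wH eq second_var_two_mode(1)[OF D wH a, of s] by blast
  qed
qed

theorem theorem4p2:
  fixes g h k m \<alpha> :: real
  assumes "g > 0" "h > 0" "k > 0" and "0 < \<alpha>" "\<alpha> < 1"
  shows
    "(\<forall>Q. let \<mu> = (Q - 2*g*h) / g; \<mu>1 = tanh (k*h) / k in
        (\<mu> > \<mu>1 \<longrightarrow> strictly_variationally_stable g h k m Q (\<lambda>x. 0)) \<and>
        (\<mu> = \<mu>1 \<longrightarrow> weakly_variationally_stable g h k m Q (\<lambda>x. 0) \<and>
                    degenerate g h k m Q (\<lambda>x. 0) \<and>
                    second_var_kernel g h k m Q (\<lambda>x. 0) =
                      {\<lambda>x. a * cos x + b * sin x | a b. True}) \<and>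
        (\<mu> < \<mu>1 \<longrightarrow> variationally_unstable g h k m Q (\<lambda>x. 0)))
     \<and>
     (\<forall>\<epsilon>0 \<mu> w. primary_even_branch h k \<alpha> \<epsilon>0 \<mu> w \<longrightarrow>
        (\<forall>\<^sub>F \<epsilon> in at 0.
           (\<exists>u\<in>H1per0. even_fun u \<and>
              second_var g h k m (g * \<mu> \<epsilon> + 2*g*h) (w \<epsilon>) u < 0) \<and>
           variationally_unstable g h k m (g * \<mu> \<epsilon> + 2*g*h) (w \<epsilon>)))"
proof (intro conjI allI impI)
  fix Q
  show "let \<mu> = (Q - 2*g*h) / g; \<mu>1 = tanh (k*h) / k in
        (\<mu> > \<mu>1 \<longrightarrow> strictly_variationally_stable g h k m Q (\<lambda>x. 0)) \<and>
        (\<mu> = \<mu>1 \<longrightarrow> weakly_variationally_stable g h k m Q (\<lambda>x. 0) \<and>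
                    degenerate g h k m Q (\<lambda>x. 0) \<and>
                    second_var_kernel g h k m Q (\<lambda>x. 0) =
                      {\<lambda>x. a * cos x + b * sin x | a b. True}) \<and>
        (\<mu> < \<mu>1 \<longrightarrow> variationally_unstable g h k m Q (\<lambda>x. 0))"
    unfolding Let_def
    using zero_strictly_stable[OF assms(1-3) refl] zero_weakly_stable[OF assms(1-3) refl]
      zero_degenerate[OF assms(1-3) refl] zero_kernel[OF assms(1-3) refl] zero_unstable[OF assms(1-3) refl]
    by (intro conjI impI)
next
  fix \<epsilon>0 \<mu> w assume br: "primary_even_branch h k \<alpha> \<epsilon>0 \<mu> w"
  \<comment> \<open>Identifies the parameter in \<open>critical_point\<close> for this Q with \<mu>
    \<epsilon>, so that points of the branch are critical points.\<close>
  have \<mu>: "(g * \<mu> \<epsilon> + 2*g*h - 2*g*h) / g = \<mu> \<epsilon>" for \<epsilon> using assms(1) by simp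
  from branch_instability[OF assms br, of m]
  show "\<forall>\<^sub>F \<epsilon> in at 0.
           (\<exists>u\<in>H1per0. even_fun u \<and>
              second_var g h k m (g * \<mu> \<epsilon> + 2*g*h) (w \<epsilon>) u < 0) \<and>
           variationally_unstable g h k m (g * \<mu> \<epsilon> + 2*g*h) (w \<epsilon>)"
    by eventually_elim (unfold variationally_unstable_def critical_point_def \<mu>, blast)
qed

end
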